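(* Let $V$ be a uniformly random $d$-dimensional subspace of $\mathbb{R}^n$ with $n^{0.99}\le d\le n$, and let $\Pi_V$ be the orthogonal projection onto $V$. With probability $1-o_n(1)$ there exists a degree-4 SoS SDP solution $\mathcal{M}$ with $\frac1n\sum_{i,j\in[n]}(\Pi_V)_{ij}\,\mathcal{M}[\{i\},\{j\}]\ge1-o_n(1)$.
   Context: A degree-4 SoS SDP solution is a real matrix $\mathcal{M}$ with rows and columns indexed by subsets of $[n]$ of size at most $2$ such that $\mathcal{M}[S,T]=\mathcal{M}[S',T']$ whenever $S\Delta T=S'\Delta T'$, $\mathcal{M}[\emptyset,\emptyset]=1$, and $\mathcal{M}\succeq0$. The quantity $\frac1n\sum_{ij}(\Pi_V)_{ij}\mathcal{M}[\{i\},\{j\}]$ is its value as a relaxation of $\frac1n\max_{x\in\{\pm1\}^n}x^\top\Pi_Vx$. *)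

theory Defs
  imports
    "HOL-Probability.Probability"
    "HOL-Library.Landau_Symbols"
    "Jordan_Normal_Form.VS_Connect"
begin

text \<open>
  Since the dimension \<open>n\<close> varies inside the statement, \<open>\<real>\<^sup>n\<close> is \<open>carrier_vec n\<close> and the index set
  \<open>[n]\<close> is \<open>{..<n}\<close>.
\<close>

definition grassmannian :: "nat \<Rightarrow> nat \<Rightarrow> real vec set set" where
  "grassmannian n d =
     {V. VectorSpace.subspace class_ring V (module_vec TYPE(real) n) \<and>
         vectorspace.dim class_ring ((module_vec TYPE(real) n)\<lparr>carrier := V\<rparr>) = d}"

definition orth_proj :: "nat \<Rightarrow> real vec set \<Rightarrow> real mat" where
  "orth_proj n V =
     (THE P. P \<in> carrier_mat n n \<and>
        (\<forall>v\<in>carrier_vec n. P *\<^sub>v v \<in> V \<and> (\<forall>w\<in>V. scalar_prod (v - P *\<^sub>v v) w = 0)))"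

text \<open>
  The Borel \<open>\<sigma>\<close>-algebra of the Grassmannian, whose topology is the one induced by the embedding of
  \<open>V\<close> as its projection matrix.
\<close>

definition grassmannian_borel :: "nat \<Rightarrow> nat \<Rightarrow> real vec set measure" where
  "grassmannian_borel n d =
     vimage_algebra (grassmannian n d)
       (\<lambda>V. \<lambda>(i,j)\<in>{..<n} \<times> {..<n}. orth_proj n V $$ (i,j))
       (\<Pi>\<^sub>M ij\<in>{..<n} \<times> {..<n}. borel)"

text \<open>
  The orthogonal group acts transitively on the Grassmannian, so for \<open>d \<le> n\<close> exactly one
  probability measure is invariant under it; this is the law of a uniformly random subspace.
  (The library's \<open>orthogonal_mat\<close> does not require columns of norm 1, hence the explicit equation.)
\<close>

definition uniform_subspace_law :: "nat \<Rightarrow> nat \<Rightarrow> real vec set measure \<Rightarrow> bool" where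
  "uniform_subspace_law n d \<mu> \<longleftrightarrow>
     prob_space \<mu> \<and>
     space \<mu> = grassmannian n d \<and>
     sets \<mu> = sets (grassmannian_borel n d) \<and>
     (\<forall>Q\<in>carrier_mat n n. transpose_mat Q * Q = 1\<^sub>m n \<longrightarrow>
        distr \<mu> (grassmannian_borel n d) (\<lambda>V. (\<lambda>v. Q *\<^sub>v v) ` V) = \<mu>)"

definition psd_on :: "'a set \<Rightarrow> ('a \<Rightarrow> 'a \<Rightarrow> real) \<Rightarrow> bool" where
  "psd_on I M \<longleftrightarrow>
     (\<forall>S\<in>I. \<forall>T\<in>I. M S T = M T S) \<and>
     (\<forall>c. (\<Sum>S\<in>I. \<Sum>T\<in>I. c S * M S T * c T) \<ge> 0)"

definition subsets_upto2 :: "nat \<Rightarrow> nat set set" where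
  "subsets_upto2 n = {S. S \<subseteq> {..<n} \<and> card S \<le> 2}"

text \<open>Entries of \<open>M\<close> outside the index set \<open>subsets_upto2 n\<close> are irrelevant.\<close>

definition sos4_solution :: "nat \<Rightarrow> (nat set \<Rightarrow> nat set \<Rightarrow> real) \<Rightarrow> bool" where
  "sos4_solution n M \<longleftrightarrow>
     (\<forall>S\<in>subsets_upto2 n. \<forall>T\<in>subsets_upto2 n. \<forall>S'\<in>subsets_upto2 n. \<forall>T'\<in>subsets_upto2 n.
        sym_diff S T = sym_diff S' T' \<longrightarrow> M S T = M S' T') \<and>
     M {} {} = 1 \<and>
     psd_on (subsets_upto2 n) M"

definition sos4_value :: "nat \<Rightarrow> real mat \<Rightarrow> (nat set \<Rightarrow> nat set \<Rightarrow> real) \<Rightarrow> real" where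
  "sos4_value n A M = (1 / real n) * (\<Sum>i<n. \<Sum>j<n. A $$ (i,j) * M {i} {j})"

end

theory Submission
  imports Defs "Jordan_Normal_Form.Gram_Schmidt" "HOL-Real_Asymp.Real_Asymp"
begin

text \<open>
  Let \<open>p\<close> be the projection onto \<open>V\<close> and \<open>A = (n/d) p\<close>. The pseudo-moments are those of a Gaussian
  vector with covariance \<open>A\<close>, conditioned to have \<open>x\<^sub>i\<^sup>2 = 1\<close>: the degree-2 moments are
  \<open>A\<^sub>i\<^sub>j\<close>, and up to lower order terms the degree-4 moments are
  \<open>A\<^sub>i\<^sub>j A\<^sub>k\<^sub>l + A\<^sub>i\<^sub>k A\<^sub>j\<^sub>l + A\<^sub>i\<^sub>l A\<^sub>j\<^sub>k - 2 \<Sum>\<^sub>a A\<^sub>i\<^sub>a A\<^sub>j\<^sub>a A\<^sub>k\<^sub>a A\<^sub>l\<^sub>a\<close>. The quadratic form of this matrix is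
  nonnegative up to a small multiple of the identity as soon as the entries of \<open>A - 1\<close> are small and
  the entrywise square of \<open>p\<close> acts on the orthogonal complement of the constants almost as a
  multiple \<open>(d/n)\<^sup>2\<close> of the identity. Mixing with the moments of the uniform distribution on the cube
  absorbs the error.

  Both conditions only need the invariance of the law of \<open>p\<close> under conjugation by plane rotations. It
  gives the recursion for the moments of an off-diagonal entry. The difference of two diagonal entries
  has the law of twice an off-diagonal one. The square of the off-diagonal part of \<open>(p\<^sub>i\<^sub>j\<^sup>2)\<close> has the
  entries \<open>\<Sum>\<^sub>c p\<^sub>a\<^sub>c\<^sup>2 p\<^sub>b\<^sub>c\<^sup>2\<close>; these concentrate around a constant in mean square, and a constant
  matrix vanishes on the complement of the constants.
\<close>

section \<open>Subspaces and their orthogonal projections\<close>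

text \<open>Entries may depend only on the symmetric difference of their labels. This forces a
  fourth moment symmetric in its four indices. It also fixes the value on overlapping labels by
  x_i^2 = 1; the mismatch with the Gaussian formula is an error controlled by the deviation of A
  from the identity.

  Why the entrywise square of p is squared once more: write \<epsilon> = d/n. Heuristically each
  off-diagonal p_ij^2 fluctuates by about its mean (\<epsilon> - \<epsilon>^2)/n, so the centred
  off-diagonal part has Frobenius norm of order \<epsilon> - \<epsilon>^2. The error must be small
  against \<epsilon>^2, so this is useless. An entry of the square averages over n columns; the
  total mean-square deviation of all these entries is O(r), where r is the bound on the off-diagonal
  entries. Their Frobenius norm is then a negative power of n, and its square root still beats
  \<epsilon>^2.

  All losses are fixed powers of n/d \<le> n^0.01, all gains fixed powers of n. Hence crude
  constants and moments of one fixed order suffice.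

  The event quantifies over uncountably many matrices; its measurability needs a compactness
  argument.\<close>

definition mat_range :: "real mat \<Rightarrow> real vec set" where
  "mat_range B = (\<lambda>x. B *\<^sub>v x) ` carrier_vec (dim_col B)"

text \<open>The difference of the two images of a vector lies in \<open>V\<close> and is orthogonal
  to \<open>V\<close>, hence to itself. This is the uniqueness half of the \<open>THE\<close> in
  \<open>orth_proj\<close>.\<close>

lemma orth_proj_unique:
  fixes P P' :: "real mat"
  assumes V: "V \<subseteq> carrier_vec n" "\<And>v w. v \<in> V \<Longrightarrow> w \<in> V \<Longrightarrow> v - w \<in> V"
    and P: "P \<in> carrier_mat n n"
      "\<And>v. v \<in> carrier_vec n \<Longrightarrow> P *\<^sub>v v \<in> V \<and> (\<forall>w\<in>V. scalar_prod (v - P *\<^sub>v v) w = 0)"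
    and P': "P' \<in> carrier_mat n n"
      "\<And>v. v \<in> carrier_vec n \<Longrightarrow> P' *\<^sub>v v \<in> V \<and> (\<forall>w\<in>V. scalar_prod (v - P' *\<^sub>v v) w = 0)"
  shows "P = P'"
proof (rule eq_matI)
  show "dim_row P = dim_row P'" "dim_col P = dim_col P'" using P P' by auto
  fix i j assume "i < dim_row P'" "j < dim_col P'"
  hence ij: "i < n" "j < n" using P' by auto
  let ?v = "unit_vec n j :: real vec"
  have v: "?v \<in> carrier_vec n" by simp
  have c: "P *\<^sub>v ?v \<in> carrier_vec n" "P' *\<^sub>v ?v \<in> carrier_vec n" using P P' v by auto
  let ?u = "P *\<^sub>v ?v - P' *\<^sub>v ?v"
  have u: "?u \<in> V" using V(2) P(2)[OF v] P'(2)[OF v] by blast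
  have uc: "?u \<in> carrier_vec n" using c by simp
  have "scalar_prod ?u ?u = scalar_prod ((?v - P' *\<^sub>v ?v) - (?v - P *\<^sub>v ?v)) ?u"
    by (rule arg_cong[where f = "\<lambda>x. scalar_prod x ?u"], rule eq_vecI) (use c P(1) P'(1) in \<open>auto simp del: index_mult_mat_vec\<close>)
  also have "\<dots> = scalar_prod (?v - P' *\<^sub>v ?v) ?u - scalar_prod (?v - P *\<^sub>v ?v) ?u"
    by (rule minus_scalar_prod_distrib[of _ n]) (use c uc v in auto)
  also have "\<dots> = 0" using P(2)[OF v] P'(2)[OF v] u by simp
  finally have "?u = 0\<^sub>v n" 
    using conjugate_square_eq_0_vec[OF uc] by (simp only: vec_conjugate_real simp_thms)
  hence "(P *\<^sub>v ?v) $ i = (P' *\<^sub>v ?v) $ i" using ij c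
    by (metis carrier_vecD eq_iff_diff_eq_0 index_minus_vec(1) index_zero_vec(1))
  thus "P $$ (i,j) = P' $$ (i,j)" using ij P(1) P'(1) by (simp add: scalar_prod_right_unit)
qed


lemma mat_range_subset:
  "B \<in> carrier_mat n d \<Longrightarrow> mat_range B \<subseteq> carrier_vec n"
  by (auto simp: mat_range_def)

lemma mat_range_minus:
  assumes B: "B \<in> carrier_mat n d" and "v \<in> mat_range B" "w \<in> mat_range B"
  shows "v - w \<in> mat_range B"
proof -
  obtain x y where "x \<in> carrier_vec d" "y \<in> carrier_vec d" "v = B *\<^sub>v x" "w = B *\<^sub>v y"
    using assms by (auto simp: mat_range_def)
  with B show ?thesis by (auto simp: mat_range_def mult_minus_distrib_mat_vec[symmetric] intro!: image_eqI)
qed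

lemma orth_proj_mat_range:
  assumes B: "B \<in> carrier_mat n d" and o: "transpose_mat B * B = 1\<^sub>m d"
  shows "orth_proj n (mat_range B) = B * transpose_mat B"
proof -
  have Bt: "transpose_mat B \<in> carrier_mat d n" using B by simp
  have P: "(B * transpose_mat B) *\<^sub>v v \<in> mat_range B \<and>
      (\<forall>w\<in>mat_range B. scalar_prod (v - (B * transpose_mat B) *\<^sub>v v) w = 0)"
    if v: "v \<in> carrier_vec n" for v
  proof (intro conjI ballI)
    have e: "(B * transpose_mat B) *\<^sub>v v = B *\<^sub>v (transpose_mat B *\<^sub>v v)"
      using B Bt v by (rule assoc_mult_mat_vec)
    have tv: "transpose_mat B *\<^sub>v v \<in> carrier_vec d" using Bt v by simp
    show "(B * transpose_mat B) *\<^sub>v v \<in> mat_range B"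
      unfolding e mat_range_def using tv B by auto
    fix w assume "w \<in> mat_range B"
    then obtain x where x: "x \<in> carrier_vec d" and w: "w = B *\<^sub>v x"
      using B by (auto simp: mat_range_def)
    have c: "v - B *\<^sub>v (transpose_mat B *\<^sub>v v) \<in> carrier_vec n" using v B tv by simp
    have "scalar_prod (v - B *\<^sub>v (transpose_mat B *\<^sub>v v)) (B *\<^sub>v x)
        = scalar_prod (transpose_mat B *\<^sub>v (v - B *\<^sub>v (transpose_mat B *\<^sub>v v))) x"
      using transpose_vec_mult_scalar[OF B x c] by simp
    also have "transpose_mat B *\<^sub>v (v - B *\<^sub>v (transpose_mat B *\<^sub>v v))
       = transpose_mat B *\<^sub>v v - (transpose_mat B * B) *\<^sub>v (transpose_mat B *\<^sub>v v)"
      using mult_minus_distrib_mat_vec[OF Bt v, of "B *\<^sub>v (transpose_mat B *\<^sub>v v)"] 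
        assoc_mult_mat_vec[OF Bt B tv] B tv by simp
    also have "\<dots> = 0\<^sub>v d" using tv o by simp
    finally show "scalar_prod (v - (B * transpose_mat B) *\<^sub>v v) w = 0" using e w x by simp
  qed
  show ?thesis unfolding orth_proj_def
  proof (rule the_equality)
    show "B * transpose_mat B \<in> carrier_mat n n \<and> (\<forall>v\<in>carrier_vec n. B * transpose_mat B *\<^sub>v v \<in> mat_range B \<and>
        (\<forall>w\<in>mat_range B. scalar_prod (v - B * transpose_mat B *\<^sub>v v) w = 0))"
      using P B Bt by auto
    fix Q assume "Q \<in> carrier_mat n n \<and> (\<forall>v\<in>carrier_vec n. Q *\<^sub>v v \<in> mat_range B \<and>
        (\<forall>w\<in>mat_range B. scalar_prod (v - Q *\<^sub>v v) w = 0))"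
    thus "Q = B * transpose_mat B"
      using orth_proj_unique[OF mat_range_subset[OF B] mat_range_minus[OF B], of Q "B * transpose_mat B"] P B Bt
      by auto
  qed
qed

lemma subspace_mat_range:
  assumes B: "(B :: real mat) \<in> carrier_mat n d"
  shows "VectorSpace.subspace class_ring (mat_range B) (module_vec TYPE(real) n)"
proof -
  interpret vec_space "TYPE(real)" n .
  show ?thesis
  proof (unfold VectorSpace.subspace_def, intro conjI)
    show "vectorspace class_ring (module_vec TYPE(real) n)" by (rule vec_vs)
    show "submodule class_ring (mat_range B) (module_vec TYPE(real) n)"
    proof (unfold submodule_def, intro conjI allI impI)
      show "Module.module class_ring (module_vec TYPE(real) n)" by (rule vec_module)
      show "mat_range B \<subseteq> carrier V" using mat_range_subset[OF B] by simp
      show "\<zero>\<^bsub>V\<^esub> \<in> mat_range B"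
        using B by (auto simp: mat_range_def intro!: image_eqI[of _ _ "0\<^sub>v d"])
    next
      fix v w assume "v \<in> mat_range B" "w \<in> mat_range B"
      then obtain x y where "x \<in> carrier_vec d" "y \<in> carrier_vec d" "v = B *\<^sub>v x" "w = B *\<^sub>v y"
        using assms by (auto simp: mat_range_def)
      thus "v \<oplus>\<^bsub>V\<^esub> w \<in> mat_range B" using B
        by (auto simp: mat_range_def mult_add_distrib_mat_vec[symmetric] intro!: image_eqI)
    next
      fix c :: real and v assume "c \<in> carrier class_ring" "v \<in> mat_range B"
      then obtain x where "x \<in> carrier_vec d" "v = B *\<^sub>v x"
        using assms by (auto simp: mat_range_def)
      thus "c \<odot>\<^bsub>V\<^esub> v \<in> mat_range B" using B
        by (auto simp: mat_range_def mult_mat_vec[symmetric] intro!: image_eqI)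
    qed
  qed
qed

text \<open>An independent subset of \<open>W\<close> has at most \<open>n\<close> elements, so a
  maximal one exists. Independence and span agree in \<open>W\<close> and in the ambient space, so
  it is a basis of \<open>W\<close>; Gram-Schmidt makes it orthogonal and division by the norms
  \<open>r j\<close> orthonormal.\<close>

lemma subspace_orthonormal_basis:
  fixes W :: "real vec set"
  assumes W: "VectorSpace.subspace class_ring W (module_vec TYPE(real) n)"
  shows "\<exists>B \<in> carrier_mat n (vectorspace.dim class_ring ((module_vec TYPE(real) n)\<lparr>carrier := W\<rparr>)).
    transpose_mat B * B = 1\<^sub>m (vectorspace.dim class_ring ((module_vec TYPE(real) n)\<lparr>carrier := W\<rparr>)) \<and> W = mat_range B"
proof -
  interpret cof_vec_space n "TYPE(real)" .
  interpret W: vectorspace class_ring "vs W" by (rule subspace_is_vs[OF W])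
  have sm: "submodule class_ring W V" using W by (simp add: VectorSpace.subspace_def)
  have WV: "W \<subseteq> carrier_vec n" using sm by (simp add: submodule_def)
  have spW: "W.span S = span S" "W.lin_dep S = lin_dep S" if "S \<subseteq> W" for S
    using span_li_not_depend[OF that sm] by auto
  have "\<exists>A. finite A \<and> maximal A (\<lambda>S. S \<subseteq> W \<and> \<not> lin_dep S)"
  proof (rule maximal_exists[where N = n and B = "{}"])
    fix A assume "A \<subseteq> W \<and> \<not> lin_dep A"
    thus "finite A \<and> card A \<le> n" using li_le_dim[OF fin_dim, of A] WV dim_is_n by auto
  next
    show "{} \<subseteq> W \<and> \<not> lin_dep {}" by (auto simp: lin_dep_def)
  qed
  then obtain A where finA: "finite A" and maxA: "maximal A (\<lambda>S. S \<subseteq> W \<and> \<not> lin_dep S)" by auto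
  have AW: "A \<subseteq> W" and liA: "\<not> lin_dep A" using maxA by (auto simp: maximal_def)
  have "maximal A (\<lambda>S. S \<subseteq> carrier (vs W) \<and> \<not> W.lin_dep S)"
  proof -
    have "(\<lambda>S. S \<subseteq> carrier (vs W) \<and> \<not> W.lin_dep S) = (\<lambda>S. S \<subseteq> W \<and> \<not> lin_dep S)"
    proof
      fix S show "(S \<subseteq> carrier (vs W) \<and> \<not> W.lin_dep S) = (S \<subseteq> W \<and> \<not> lin_dep S)"
        using spW(2)[of S] by (cases "S \<subseteq> W") simp_all
    qed
    thus ?thesis using maxA by (simp only:)
  qed
  hence bA: "W.basis A" by (rule W.max_li_is_basis)
  have cA: "card A = W.dim" using W.dim_basis[OF finA bA] by simp
  have spA: "span A = W" using bA spW(1)[OF AW] by (simp add: W.basis_def)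
  obtain ws where ws: "set ws = A" "distinct ws" using finite_distinct_list[OF finA] by auto
  let ?us = "gram_schmidt n ws"
  have wsc: "set ws \<subseteq> carrier_vec n" using ws AW WV by auto
  note gs = gram_schmidt_result[OF wsc ws(2) _ refl]
  have us: "span (set ?us) = W" "corthogonal ?us" "set ?us \<subseteq> carrier_vec n" "length ?us = W.dim"
    using gs ws liA spA cA distinct_card[OF ws(2)] by auto
  define d where "d = W.dim"
  define r where "r j = sqrt (scalar_prod (?us ! j) (?us ! j))" for j
  have usc: "?us ! j \<in> carrier_vec n" if "j < d" for j using us that by (auto simp: d_def)
  have ort: "scalar_prod (?us ! i) (?us ! j) = 0 \<longleftrightarrow> i \<noteq> j" if "i < d" "j < d" for i j
    using corthogonalD[OF us(2), of i j] us(4) that by (simp add: d_def)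
  have rpos: "r j > 0" if "j < d" for j
  proof -
    have "scalar_prod (?us ! j) (?us ! j) \<ge> 0" by (auto simp: scalar_prod_def intro!: sum_nonneg)
    thus ?thesis using ort[OF that that] by (simp add: r_def less_le)
  qed
  define B where "B = mat n d (\<lambda>(i,j). ?us ! j $ i / r j)"
  have B: "B \<in> carrier_mat n d" by (simp add: B_def)
  have colB: "col B j = (1 / r j) \<cdot>\<^sub>v (?us ! j)" if "j < d" for j
    using usc[OF that] that by (intro eq_vecI) (auto simp: B_def)
  have "transpose_mat B * B = 1\<^sub>m d"
  proof (rule eq_matI)
    fix i j assume "i < dim_row (1\<^sub>m d :: real mat)" "j < dim_col (1\<^sub>m d :: real mat)"
    hence ij: "i < d" "j < d" by auto
    have "(transpose_mat B * B) $$ (i,j) = scalar_prod (col B i) (col B j)" using ij B by simp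
    also have "\<dots> = (1 / r i) * (1 / r j) * scalar_prod (?us ! i) (?us ! j)"
      using colB ij usc[OF ij(1)] usc[OF ij(2)] by (simp add: smult_scalar_prod_distrib[of _ n] scalar_prod_smult_distrib[of _ n])
    also have "\<dots> = (1\<^sub>m d :: real mat) $$ (i,j)"
    proof (cases "i = j")
      case True
      have "scalar_prod (?us ! j) (?us ! j) = r j * r j"
        using rpos[OF ij(2)] unfolding r_def by (metis abs_of_pos real_sqrt_abs2 real_sqrt_mult_self real_sqrt_gt_0_iff abs_of_nonneg less_eq_real_def)
      thus ?thesis using True ij rpos[OF ij(2)] by simp
    next
      case False thus ?thesis using ort[OF ij] ij by simp
    qed
    finally show "(transpose_mat B * B) $$ (i,j) = (1\<^sub>m d :: real mat) $$ (i,j)" .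
  qed (auto simp: B_def)
  moreover have "W = mat_range B"
  proof -
    have usd: "\<forall>w\<in>set ?us. dim_vec w = n" using us(3) by auto
    have W1: "W = span_list ?us" using us(1) span_list_as_span[OF us(3)] by simp
    have key: "lincomb_list c (gram_schmidt n ws) = B *\<^sub>v vec d (\<lambda>j. c j * r j)" for c
      unfolding lincomb_list_as_mat_mult[OF usd] using us(4) rpos
      by (intro eq_vecI) (auto simp: B_def d_def scalar_prod_def mat_of_cols_def less_imp_neq[THEN not_sym] intro!: sum.cong)
    show ?thesis
    proof (intro equalityI subsetI)
      fix w assume "w \<in> W"
      then obtain c where "w = lincomb_list c ?us" using W1 by (auto simp: span_list_def)
      thus "w \<in> mat_range B" using key B by (auto simp: mat_range_def)
    next
      fix w assume "w \<in> mat_range B"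
      then obtain x where x: "x \<in> carrier_vec d" "w = B *\<^sub>v x" using B by (auto simp: mat_range_def)
      have "vec d (\<lambda>j. x $ j / r j * r j) = x" using x rpos by (intro eq_vecI) (auto simp: less_imp_neq[THEN not_sym])
      hence "w = lincomb_list (\<lambda>j. x $ j / r j) ?us" using key x by simp
      thus "w \<in> W" unfolding W1 by (auto simp: span_list_def)
    qed
  qed
  ultimately show ?thesis using B unfolding d_def by blast
qed


lemma trace_mult_transpose:
  assumes B: "(B :: real mat) \<in> carrier_mat n d" and o: "transpose_mat B * B = 1\<^sub>m d"
  shows "(\<Sum>i<n. (B * transpose_mat B) $$ (i,i)) = real d"
proof -
  have "(\<Sum>i<n. (B * transpose_mat B) $$ (i,i)) = (\<Sum>i<n. \<Sum>j<d. B $$ (i,j) * B $$ (i,j))"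
    using B by (intro sum.cong) (auto simp: scalar_prod_def atLeast0LessThan)
  also have "\<dots> = (\<Sum>j<d. \<Sum>i<n. B $$ (i,j) * B $$ (i,j))" by (rule sum.swap)
  also have "\<dots> = (\<Sum>j<d. (transpose_mat B * B) $$ (j,j))"
    using B by (intro sum.cong) (auto simp: scalar_prod_def atLeast0LessThan)
  also have "\<dots> = real d" unfolding o by simp
  finally show ?thesis .
qed

text \<open>For the converse, \<open>mat_range B\<close> also has an orthonormal basis of the size
  of its dimension. Both bases yield the same projection, and its trace counts the columns of either
  one.\<close>

lemma grassmannian_iff:
  "V \<in> grassmannian n d \<longleftrightarrow>
    (\<exists>B\<in>carrier_mat n d. transpose_mat B * B = 1\<^sub>m d \<and> V = mat_range B)"
proof
  assume "V \<in> grassmannian n d"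
  thus "\<exists>B\<in>carrier_mat n d. transpose_mat B * B = 1\<^sub>m d \<and> V = mat_range B"
    using subspace_orthonormal_basis unfolding grassmannian_def by blast
next
  assume "\<exists>B\<in>carrier_mat n d. transpose_mat B * B = 1\<^sub>m d \<and> V = mat_range B"
  then obtain B where B: "B \<in> carrier_mat n d" "transpose_mat B * B = 1\<^sub>m d" "V = mat_range B" by blast
  have sub: "VectorSpace.subspace class_ring V (module_vec TYPE(real) n)"
    using subspace_mat_range[OF B(1)] B(3) by simp
  define d' where "d' = vectorspace.dim class_ring ((module_vec TYPE(real) n)\<lparr>carrier := V\<rparr>)"
  obtain B' where B': "B' \<in> carrier_mat n d'" "transpose_mat B' * B' = 1\<^sub>m d'" "V = mat_range B'"
    using subspace_orthonormal_basis[OF sub] unfolding d'_def by blast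
  have "B * transpose_mat B = B' * transpose_mat B'"
    using orth_proj_mat_range[OF B(1,2)] orth_proj_mat_range[OF B'(1,2)] B(3) B'(3) by simp
  hence "real d = real d'"
    using trace_mult_transpose[OF B(1,2)] trace_mult_transpose[OF B'(1,2)] by simp
  thus "V \<in> grassmannian n d" using sub unfolding grassmannian_def d'_def by simp
qed

text \<open>Size, symmetry, idempotence and trace: the later analysis sees a single subspace only
  through these facts.\<close>

lemma grassmannian_orth_proj:
  assumes "V \<in> grassmannian n d"
  shows "orth_proj n V \<in> carrier_mat n n"
    and "\<And>i j. i < n \<Longrightarrow> j < n \<Longrightarrow> orth_proj n V $$ (i,j) = orth_proj n V $$ (j,i)"
    and "\<And>i j. i < n \<Longrightarrow> j < n \<Longrightarrow>
      (\<Sum>k<n. orth_proj n V $$ (i,k) * orth_proj n V $$ (k,j)) = orth_proj n V $$ (i,j)"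
    and "(\<Sum>i<n. orth_proj n V $$ (i,i)) = real d"
proof -
  obtain B where B: "B \<in> carrier_mat n d" "transpose_mat B * B = 1\<^sub>m d" "V = mat_range B"
    using assms grassmannian_iff by blast
  have P: "orth_proj n V = B * transpose_mat B" using orth_proj_mat_range B by simp
  have Bt: "transpose_mat B \<in> carrier_mat d n" using B by simp
  show c: "orth_proj n V \<in> carrier_mat n n" using P B by simp
  have "transpose_mat (orth_proj n V) = orth_proj n V"
    unfolding P using transpose_mult[OF B(1) Bt] by simp
  thus "orth_proj n V $$ (i,j) = orth_proj n V $$ (j,i)" if "i < n" "j < n" for i j
    using that c by (metis carrier_matD index_transpose_mat(1))
  have "orth_proj n V * orth_proj n V = B * ((transpose_mat B * B) * transpose_mat B)"
    unfolding P using B(1) Bt by (simp add: assoc_mult_mat[of _ n d _ n _ n] assoc_mult_mat[of _ d n _ d _ n])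
  also have "\<dots> = orth_proj n V" unfolding P B(2) using Bt by simp
  finally have idem: "orth_proj n V * orth_proj n V = orth_proj n V" .
  show "(\<Sum>k<n. orth_proj n V $$ (i,k) * orth_proj n V $$ (k,j)) = orth_proj n V $$ (i,j)"
    if "i < n" "j < n" for i j
  proof -
    have "(\<Sum>k<n. orth_proj n V $$ (i,k) * orth_proj n V $$ (k,j)) = (orth_proj n V * orth_proj n V) $$ (i,j)"
      using that c by (auto simp: scalar_prod_def atLeast0LessThan intro!: sum.cong)
    thus ?thesis by (simp only: idem)
  qed
  show "(\<Sum>i<n. orth_proj n V $$ (i,i)) = real d"
    unfolding P by (rule trace_mult_transpose[OF B(1,2)])
qed

lemma grassmannian_orthogonal_image:
  assumes V: "V \<in> grassmannian n d" and Q: "Q \<in> carrier_mat n n" "transpose_mat Q * Q = 1\<^sub>m n"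
  shows "(\<lambda>v. Q *\<^sub>v v) ` V \<in> grassmannian n d"
    and "orth_proj n ((\<lambda>v. Q *\<^sub>v v) ` V) = Q * orth_proj n V * transpose_mat Q"
proof -
  obtain B where B: "B \<in> carrier_mat n d" "transpose_mat B * B = 1\<^sub>m d" "V = mat_range B"
    using V grassmannian_iff by blast
  have Bt: "transpose_mat B \<in> carrier_mat d n" and Qt: "transpose_mat Q \<in> carrier_mat n n" using B Q by auto
  have QB: "Q * B \<in> carrier_mat n d" using B Q by simp
  have im: "(\<lambda>v. Q *\<^sub>v v) ` V = mat_range (Q * B)"
    unfolding B(3) mat_range_def image_image using B(1) Q(1)
    by (intro image_cong) (auto simp: assoc_mult_mat_vec[of _ n n _ d])
  have "transpose_mat (Q * B) * (Q * B) = transpose_mat B * ((transpose_mat Q * Q) * B)"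
    unfolding transpose_mult[OF Q(1) B(1)] using Q(1) B(1) Bt Qt
    by (simp add: assoc_mult_mat[of _ d n _ n _ d] assoc_mult_mat[of _ n n _ n _ d])
  also have "\<dots> = 1\<^sub>m d" unfolding Q(2) using B by simp
  finally have o: "transpose_mat (Q * B) * (Q * B) = 1\<^sub>m d" .
  show "(\<lambda>v. Q *\<^sub>v v) ` V \<in> grassmannian n d" using grassmannian_iff im o QB by blast
  show "orth_proj n ((\<lambda>v. Q *\<^sub>v v) ` V) = Q * orth_proj n V * transpose_mat Q"
  proof -
    have "orth_proj n ((\<lambda>v. Q *\<^sub>v v) ` V) = Q * B * transpose_mat (Q * B)"
      by (simp only: im orth_proj_mat_range[OF QB o])
    also have "\<dots> = Q * (B * transpose_mat B) * transpose_mat Q"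
      unfolding transpose_mult[OF Q(1) B(1)] using Q(1) B(1) Bt Qt
      by (simp add: assoc_mult_mat[of _ n d _ n _ n] assoc_mult_mat[of _ n n _ d _ n] assoc_mult_mat[of _ n n _ n _ n])
    finally show ?thesis unfolding B(3) orth_proj_mat_range[OF B(1,2)] .
  qed
qed

section \<open>Forms in the entries of a projection matrix\<close>

text \<open>Matrices become plain functions of two indices. Only indices below \<open>n\<close>
  enter the sums, so no carrier conditions arise.\<close>

definition mmult :: "nat \<Rightarrow> (nat \<Rightarrow> nat \<Rightarrow> real) \<Rightarrow> (nat \<Rightarrow> nat \<Rightarrow> real) \<Rightarrow> nat \<Rightarrow> nat \<Rightarrow> real" where
  "mmult n f g i j = (\<Sum>k<n. f i k * g k j)"

definition frob :: "nat \<Rightarrow> (nat \<Rightarrow> nat \<Rightarrow> real) \<Rightarrow> (nat \<Rightarrow> nat \<Rightarrow> real) \<Rightarrow> real" where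
  "frob n f g = (\<Sum>i<n. \<Sum>j<n. f i j * g i j)"

lemma mmult_assoc: "mmult n (mmult n f g) h = mmult n f (mmult n g h)"
proof (intro ext)
  fix i j
  have "mmult n (mmult n f g) h i j = (\<Sum>k<n. \<Sum>l<n. f i l * g l k * h k j)"
    by (simp add: mmult_def sum_distrib_right)
  also have "\<dots> = (\<Sum>l<n. \<Sum>k<n. f i l * g l k * h k j)" by (rule sum.swap)
  also have "\<dots> = mmult n f (mmult n g h) i j"
    by (simp add: mmult_def sum_distrib_left mult.assoc)
  finally show "mmult n (mmult n f g) h i j = mmult n f (mmult n g h) i j" .
qed

lemma frob_cong: "(\<And>i j. i < n \<Longrightarrow> j < n \<Longrightarrow> f i j = f' i j) \<Longrightarrow> (\<And>i j. i < n \<Longrightarrow> j < n \<Longrightarrow> g i j = g' i j)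
    \<Longrightarrow> frob n f g = frob n f' g'"
  by (simp add: frob_def)

lemma mmult_cong: "(\<And>k. k < n \<Longrightarrow> f i k = f' i k) \<Longrightarrow> (\<And>k. k < n \<Longrightarrow> g k j = g' k j) \<Longrightarrow> mmult n f g i j = mmult n f' g' i j"
  by (simp add: mmult_def)

lemma frob_commute: "frob n f g = frob n g f"
  by (simp add: frob_def mult.commute)

lemma frob_nonneg: "frob n f f \<ge> 0"
  by (auto simp: frob_def intro!: sum_nonneg)

lemma frob_mult_left:
  assumes "\<And>i j. i < n \<Longrightarrow> j < n \<Longrightarrow> p i j = p j i"
  shows "frob n (mmult n p f) h = frob n f (mmult n p h)"
proof -
  have "frob n (mmult n p f) h = (\<Sum>i<n. \<Sum>j<n. \<Sum>k<n. p i k * f k j * h i j)"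
    by (simp add: frob_def mmult_def sum_distrib_right)
  also have "\<dots> = (\<Sum>j<n. \<Sum>i<n. \<Sum>k<n. p i k * f k j * h i j)" by (rule sum.swap)
  also have "\<dots> = (\<Sum>j<n. \<Sum>k<n. \<Sum>i<n. p i k * f k j * h i j)"
    by (intro sum.cong refl sum.swap)
  also have "\<dots> = (\<Sum>k<n. \<Sum>j<n. \<Sum>i<n. p i k * f k j * h i j)" by (rule sum.swap)
  also have "\<dots> = (\<Sum>k<n. \<Sum>j<n. \<Sum>i<n. f k j * (p k i * h i j))"
    by (intro sum.cong refl) (use assms in \<open>simp add: mult_ac\<close>)
  also have "\<dots> = frob n f (mmult n p h)"
    by (simp add: frob_def mmult_def sum_distrib_left)
  finally show ?thesis .
qed

lemma frob_mult_right:
  assumes "\<And>i j. i < n \<Longrightarrow> j < n \<Longrightarrow> p i j = p j i"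
  shows "frob n (mmult n f p) h = frob n f (mmult n h p)"
proof -
  have "frob n (mmult n f p) h = (\<Sum>i<n. \<Sum>j<n. \<Sum>k<n. f i k * p k j * h i j)"
    by (simp add: frob_def mmult_def sum_distrib_right)
  also have "\<dots> = (\<Sum>i<n. \<Sum>k<n. \<Sum>j<n. f i k * p k j * h i j)" 
    by (intro sum.cong refl sum.swap)
  also have "\<dots> = (\<Sum>i<n. \<Sum>k<n. \<Sum>j<n. f i k * (h i j * p j k))"
    by (intro sum.cong refl) (use assms in \<open>simp add: mult_ac\<close>)
  also have "\<dots> = frob n f (mmult n h p)"
    by (simp add: frob_def mmult_def sum_distrib_left)
  finally show ?thesis .
qed

lemma sum_Cauchy_Schwarz:
  fixes f g :: "'a \<Rightarrow> real"
  shows "(\<Sum>i\<in>A. f i * g i)\<^sup>2 \<le> (\<Sum>i\<in>A. (f i)\<^sup>2) * (\<Sum>i\<in>A. (g i)\<^sup>2)"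
proof -
  have "\<bar>\<Sum>i\<in>A. f i * g i\<bar> \<le> (\<Sum>i\<in>A. \<bar>f i\<bar> * \<bar>g i\<bar>)"
    by (rule order_trans[OF sum_abs]) (simp add: abs_mult)
  also have "\<dots> \<le> L2_set f A * L2_set g A" by (rule L2_set_mult_ineq)
  finally have "\<bar>\<Sum>i\<in>A. f i * g i\<bar>\<^sup>2 \<le> (L2_set f A * L2_set g A)\<^sup>2"
    by (rule power_mono) simp
  thus ?thesis by (simp add: L2_set_def power_mult_distrib sum_nonneg)
qed

lemma frob_Cauchy_Schwarz: "(frob n f g)\<^sup>2 \<le> frob n f f * frob n g g"
  using sum_Cauchy_Schwarz[of "\<lambda>x. f (fst x) (snd x)" "\<lambda>x. g (fst x) (snd x)" "{..<n} \<times> {..<n}"]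
  by (simp add: frob_def sum.cartesian_product case_prod_beta power2_eq_square)

section \<open>Symmetric idempotent kernels and compression by them\<close>

locale proj_kernel =
  fixes n :: nat and p :: "nat \<Rightarrow> nat \<Rightarrow> real"
  assumes p_sym: "\<And>i j. i < n \<Longrightarrow> j < n \<Longrightarrow> p i j = p j i"
    and p_idem: "\<And>i j. i < n \<Longrightarrow> j < n \<Longrightarrow> (\<Sum>k<n. p i k * p k j) = p i j"
begin

lemma mmult_idem: "i < n \<Longrightarrow> j < n \<Longrightarrow> mmult n p p i j = p i j"
  by (simp add: mmult_def p_idem)

lemma row_norm: "i < n \<Longrightarrow> (\<Sum>k<n. (p i k)\<^sup>2) = p i i"
  using p_idem[of i i] p_sym by (simp add: power2_eq_square)

lemma p_diag: assumes "i < n" shows "0 \<le> p i i" "p i i \<le> 1"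
proof -
  show 0: "0 \<le> p i i" using row_norm[OF assms, symmetric] by (simp add: sum_nonneg)
  have "(p i i)\<^sup>2 \<le> (\<Sum>k<n. (p i k)\<^sup>2)" using assms by (intro member_le_sum) auto
  hence "p i i * p i i \<le> 1 * p i i" using row_norm[OF assms] by (simp add: power2_eq_square)
  thus "p i i \<le> 1" using 0 by (cases "p i i = 0") (auto dest: mult_right_le_imp_le)
qed

lemma p_sq_le: assumes "i < n" "j < n" shows "(p i j)\<^sup>2 \<le> p i i"
  unfolding row_norm[OF assms(1), symmetric] using assms by (intro member_le_sum) auto

lemma p_abs_le_1: assumes "i < n" "j < n" shows "\<bar>p i j\<bar> \<le> 1"
  using p_sq_le[OF assms] p_diag[OF assms(1)] abs_square_le_1 by force

text \<open>With \<open>y\<close> the image of \<open>x\<close> under \<open>p\<close>, symmetry and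
  idempotence make the pairing of \<open>x\<close> with \<open>y\<close> equal to |y|^2. The lower
  bound is immediate, the upper one follows from |x - y|^2 \<ge> 0.\<close>

lemma contraction: "(\<Sum>i<n. \<Sum>j<n. x i * x j * p i j) \<le> (\<Sum>i<n. (x i)\<^sup>2)"
  and quadratic_nonneg: "(\<Sum>i<n. \<Sum>j<n. x i * x j * p i j) \<ge> 0"
proof -
  define y where "y i = (\<Sum>k<n. p i k * x k)" for i
  have e1: "(\<Sum>i<n. x i * y i) = (\<Sum>i<n. \<Sum>j<n. x i * x j * p i j)"
    by (simp add: y_def sum_distrib_left mult_ac)
  have "(\<Sum>i<n. y i * y i) = (\<Sum>i<n. \<Sum>k<n. x k * (p k i * y i))"
    by (intro sum.cong refl, subst (2) y_def) (auto simp: sum_distrib_left sum_distrib_right p_sym mult_ac)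
  also have "\<dots> = (\<Sum>k<n. x k * (\<Sum>i<n. p k i * y i))"
    by (subst sum.swap) (simp add: sum_distrib_left)
  also have "\<dots> = (\<Sum>k<n. x k * y k)"
  proof (intro sum.cong refl)
    fix k assume "k \<in> {..<n}"
    have "(\<Sum>i<n. p k i * y i) = (\<Sum>i<n. \<Sum>l<n. p k i * p i l * x l)"
      by (simp add: y_def sum_distrib_left mult_ac)
    also have "\<dots> = (\<Sum>l<n. (\<Sum>i<n. p k i * p i l) * x l)"
      by (subst sum.swap) (simp add: sum_distrib_right)
    also have "\<dots> = y k" using \<open>k \<in> {..<n}\<close> by (simp add: p_idem y_def)
    finally show "x k * (\<Sum>i<n. p k i * y i) = x k * y k" by simp
  qed
  finally have e2: "(\<Sum>i<n. (y i)\<^sup>2) = (\<Sum>i<n. x i * y i)" by (simp add: power2_eq_square)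
  have "0 \<le> (\<Sum>i<n. (x i - y i)\<^sup>2)" by (simp add: sum_nonneg)
  also have "\<dots> = (\<Sum>i<n. (x i)\<^sup>2) + (\<Sum>i<n. (y i)\<^sup>2) - 2 * (\<Sum>i<n. x i * y i)"
    by (simp add: power2_diff sum.distrib sum_subtractf sum_distrib_left mult.assoc)
  finally show "(\<Sum>i<n. \<Sum>j<n. x i * x j * p i j) \<le> (\<Sum>i<n. (x i)\<^sup>2)" using e1 e2 by simp
  show "(\<Sum>i<n. \<Sum>j<n. x i * x j * p i j) \<ge> 0" unfolding e1[symmetric] e2[symmetric] by (simp add: sum_nonneg)
qed

text \<open>Compression by \<open>p\<close> is itself an orthogonal projection, now on the space of
  matrices: it is idempotent and self-adjoint for \<open>frob\<close>.\<close>

definition compr :: "(nat \<Rightarrow> nat \<Rightarrow> real) \<Rightarrow> nat \<Rightarrow> nat \<Rightarrow> real" where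
  "compr f = mmult n p (mmult n f p)"

lemma compr_idem: "i < n \<Longrightarrow> j < n \<Longrightarrow> compr (compr f) i j = compr f i j"
proof -
  assume ij: "i < n" "j < n"
  have "compr (compr f) i j = mmult n (mmult n p p) (mmult n f (mmult n p p)) i j"
    by (simp add: compr_def mmult_assoc)
  also have "\<dots> = compr f i j"
    unfolding compr_def using ij by (intro mmult_cong) (simp_all add: mmult_idem)
  finally show ?thesis .
qed

lemma frob_compr: "frob n (compr f) g = frob n f (compr g)"
  unfolding compr_def by (simp add: frob_mult_left[OF p_sym] frob_mult_right[OF p_sym] mmult_assoc)

lemma frob_compr_self: "frob n (compr f) (compr f) = frob n f (compr f)"
  using frob_compr[of f "compr f"] frob_cong[of n f f "compr (compr f)" "compr f"] compr_idem by simp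

lemma compr_contract: "frob n (compr f) (compr f) \<le> frob n f f"
proof -
  have "0 \<le> frob n (\<lambda>i j. f i j - compr f i j) (\<lambda>i j. f i j - compr f i j)" by (rule frob_nonneg)
  also have "\<dots> = frob n f f + frob n (compr f) (compr f) - 2 * frob n f (compr f)"
    by (simp add: frob_def algebra_simps sum.distrib sum_subtractf sum_distrib_left)
  finally show ?thesis using frob_compr_self[of f] by simp
qed

lemma trace_compr: "(\<Sum>a<n. compr f a a) = frob n f p"
proof -
  have "(\<Sum>a<n. compr f a a) = frob n (\<lambda>i j. if i = j then 1 else 0) (compr f)"
    by (simp add: frob_def if_distrib[of "\<lambda>x. x * _"] cong: if_cong)
  also have "\<dots> = frob n (compr (\<lambda>i j. if i = j then 1 else 0)) f" by (simp add: frob_compr)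
  also have "\<dots> = frob n p f"
  proof (rule frob_cong)
    fix i j assume "i < n" "j < n"
    have "mmult n (\<lambda>i j. if i = j then 1 else 0) p k j = p k j" if "k < n" for k
      using that by (simp add: mmult_def if_distrib[of "\<lambda>x. x * _"] cong: if_cong)
    thus "compr (\<lambda>i j. if i = j then 1 else 0) i j = p i j"
      unfolding compr_def using mmult_idem[OF \<open>i < n\<close> \<open>j < n\<close>]
      by (subst mmult_cong[of n p i p _ j p]) auto
  qed simp
  finally show ?thesis by (simp add: frob_commute)
qed

text \<open>The diagonal map \<open>f \<mapsto> diag (p f p)\<close> is adjoint to \<open>x \<mapsto> p D\<^sub>x p\<close>, whose squared norm
  is the form \<open>\<Sum> x\<^sub>i x\<^sub>j p\<^sub>i\<^sub>j\<^sup>2\<close>; the constant vector is treated separately.\<close>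

lemma sum_diag_compr_sq_le:
  assumes n: "n > 0" and th: "\<theta> \<ge> 0"
    and T: "\<And>x. (\<Sum>i<n. x i) = 0 \<Longrightarrow> (\<Sum>i<n. \<Sum>j<n. x i * x j * (p i j)\<^sup>2) \<le> \<theta> * (\<Sum>i<n. (x i)\<^sup>2)"
  shows "(\<Sum>a<n. (compr f a a)\<^sup>2) \<le> (frob n f p)\<^sup>2 / n + \<theta> * frob n (compr f) (compr f)"
proof -
  define B where "B = compr f"
  define t where "t = frob n f p / n"
  \<comment> \<open>By \<open>trace_compr\<close>, \<open>t\<close> is the mean of the diagonal of
    \<open>B\<close>. So \<open>x\<close> sums to zero, as the hypothesis on the form requires, and
    Pythagoras splits the squared norm of the diagonal.\<close>
  define x where "x a = B a a - t" for a
  define D where "D i j = (if i = j then x i else 0)" for i j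
  have trB: "(\<Sum>a<n. B a a) = n * t" using n by (simp add: B_def t_def trace_compr)
  have sx: "(\<Sum>a<n. x a) = 0" by (simp add: x_def sum_subtractf trB)
  have xx: "(\<Sum>a<n. (x a)\<^sup>2) = (\<Sum>a<n. x a * B a a)"
  proof -
    have "(\<Sum>a<n. (x a)\<^sup>2) = (\<Sum>a<n. x a * B a a) - t * (\<Sum>a<n. x a)"
      by (simp add: x_def power2_eq_square algebra_simps sum.distrib sum_subtractf sum_distrib_left)
    thus ?thesis using sx by simp
  qed
  have "(\<Sum>a<n. x a * B a a) = (\<Sum>a<n. (B a a)\<^sup>2) - t * (\<Sum>a<n. B a a)"
    by (simp add: x_def power2_eq_square algebra_simps sum.distrib sum_subtractf sum_distrib_left)
  hence e0: "(\<Sum>a<n. (B a a)\<^sup>2) = (\<Sum>a<n. (x a)\<^sup>2) + (frob n f p)\<^sup>2 / n"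
    using xx n unfolding trB by (simp add: t_def power2_eq_square)
  have "(\<Sum>a<n. x a * B a a) = frob n D B"
    by (simp add: frob_def D_def if_distrib[of "\<lambda>x. x * _"] cong: if_cong)
  also have "\<dots> = frob n D (compr B)"
    unfolding B_def by (rule frob_cong) (simp_all add: compr_idem)
  also have "\<dots> = frob n (compr D) B" by (simp add: frob_compr)
  finally have e1: "(\<Sum>a<n. (x a)\<^sup>2) = frob n (compr D) B" using xx by simp
  have "frob n (compr D) (compr D) = frob n D (compr D)" by (rule frob_compr_self)
  also have "\<dots> = (\<Sum>i<n. x i * compr D i i)"
    by (simp add: frob_def D_def if_distrib[of "\<lambda>x. x * _"] cong: if_cong)
  also have "\<dots> = (\<Sum>i<n. \<Sum>j<n. x i * x j * (p i j)\<^sup>2)"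
  proof (intro sum.cong refl)
    fix i assume "i \<in> {..<n}"
    have "mmult n D p k i = x k * p k i" if "k < n" for k
      using that by (simp add: mmult_def D_def if_distrib[of "\<lambda>x. x * _"] cong: if_cong)
    hence "compr D i i = (\<Sum>k<n. p i k * (x k * p k i))"
      unfolding compr_def by (simp add: mmult_def[of n p])
    also have "\<dots> = (\<Sum>k<n. x k * (p i k)\<^sup>2)"
      using \<open>i \<in> {..<n}\<close> by (intro sum.cong refl) (auto simp: p_sym power2_eq_square)
    finally show "x i * compr D i i = (\<Sum>j<n. x i * x j * (p i j)\<^sup>2)"
      by (simp add: sum_distrib_left mult_ac)
  qed
  also have "\<dots> \<le> \<theta> * (\<Sum>i<n. (x i)\<^sup>2)" by (rule T[OF sx])
  finally have dd: "frob n (compr D) (compr D) \<le> \<theta> * (\<Sum>i<n. (x i)\<^sup>2)" .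
  define S where "S = (\<Sum>i<n. (x i)\<^sup>2)"
  have S0: "S \<ge> 0" by (simp add: S_def sum_nonneg)
  \<comment> \<open>\<open>S\<close> is the pairing of \<open>compr D\<close> with \<open>B\<close>,
    while the squared norm of \<open>compr D\<close> is at most \<open>\<theta> * S\<close>; so one
    factor \<open>S\<close> cancels.\<close>
  have "S\<^sup>2 \<le> frob n (compr D) (compr D) * frob n B B"
    using frob_Cauchy_Schwarz e1 by (simp add: S_def)
  also have "\<dots> \<le> \<theta> * S * frob n B B"
    using dd frob_nonneg by (intro mult_right_mono) (auto simp: S_def)
  finally have "S * S \<le> S * (\<theta> * frob n B B)" by (simp add: power2_eq_square mult_ac)
  hence "S \<le> \<theta> * frob n B B"
    using S0 th frob_nonneg[of n B] by (cases "S = 0") auto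
  thus ?thesis using e0 by (simp add: S_def B_def)
qed

end

text \<open>The two omitted columns are those in which a diagonal entry of \<open>p\<close> would
  appear: this is an entry of the square of a matrix with zero diagonal.\<close>

definition overlap :: "nat \<Rightarrow> (nat \<Rightarrow> nat \<Rightarrow> real) \<Rightarrow> nat \<Rightarrow> nat \<Rightarrow> real" where
  "overlap n p a b = (\<Sum>c\<in>{..<n} - {a, b}. (p a c)\<^sup>2 * (p b c)\<^sup>2)"

lemma frob_rank_one: "frob n (\<lambda>i j. x i * y j) (\<lambda>i j. x i * y j) = (\<Sum>i<n. (x i)\<^sup>2) * (\<Sum>j<n. (y j)\<^sup>2)"
  by (simp add: frob_def sum_product power2_eq_square mult_ac)

lemma sum_product4:
  fixes f g :: "nat \<Rightarrow> nat \<Rightarrow> real"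
  shows "(\<Sum>i\<in>A. \<Sum>j\<in>B. f i j) * (\<Sum>k\<in>A'. \<Sum>l\<in>B'. g k l)
    = (\<Sum>i\<in>A. \<Sum>j\<in>B. \<Sum>k\<in>A'. \<Sum>l\<in>B'. f i j * g k l)"
  by (simp only: sum_distrib_right) (simp only: sum_distrib_left)

lemma sum4_linear:
  fixes \<gamma> \<beta> :: real
  shows "(\<Sum>i\<in>A. \<Sum>j\<in>B. \<Sum>k\<in>D. \<Sum>l\<in>E. \<gamma> * f i j k l + \<gamma> * g i j k l + \<gamma> * h i j k l - \<beta> * e i j k l)
    = \<gamma> * (\<Sum>i\<in>A. \<Sum>j\<in>B. \<Sum>k\<in>D. \<Sum>l\<in>E. f i j k l) + \<gamma> * (\<Sum>i\<in>A. \<Sum>j\<in>B. \<Sum>k\<in>D. \<Sum>l\<in>E. g i j k l)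
      + \<gamma> * (\<Sum>i\<in>A. \<Sum>j\<in>B. \<Sum>k\<in>D. \<Sum>l\<in>E. h i j k l) - \<beta> * (\<Sum>i\<in>A. \<Sum>j\<in>B. \<Sum>k\<in>D. \<Sum>l\<in>E. e i j k l)"
  by (simp only: sum.distrib sum_subtractf sum_distrib_left)

lemma sum_swap4:
  "(\<Sum>a\<in>A. \<Sum>i\<in>I. \<Sum>j\<in>J. \<Sum>k\<in>K. \<Sum>l\<in>L. f a i j k l)
    = (\<Sum>i\<in>I. \<Sum>j\<in>J. \<Sum>k\<in>K. \<Sum>l\<in>L. \<Sum>a\<in>A. f a i j k l)"
  by (simp only: sum.swap[where A = A and B = I] sum.swap[where A = A and B = J]
      sum.swap[where A = A and B = K] sum.swap[where A = A and B = L])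

section \<open>The form of the entrywise square and the quartic form\<close>

context proj_kernel
begin

text \<open>The diagonal contributes at most \<open>q\<^sup>2\<close>. For the off-diagonal part
  \<open>X\<close>, Cauchy-Schwarz bounds the form by |x| |Xx|, and |Xx|^2 is the form of X^2. Off
  its diagonal X^2 is the constant \<open>m\<close> plus an error of Frobenius norm at most
  \<open>\<nu>\<close>; on the diagonal it is at most \<open>r\<^sup>2 * q\<close>. The square root
  in the bound comes from passing to X^2.\<close>

lemma squared_kernel_form_le:
  assumes r: "\<And>i j. i < n \<Longrightarrow> j < n \<Longrightarrow> i \<noteq> j \<Longrightarrow> \<bar>p i j\<bar> \<le> r"
    and q: "\<And>i. i < n \<Longrightarrow> p i i \<le> q"
    and m: "m \<ge> 0" and \<nu>: "\<nu> \<ge> 0" and r0: "r \<ge> 0" and q0: "q \<ge> 0"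
    and T: "(\<Sum>i<n. \<Sum>j\<in>{..<n} - {i}. (overlap n p i j - m)\<^sup>2) \<le> \<nu>\<^sup>2"
    and x: "(\<Sum>i<n. x i) = 0"
  shows "(\<Sum>i<n. \<Sum>j<n. x i * x j * (p i j)\<^sup>2) \<le> (q\<^sup>2 + sqrt (r\<^sup>2 * q + \<nu>)) * (\<Sum>i<n. (x i)\<^sup>2)"
proof -
  define S where "S = (\<Sum>i<n. (x i)\<^sup>2)"
  have S0: "S \<ge> 0" by (simp add: S_def sum_nonneg)
  define X where "X i j = (if i = j then 0 else (p i j)\<^sup>2)" for i j
  define E where "E i j = (if i = j then 0 else overlap n p i j - m)" for i j
  define u where "u i = (\<Sum>j<n. X i j * x j)" for i
  have Xsym: "X i j = X j i" if "i < n" "j < n" for i j using p_sym[OF that] by (simp add: X_def)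
  have XXo: "mmult n X X i j = overlap n p i j" if "i < n" "j < n" "i \<noteq> j" for i j
  proof -
    have "mmult n X X i j = (\<Sum>c\<in>{..<n} - {i, j}. X i c * X c j)"
      unfolding mmult_def by (rule sum.mono_neutral_right) (auto simp: X_def)
    also have "\<dots> = overlap n p i j"
      unfolding overlap_def by (rule sum.cong) (use that p_sym in \<open>auto simp: X_def\<close>)
    finally show ?thesis .
  qed
  have XXd: "mmult n X X i i \<le> r\<^sup>2 * q" if i: "i < n" for i
  proof -
    have "mmult n X X i i \<le> (\<Sum>c<n. r\<^sup>2 * (p i c)\<^sup>2)"
      unfolding mmult_def
    proof (rule sum_mono)
      fix c assume "c \<in> {..<n}"
      show "X i c * X c i \<le> r\<^sup>2 * (p i c)\<^sup>2"
      proof (cases "c = i")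
        case False
        have "(p i c)\<^sup>2 \<le> r\<^sup>2" using r[of i c] i \<open>c \<in> {..<n}\<close> False r0 by (intro power2_le_iff_abs_le[THEN iffD2]) auto
        moreover have "X i c * X c i = (p i c)\<^sup>2 * (p i c)\<^sup>2"
          using False p_sym[of c i] i \<open>c \<in> {..<n}\<close> by (simp add: X_def)
        ultimately show ?thesis by (metis mult_right_mono zero_le_power2)
      qed (simp add: X_def)
    qed
    also have "\<dots> = r\<^sup>2 * p i i" using row_norm[OF i] by (simp add: sum_distrib_left[symmetric])
    also have "\<dots> \<le> r\<^sup>2 * q" using q[OF i] by (intro mult_left_mono) auto
    finally show ?thesis .
  qed
  have EE: "frob n E E \<le> \<nu>\<^sup>2"
  proof -
    have "frob n E E = (\<Sum>i<n. \<Sum>j\<in>{..<n} - {i}. (overlap n p i j - m)\<^sup>2)"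
      unfolding frob_def E_def
      by (intro sum.cong refl sum.mono_neutral_cong_right) (auto simp: power2_eq_square)
    thus ?thesis using T by simp
  qed
  have "(\<Sum>i<n. (u i)\<^sup>2) = (\<Sum>i<n. \<Sum>j<n. \<Sum>k<n. X i j * X i k * (x j * x k))"
    unfolding u_def power2_eq_square sum_product by (simp add: mult_ac)
  also have "\<dots> = (\<Sum>j<n. \<Sum>i<n. \<Sum>k<n. X i j * X i k * (x j * x k))" by (rule sum.swap)
  also have "\<dots> = (\<Sum>j<n. \<Sum>k<n. \<Sum>i<n. X i j * X i k * (x j * x k))"
    by (intro sum.cong refl sum.swap)
  also have "\<dots> = (\<Sum>j<n. \<Sum>k<n. x j * x k * mmult n X X j k)"
    unfolding mmult_def sum_distrib_left by (intro sum.cong refl) (simp add: Xsym mult_ac)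
  \<comment> \<open>The constant \<open>m\<close> is put on the diagonal too, so that it multiplies
    the full square of the sum of \<open>x\<close>, which is zero. The compensating - m on the
    diagonal only helps, as \<open>m \<ge> 0\<close>.\<close>
  also have "\<dots> = (\<Sum>j<n. \<Sum>k<n. x j * x k * E j k + m * (x j * x k) + (if j = k then x j * x k * (mmult n X X j k - m) else 0))"
    by (intro sum.cong refl) (auto simp: E_def XXo algebra_simps)
  also have "\<dots> = frob n (\<lambda>j k. x j * x k) E + m * ((\<Sum>j<n. x j) * (\<Sum>k<n. x k)) + (\<Sum>j<n. x j * x j * (mmult n X X j j - m))"
    by (simp add: sum.distrib frob_def sum_distrib_left[symmetric] sum_product cong: if_cong)
  also have "\<dots> \<le> S * \<nu> + 0 + (\<Sum>j<n. (x j)\<^sup>2 * (r\<^sup>2 * q))"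
  proof (intro add_mono)
    have "(frob n (\<lambda>j k. x j * x k) E)\<^sup>2 \<le> (S * S) * \<nu>\<^sup>2"
      using frob_Cauchy_Schwarz[of n "\<lambda>j k. x j * x k" E] EE S0
      unfolding frob_rank_one S_def[symmetric]
      by (meson mult_left_mono mult_nonneg_nonneg order_trans)
    also have "\<dots> = (S * \<nu>)\<^sup>2" by (simp add: power2_eq_square mult_ac)
    finally show "frob n (\<lambda>j k. x j * x k) E \<le> S * \<nu>"
      using S0 \<nu> by (meson abs_le_square_iff abs_le_D1 abs_of_nonneg mult_nonneg_nonneg power2_le_imp_le)
    show "m * ((\<Sum>j<n. x j) * (\<Sum>k<n. x k)) \<le> 0" using x by simp
    show "(\<Sum>j<n. x j * x j * (mmult n X X j j - m)) \<le> (\<Sum>j<n. (x j)\<^sup>2 * (r\<^sup>2 * q))"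
      unfolding power2_eq_square[of "x _"]
      by (intro sum_mono mult_left_mono) (use XXd m in force)+
  qed
  also have "\<dots> = (r\<^sup>2 * q + \<nu>) * S" by (simp add: S_def sum_distrib_left[symmetric] algebra_simps)
  finally have uu: "(\<Sum>i<n. (u i)\<^sup>2) \<le> (r\<^sup>2 * q + \<nu>) * S" .
  define w where "w = r\<^sup>2 * q + \<nu>"
  have w0: "w \<ge> 0" using q0 \<nu> by (simp add: w_def)
  have "(\<Sum>i<n. x i * u i)\<^sup>2 \<le> S * (\<Sum>i<n. (u i)\<^sup>2)"
    unfolding S_def by (rule sum_Cauchy_Schwarz)
  also have "\<dots> \<le> S * (w * S)" using uu S0 by (intro mult_left_mono) (auto simp: w_def)
  also have "\<dots> = (sqrt w * S)\<^sup>2" using w0 by (simp add: power_mult_distrib power2_eq_square)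
  finally have xu: "(\<Sum>i<n. x i * u i) \<le> sqrt w * S"
    using S0 w0 by (meson mult_nonneg_nonneg power2_le_imp_le real_sqrt_ge_zero)
  have "(\<Sum>i<n. \<Sum>j<n. x i * x j * (p i j)\<^sup>2) = (\<Sum>i<n. \<Sum>j<n. (if i = j then x i * x j * (p i j)\<^sup>2 else 0) + x i * (X i j * x j))"
    by (intro sum.cong refl) (auto simp: X_def)
  also have "\<dots> = (\<Sum>i<n. (x i)\<^sup>2 * (p i i)\<^sup>2) + (\<Sum>i<n. x i * u i)"
    by (simp add: sum.distrib u_def sum_distrib_left power2_eq_square cong: if_cong)
  also have "\<dots> \<le> (\<Sum>i<n. (x i)\<^sup>2 * q\<^sup>2) + sqrt w * S"
    using xu q p_diag by (intro add_mono sum_mono mult_left_mono power_mono) auto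
  also have "\<dots> = (q\<^sup>2 + sqrt w) * S" by (simp add: S_def sum_distrib_left[symmetric] algebra_simps)
  finally show ?thesis by (simp add: S_def w_def)
qed

text \<open>The pairing of i with j gives the squared pairing of \<open>C\<close> with
  \<open>p\<close>. Each crossed pairing gives the squared norm of p C p, the two being equal
  because \<open>C\<close> is symmetric. The sum over \<open>a\<close> gives the squared norm of the
  diagonal of p C p.\<close>

lemma quartic_form_eq:
  assumes C: "\<And>i j. C i j = C j i"
  shows "(\<Sum>i<n. \<Sum>j<n. \<Sum>k<n. \<Sum>l<n. C i j * C k l *
      (\<gamma> * (p i j * p k l + p i k * p j l + p i l * p j k) - \<beta> * (\<Sum>a<n. p i a * p j a * p k a * p l a)))
    = \<gamma> * ((frob n C p)\<^sup>2 + 2 * frob n (compr C) (compr C)) - \<beta> * (\<Sum>a<n. (compr C a a)\<^sup>2)"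
proof -
  have t1: "(\<Sum>i<n. \<Sum>j<n. \<Sum>k<n. \<Sum>l<n. C i j * C k l * (p i j * p k l)) = (frob n C p)\<^sup>2"
    unfolding frob_def power2_eq_square sum_product4 by (simp add: mult_ac)
  have t2: "(\<Sum>i<n. \<Sum>j<n. \<Sum>k<n. \<Sum>l<n. C i j * C k l * (p i k * p j l)) = frob n (compr C) (compr C)"
    unfolding frob_compr_self unfolding frob_def compr_def mmult_def sum_distrib_left
    by (intro sum.cong refl) (simp add: p_sym mult_ac)
  have t3: "(\<Sum>i<n. \<Sum>j<n. \<Sum>k<n. \<Sum>l<n. C i j * C k l * (p i l * p j k)) = frob n (compr C) (compr C)"
  proof -
    have "(\<Sum>i<n. \<Sum>j<n. \<Sum>k<n. \<Sum>l<n. C i j * C k l * (p i l * p j k))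
      = (\<Sum>i<n. \<Sum>j<n. \<Sum>l<n. \<Sum>k<n. C i j * C k l * (p i l * p j k))"
      by (intro sum.cong refl sum.swap)
    also have "\<dots> = (\<Sum>i<n. \<Sum>j<n. \<Sum>k<n. \<Sum>l<n. C i j * C k l * (p i k * p j l))"
      by (intro sum.cong refl) (simp add: C mult_ac)
    finally show ?thesis using t2 by simp
  qed
  have ca: "compr C a a = (\<Sum>i<n. \<Sum>j<n. C i j * (p i a * p j a))" if "a < n" for a
    unfolding compr_def mmult_def sum_distrib_left using that by (intro sum.cong refl) (simp add: p_sym mult_ac)
  have t4: "(\<Sum>i<n. \<Sum>j<n. \<Sum>k<n. \<Sum>l<n. C i j * C k l * (\<Sum>a<n. p i a * p j a * p k a * p l a)) = (\<Sum>a<n. (compr C a a)\<^sup>2)"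
  proof -
    have "(\<Sum>a<n. (compr C a a)\<^sup>2) = (\<Sum>a<n. \<Sum>i<n. \<Sum>j<n. \<Sum>k<n. \<Sum>l<n. C i j * C k l * (p i a * p j a * p k a * p l a))"
      by (intro sum.cong refl) (simp add: ca power2_eq_square sum_product4 mult_ac)
    also have "\<dots> = (\<Sum>i<n. \<Sum>j<n. \<Sum>k<n. \<Sum>l<n. \<Sum>a<n. C i j * C k l * (p i a * p j a * p k a * p l a))"
      by (rule sum_swap4)
    finally show ?thesis by (simp add: sum_distrib_left)
  qed
  have "(\<Sum>i<n. \<Sum>j<n. \<Sum>k<n. \<Sum>l<n. C i j * C k l *
      (\<gamma> * (p i j * p k l + p i k * p j l + p i l * p j k) - \<beta> * (\<Sum>a<n. p i a * p j a * p k a * p l a)))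
    = \<gamma> * (\<Sum>i<n. \<Sum>j<n. \<Sum>k<n. \<Sum>l<n. C i j * C k l * (p i j * p k l))
      + \<gamma> * (\<Sum>i<n. \<Sum>j<n. \<Sum>k<n. \<Sum>l<n. C i j * C k l * (p i k * p j l))
      + \<gamma> * (\<Sum>i<n. \<Sum>j<n. \<Sum>k<n. \<Sum>l<n. C i j * C k l * (p i l * p j k))
      - \<beta> * (\<Sum>i<n. \<Sum>j<n. \<Sum>k<n. \<Sum>l<n. C i j * C k l * (\<Sum>a<n. p i a * p j a * p k a * p l a))"
    unfolding sum4_linear[symmetric] by (intro sum.cong refl) (simp only: distrib_left right_diff_distrib mult_ac)
  thus ?thesis unfolding t1 t2 t3 t4 by (simp add: algebra_simps)
qed

end

section \<open>The pseudo-moments and their quadratic form\<close>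

lemma sum_delta_outer:
  "finite A \<Longrightarrow> (\<Sum>k\<in>A. \<Sum>l\<in>B. if k = i then f k l else 0) = (if i \<in> A then \<Sum>l\<in>B. f i l else (0::real))"
  by (subst sum.swap) simp

text \<open>\<open>\<kappa>\<close> stands for n/d, so that \<kappa> p is entrywise within
  \<open>\<rho>\<close> of the identity. The value of \<open>c\<close> makes 2 \<kappa>^4 times the
  term (frob C p)^2 / n of \<open>sum_diag_compr_sq_le\<close> equal to c \<kappa>^2 (frob C
  p)^2.\<close>

locale scaled_kernel = proj_kernel +
  fixes \<kappa> c \<rho> :: real
  assumes n_pos: "n > 0" and lam: "\<kappa> \<ge> 1" and c_eq: "c = 2 * \<kappa>\<^sup>2 / n"
    and rho: "0 \<le> \<rho>" "\<rho> \<le> 1"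
    and off_diag: "\<And>i j. i < n \<Longrightarrow> j < n \<Longrightarrow> i \<noteq> j \<Longrightarrow> \<bar>\<kappa> * p i j\<bar> \<le> \<rho>"
    and diag: "\<And>i. i < n \<Longrightarrow> \<bar>\<kappa> * p i i - 1\<bar> \<le> \<rho>"
begin

definition A :: "nat \<Rightarrow> nat \<Rightarrow> real" where
  "A i j = \<kappa> * p i j"

text \<open>\<open>F\<close> is the fourth moment of a Gaussian vector with covariance \<open>A\<close>, corrected by the
  projection orthogonal to the squares \<open>x\<^sub>a\<^sup>2\<close>. The inverse Gram matrix of these squares is close to
  the identity except in the direction of their sum, which the factor \<open>1 + c\<close> compensates; this makes
  the correction symmetric in its four indices.\<close>

definition F :: "nat \<Rightarrow> nat \<Rightarrow> nat \<Rightarrow> nat \<Rightarrow> real" where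
  "F i j k l = (1 + c) * (A i j * A k l + A i k * A j l + A i l * A j k)
     - 2 * (\<Sum>a<n. A i a * A j a * A k a * A l a)"

text \<open>The moment of x_i x_j x_k x_l on the cube: an index common to the two pairs cancels. It
  is meant for i \<noteq> j and k \<noteq> l, so only matches between the pairs are tested.\<close>

definition Y :: "nat \<Rightarrow> nat \<Rightarrow> nat \<Rightarrow> nat \<Rightarrow> real" where
  "Y i j k l =
    (if i = k then (if j = l then 1 else A j l)
     else if i = l then (if j = k then 1 else A j k)
     else if j = k then A i l
     else if j = l then A i k
     else F i j k l)"

lemma A_sym: "i < n \<Longrightarrow> j < n \<Longrightarrow> A i j = A j i"
  by (simp add: A_def p_sym)

lemma A_row_norm: "i < n \<Longrightarrow> (\<Sum>k<n. (A i k)\<^sup>2) = \<kappa> * A i i"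
  using row_norm[of i] by (simp add: A_def power_mult_distrib sum_distrib_left[symmetric] power2_eq_square[of \<kappa>])

lemma A_diag: "i < n \<Longrightarrow> A i i \<le> 1 + \<rho>" "i < n \<Longrightarrow> A i i \<ge> 1 - \<rho>" "i < n \<Longrightarrow> A i i \<ge> 0"
  using diag[of i] p_diag[of i] lam by (auto simp: A_def)

lemma c_nonneg: "c \<ge> 0"
  by (simp add: c_eq)

lemma F_perm:
  "i < n \<Longrightarrow> j < n \<Longrightarrow> F i j k l = F j i k l"
  "k < n \<Longrightarrow> l < n \<Longrightarrow> F i j k l = F i j l k"
  "i < n \<Longrightarrow> j < n \<Longrightarrow> k < n \<Longrightarrow> l < n \<Longrightarrow> F i j k l = F i k j l"
  unfolding F_def by (simp_all add: A_sym mult_ac add_ac)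

text \<open>The subtracted diagonal of p C p has two parts. Its constant part is paid for by the
  extra \<open>c\<close> in the factor 1 + c, the rest by the two crossed pairings, up to
  \<open>\<eta>\<close>. The uncrossed pairing survives intact as
  \<open>(frob n C A)\<^sup>2\<close>; it is kept to complete the square with the row of the empty
  set.\<close>

lemma wick_form_ge:
  assumes C: "\<And>i j. C i j = C j i" and eta: "\<eta> \<ge> 0" and th: "\<theta> \<ge> 0" "\<kappa>\<^sup>2 * \<theta> \<le> 1 + \<eta>"
    and T: "\<And>x. (\<Sum>i<n. x i) = 0 \<Longrightarrow> (\<Sum>i<n. \<Sum>j<n. x i * x j * (p i j)\<^sup>2) \<le> \<theta> * (\<Sum>i<n. (x i)\<^sup>2)"
  shows "(\<Sum>i<n. \<Sum>j<n. \<Sum>k<n. \<Sum>l<n. C i j * C k l * F i j k l) \<ge> (frob n C A)\<^sup>2 - 2 * \<kappa>\<^sup>2 * \<eta> * frob n C C"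
proof -
  define t where "t = frob n C p"
  define b where "b = frob n (compr C) (compr C)"
  define S where "S = (\<Sum>a<n. (compr C a a)\<^sup>2)"
  have b: "0 \<le> b" "b \<le> frob n C C" using frob_nonneg compr_contract by (auto simp: b_def)
  have ipA: "frob n C A = \<kappa> * t" by (simp add: frob_def A_def t_def sum_distrib_left mult_ac)
  have Feq: "F i j k l = (1 + c) * \<kappa>\<^sup>2 * (p i j * p k l + p i k * p j l + p i l * p j k)
     - 2 * \<kappa>^4 * (\<Sum>a<n. p i a * p j a * p k a * p l a)" for i j k l
    unfolding F_def A_def
    by (simp add: algebra_simps sum_distrib_left power2_eq_square power4_eq_xxxx)
  have "(\<Sum>i<n. \<Sum>j<n. \<Sum>k<n. \<Sum>l<n. C i j * C k l * F i j k l)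
      = (1 + c) * \<kappa>\<^sup>2 * (t\<^sup>2 + 2 * b) - 2 * \<kappa>^4 * S"
    unfolding Feq b_def S_def t_def by (rule quartic_form_eq[OF C])
  moreover have "2 * \<kappa>^4 * S \<le> c * \<kappa>\<^sup>2 * t\<^sup>2 + 2 * \<kappa>\<^sup>2 * (1 + \<eta>) * b"
  proof -
    have "2 * \<kappa>^4 * S \<le> 2 * \<kappa>^4 * (t\<^sup>2 / n + \<theta> * b)"
      unfolding S_def t_def b_def using sum_diag_compr_sq_le[OF n_pos th(1) T] by (intro mult_left_mono) auto
    also have "\<dots> = c * \<kappa>\<^sup>2 * t\<^sup>2 + 2 * \<kappa>\<^sup>2 * (\<kappa>\<^sup>2 * \<theta>) * b"
      by (simp add: c_eq algebra_simps power2_eq_square power4_eq_xxxx)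
    also have "\<dots> \<le> c * \<kappa>\<^sup>2 * t\<^sup>2 + 2 * \<kappa>\<^sup>2 * (1 + \<eta>) * b"
      using th(2) b by (intro add_left_mono mult_right_mono mult_left_mono) auto
    finally show ?thesis .
  qed
  moreover have "(1 + c) * \<kappa>\<^sup>2 * (t\<^sup>2 + 2 * b) - (c * \<kappa>\<^sup>2 * t\<^sup>2 + 2 * \<kappa>\<^sup>2 * (1 + \<eta>) * b)
      = (\<kappa> * t)\<^sup>2 - 2 * \<kappa>\<^sup>2 * \<eta> * b + 2 * c * \<kappa>\<^sup>2 * b"
    by (simp add: algebra_simps power2_eq_square)
  moreover have "0 \<le> 2 * c * \<kappa>\<^sup>2 * b" using c_nonneg b by simp
  moreover have "2 * \<kappa>\<^sup>2 * \<eta> * b \<le> 2 * \<kappa>\<^sup>2 * \<eta> * frob n C C"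
    using b eta by (intro mult_left_mono) auto
  ultimately show ?thesis unfolding ipA by linarith
qed

text \<open>\<open>E\<close> and \<open>G\<close> are the discrepancies between \<open>Y\<close> and \<open>F\<close> on index pairs sharing one and two indices.\<close>

definition E :: "nat \<Rightarrow> nat \<Rightarrow> nat \<Rightarrow> real" where
  "E i j l = A j l - F i j i l"

definition G :: "nat \<Rightarrow> nat \<Rightarrow> real" where
  "G i j = 1 - A i i - A j j + F i j i j"

text \<open>If the pairs coincide, two of the \<open>E\<close> terms fire at once; \<open>G\<close>
  is the inclusion-exclusion remainder that brings the total back to 1.\<close>

lemma Y_minus_F:
  assumes "i < n" "j < n" "k < n" "l < n" "i \<noteq> j" "k \<noteq> l"
  shows "Y i j k l = F i j k l + (if k = i then E i j l else 0) + (if l = i then E i j k else 0)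
    + (if k = j then E j i l else 0) + (if l = j then E j i k else 0)
    + (if k = i then if l = j then G i j else 0 else 0) + (if l = i then if k = j then G i j else 0 else 0)"
proof -
  have P: "F i j k i = F i j i k" "F i j j l = F j i j l" "F i j k j = F j i j k" "F j i j i = F i j i j" "F i j j i = F i j i j"
    using assms by (metis F_perm)+
  show ?thesis using assms P by (auto simp: Y_def E_def G_def)
qed

text \<open>A shared index can sit in four positions and a shared pair in two; by the symmetry of
  \<open>C\<close> all positions contribute the same sum.\<close>

lemma overlap_form_eq:
  assumes C: "\<And>i j. C i j = C j i" "\<And>i. C i i = 0"
  shows "(\<Sum>i<n. \<Sum>j<n. \<Sum>k<n. \<Sum>l<n. C i j * C k l * Y i j k l)
    = (\<Sum>i<n. \<Sum>j<n. \<Sum>k<n. \<Sum>l<n. C i j * C k l * F i j k l)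
      + 4 * (\<Sum>i<n. \<Sum>j<n. \<Sum>l<n. C i j * C i l * E i j l) + 2 * (\<Sum>i<n. \<Sum>j<n. (C i j)\<^sup>2 * G i j)"
proof -
  define Z where "Z = (\<Sum>i<n. \<Sum>j<n. \<Sum>l<n. C i j * C i l * E i j l)"
  have Zsw: "(\<Sum>i<n. \<Sum>j<n. \<Sum>l<n. C i j * C j l * E j i l) = Z"
    unfolding Z_def by (subst sum.swap) (simp add: C)
  have "(\<Sum>i<n. \<Sum>j<n. \<Sum>k<n. \<Sum>l<n. C i j * C k l * Y i j k l)
    = (\<Sum>i<n. \<Sum>j<n. \<Sum>k<n. \<Sum>l<n. C i j * C k l * F i j k l
     + (if k = i then C i j * C k l * E i j l else 0) + (if l = i then C i j * C k l * E i j k else 0)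
    + (if k = j then C i j * C k l * E j i l else 0) + (if l = j then C i j * C k l * E j i k else 0)
    + (if k = i then if l = j then C i j * C k l * G i j else 0 else 0) + (if l = i then if k = j then C i j * C k l * G i j else 0 else 0))"
    (is "_ = (\<Sum>i<n. \<Sum>j<n. \<Sum>k<n. \<Sum>l<n. ?f i j k l)")
  proof (intro sum.cong refl)
    fix i j k l assume "i \<in> {..<n}" "j \<in> {..<n}" "k \<in> {..<n}" "l \<in> {..<n}"
    thus "C i j * C k l * Y i j k l = ?f i j k l"
      using Y_minus_F[of i j k l] C(2) by (cases "i = j"; cases "k = l") (auto simp: algebra_simps)
  qed
  also have "\<dots> = (\<Sum>i<n. \<Sum>j<n. \<Sum>k<n. \<Sum>l<n. C i j * C k l * F i j k l)
     + (\<Sum>i<n. \<Sum>j<n. \<Sum>k<n. \<Sum>l<n. if k = i then C i j * C k l * E i j l else 0)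
     + (\<Sum>i<n. \<Sum>j<n. \<Sum>k<n. \<Sum>l<n. if l = i then C i j * C k l * E i j k else 0)
     + (\<Sum>i<n. \<Sum>j<n. \<Sum>k<n. \<Sum>l<n. if k = j then C i j * C k l * E j i l else 0)
     + (\<Sum>i<n. \<Sum>j<n. \<Sum>k<n. \<Sum>l<n. if l = j then C i j * C k l * E j i k else 0)
     + (\<Sum>i<n. \<Sum>j<n. \<Sum>k<n. \<Sum>l<n. if k = i then if l = j then C i j * C k l * G i j else 0 else 0)
     + (\<Sum>i<n. \<Sum>j<n. \<Sum>k<n. \<Sum>l<n. if l = i then if k = j then C i j * C k l * G i j else 0 else 0)"
    by (simp only: sum.distrib)
  also have "(\<Sum>i<n. \<Sum>j<n. \<Sum>k<n. \<Sum>l<n. if k = i then C i j * C k l * E i j l else 0) = Z"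
    unfolding Z_def by (simp add: sum_delta_outer)
  also have "(\<Sum>i<n. \<Sum>j<n. \<Sum>k<n. \<Sum>l<n. if l = i then C i j * C k l * E i j k else 0) = Z"
    unfolding Z_def by (simp add: C)
  also have "(\<Sum>i<n. \<Sum>j<n. \<Sum>k<n. \<Sum>l<n. if k = j then C i j * C k l * E j i l else 0) = Z"
    unfolding Zsw[symmetric] by (simp add: sum_delta_outer)
  also have "(\<Sum>i<n. \<Sum>j<n. \<Sum>k<n. \<Sum>l<n. if l = j then C i j * C k l * E j i k else 0) = Z"
    unfolding Zsw[symmetric] by (simp add: C)
  also have "(\<Sum>i<n. \<Sum>j<n. \<Sum>k<n. \<Sum>l<n. if k = i then if l = j then C i j * C k l * G i j else 0 else 0)
      = (\<Sum>i<n. \<Sum>j<n. (C i j)\<^sup>2 * G i j)"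
    by (simp add: sum_delta_outer power2_eq_square)
  also have "(\<Sum>i<n. \<Sum>j<n. \<Sum>k<n. \<Sum>l<n. if l = i then if k = j then C i j * C k l * G i j else 0 else 0)
      = (\<Sum>i<n. \<Sum>j<n. (C i j)\<^sup>2 * G i j)"
    by (simp add: power2_eq_square C)
  finally show ?thesis by (simp add: Z_def)
qed

text \<open>\<open>E\<close> is a small multiple of \<open>A\<close>, minus about twice the rank-one
  matrix of row \<open>i\<close> of \<open>A\<close>, plus twice a positive semidefinite sum over
  \<open>a\<close>. Its term a = i nearly cancels the rank-one part, because \<open>A i i\<close> is
  near 1. What remains is bounded by \<open>contraction\<close> and by the row norm of
  \<open>A\<close>, each at the cost of a factor \<open>\<kappa>\<close>.\<close>

lemma E_form_ge:
  assumes i: "i < n"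
  shows "(\<Sum>j<n. \<Sum>l<n. C i j * C i l * E i j l) \<ge> - \<kappa> * (6 * c + 9 * \<rho>) * (\<Sum>j<n. (C i j)\<^sup>2)"
proof -
  define N where "N = (\<Sum>j<n. (C i j)\<^sup>2)"
  define w where "w a = (\<Sum>j<n. C i j * A j a)" for a
  define q where "q = (\<Sum>j<n. \<Sum>l<n. C i j * C i l * A j l)"
  have N0: "N \<ge> 0" by (simp add: N_def sum_nonneg)
  have q0: "0 \<le> q" "q \<le> \<kappa> * N"
  proof -
    have "q = \<kappa> * (\<Sum>j<n. \<Sum>l<n. C i j * C i l * p j l)"
      by (simp add: q_def A_def sum_distrib_left mult_ac)
    thus "0 \<le> q" "q \<le> \<kappa> * N"
      using lam contraction[of "C i"] quadratic_nonneg[of "C i"] by (auto simp: N_def)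
  qed
  have wi: "(\<Sum>j<n. C i j * A i j) = w i"
    unfolding w_def using i by (intro sum.cong refl) (simp add: A_sym)
  have "(w i)\<^sup>2 \<le> N * (\<Sum>j<n. (A i j)\<^sup>2)"
    unfolding wi[symmetric] N_def by (rule sum_Cauchy_Schwarz)
  also have "\<dots> = N * \<kappa> * A i i" using A_row_norm[OF i] by simp
  also have "\<dots> \<le> N * \<kappa> * 2" using A_diag(1)[OF i] rho N0 lam by (intro mult_left_mono) auto
  finally have w2: "(w i)\<^sup>2 \<le> 2 * \<kappa> * N" by (simp add: mult_ac)
  have Eeq: "E i j l = (1 - (1 + c) * A i i) * A j l - 2 * (1 + c) * (A i j * A i l)
      + 2 * (\<Sum>a<n. (A i a)\<^sup>2 * (A j a * A l a))" if "j < n" "l < n" for j l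
    unfolding E_def F_def using A_sym[OF \<open>j < n\<close> i]
    by (simp add: algebra_simps power2_eq_square)
  have "(\<Sum>j<n. \<Sum>l<n. C i j * C i l * E i j l)
      = (\<Sum>j<n. \<Sum>l<n. (1 - (1 + c) * A i i) * (C i j * C i l * A j l)
         - 2 * (1 + c) * ((C i j * A i j) * (C i l * A i l))
         + 2 * (\<Sum>a<n. (A i a)\<^sup>2 * ((C i j * A j a) * (C i l * A l a))))"
    by (intro sum.cong refl) (simp add: Eeq algebra_simps sum_distrib_left)
  also have "\<dots> = (1 - (1 + c) * A i i) * q - 2 * (1 + c) * (w i * w i)
      + 2 * (\<Sum>j<n. \<Sum>l<n. \<Sum>a<n. (A i a)\<^sup>2 * ((C i j * A j a) * (C i l * A l a)))"
    unfolding wi[symmetric] q_def sum_product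
    by (simp add: sum.distrib sum_subtractf sum_distrib_left)
  also have "(\<Sum>j<n. \<Sum>l<n. \<Sum>a<n. (A i a)\<^sup>2 * ((C i j * A j a) * (C i l * A l a)))
      = (\<Sum>j<n. \<Sum>a<n. \<Sum>l<n. (A i a)\<^sup>2 * ((C i j * A j a) * (C i l * A l a)))"
    by (intro sum.cong refl sum.swap)
  also have "\<dots> = (\<Sum>a<n. \<Sum>j<n. \<Sum>l<n. (A i a)\<^sup>2 * ((C i j * A j a) * (C i l * A l a)))"
    by (rule sum.swap)
  also have "\<dots> = (\<Sum>a<n. (A i a)\<^sup>2 * (w a)\<^sup>2)"
    unfolding w_def power2_eq_square[of "sum _ _"] sum_product by (simp add: sum_distrib_left)
  \<comment> \<open>Only the cancelling term a = i is kept; the others are nonnegative.\<close>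
  also have "(1 - (1 + c) * A i i) * q - 2 * (1 + c) * (w i * w i) + 2 * (\<Sum>a<n. (A i a)\<^sup>2 * (w a)\<^sup>2)
     \<ge> (1 - (1 + c) * A i i) * q - 2 * (1 + c) * (w i * w i) + 2 * ((A i i)\<^sup>2 * (w i)\<^sup>2)"
    using i by (intro add_left_mono mult_left_mono member_le_sum) auto
  finally have ge: "(\<Sum>j<n. \<Sum>l<n. C i j * C i l * E i j l)
     \<ge> (1 - (1 + c) * A i i) * q - 2 * (1 + c - (A i i)\<^sup>2) * (w i)\<^sup>2"
    by (simp add: algebra_simps power2_eq_square)
  have "(1 + c) * A i i \<le> (1 + c) * (1 + \<rho>)" using A_diag(1)[OF i] c_nonneg by (intro mult_left_mono) auto
  also have "\<dots> \<le> 1 + 2 * c + \<rho>" using mult_left_mono[OF rho(2) c_nonneg] by (simp add: algebra_simps)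
  finally have "(1 - (1 + c) * A i i) * q \<ge> - (2 * c + \<rho>) * q" 
    using q0 by (intro mult_right_mono) auto
  moreover have "(2 * c + \<rho>) * q \<le> (2 * c + \<rho>) * (\<kappa> * N)" using q0 c_nonneg rho by (intro mult_left_mono) auto
  ultimately have g1: "(1 - (1 + c) * A i i) * q \<ge> - (2 * c + \<rho>) * (\<kappa> * N)"
    unfolding mult_minus_left by linarith
  have "(A i i)\<^sup>2 \<ge> (1 - \<rho>)\<^sup>2" using A_diag(2)[OF i] rho by (intro power_mono) auto
  hence "1 + c - (A i i)\<^sup>2 \<le> c + 2 * \<rho>" by (simp add: power2_eq_square algebra_simps) (use zero_le_square[of \<rho>] in linarith)
  hence "(1 + c - (A i i)\<^sup>2) * (w i)\<^sup>2 \<le> (c + 2 * \<rho>) * (w i)\<^sup>2" by (intro mult_right_mono) auto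
  also have "\<dots> \<le> (c + 2 * \<rho>) * (2 * \<kappa> * N)" using w2 c_nonneg rho by (intro mult_left_mono) auto
  finally have g2: "2 * (1 + c - (A i i)\<^sup>2) * (w i)\<^sup>2 \<le> 2 * ((c + 2 * \<rho>) * (2 * \<kappa> * N))"
    by (simp only: mult.assoc)
  have "- (2 * c + \<rho>) * (\<kappa> * N) - 2 * ((c + 2 * \<rho>) * (2 * \<kappa> * N)) = - \<kappa> * (6 * c + 9 * \<rho>) * N"
    by (simp add: algebra_simps)
  thus ?thesis using ge g1 g2 unfolding N_def[symmetric] by linarith
qed

text \<open>The part of \<open>G\<close> free of fourth-order sums factors as (1 - A_ii)(1 - A_jj)
  up to nonnegative terms. In each summand of the fourth-order sum at least one of the two entries
  is off-diagonal, which gives \<open>\<rho>\<^sup>2\<close> times a row norm.\<close>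

lemma G_ge:
  assumes ij: "i < n" "j < n" "i \<noteq> j"
  shows "G i j \<ge> - 9 * \<kappa> * \<rho>"
proof -
  have "(\<Sum>a<n. A i a * A j a * A i a * A j a) \<le> (\<Sum>a<n. \<rho>\<^sup>2 * ((A i a)\<^sup>2 + (A j a)\<^sup>2))"
  proof (rule sum_mono)
    fix a assume a: "a \<in> {..<n}"
    have "A i a * A j a * A i a * A j a = (A i a)\<^sup>2 * (A j a)\<^sup>2" by (simp add: power2_eq_square)
    also have "\<dots> \<le> \<rho>\<^sup>2 * ((A i a)\<^sup>2 + (A j a)\<^sup>2)"
    proof (cases "a = i")
      case True
      have "(A j a)\<^sup>2 \<le> \<rho>\<^sup>2" using off_diag[of j a] ij a True rho unfolding A_def[symmetric]
        by (intro power2_le_iff_abs_le[THEN iffD2]) auto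
      hence "(A i a)\<^sup>2 * (A j a)\<^sup>2 \<le> (A i a)\<^sup>2 * \<rho>\<^sup>2" by (intro mult_left_mono) auto
      thus ?thesis by (simp add: algebra_simps add_increasing2)
    next
      case False
      have "(A i a)\<^sup>2 \<le> \<rho>\<^sup>2" using off_diag[of i a] ij a False rho unfolding A_def[symmetric]
        by (intro power2_le_iff_abs_le[THEN iffD2]) auto
      hence "(A i a)\<^sup>2 * (A j a)\<^sup>2 \<le> \<rho>\<^sup>2 * (A j a)\<^sup>2" by (intro mult_right_mono) auto
      thus ?thesis by (simp add: algebra_simps add_increasing)
    qed
    finally show "A i a * A j a * A i a * A j a \<le> \<rho>\<^sup>2 * ((A i a)\<^sup>2 + (A j a)\<^sup>2)" .
  qed
  also have "\<dots> = \<rho>\<^sup>2 * (\<kappa> * A i i + \<kappa> * A j j)"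
    using A_row_norm ij by (simp add: sum_distrib_left[symmetric] sum.distrib)
  also have "\<dots> \<le> \<rho>\<^sup>2 * (\<kappa> * 2 + \<kappa> * 2)"
    using A_diag(1)[OF ij(1)] A_diag(1)[OF ij(2)] rho lam by (intro mult_left_mono add_mono) auto
  finally have s: "(\<Sum>a<n. A i a * A j a * A i a * A j a) \<le> 4 * \<kappa> * \<rho>\<^sup>2" by (simp add: mult_ac)
  have "\<bar>(1 - A i i) * (1 - A j j)\<bar> \<le> \<rho> * \<rho>"
    unfolding abs_mult using diag ij rho unfolding A_def[symmetric]
    by (intro mult_mono) (auto simp: abs_minus_commute)
  hence d: "(1 - A i i) * (1 - A j j) \<ge> - (\<rho>\<^sup>2)" by (auto simp: power2_eq_square abs_le_iff)
  have "G i j = (1 - A i i) * (1 - A j j) + c * (A i i * A j j) + 2 * (1 + c) * (A i j)\<^sup>2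
      - 2 * (\<Sum>a<n. A i a * A j a * A i a * A j a)"
    unfolding G_def F_def using A_sym[OF ij(2,1)] by (simp add: algebra_simps power2_eq_square)
  moreover have "c * (A i i * A j j) \<ge> 0" "2 * (1 + c) * (A i j)\<^sup>2 \<ge> 0"
    using c_nonneg A_diag(3) ij by auto
  ultimately have "G i j \<ge> - (\<rho>\<^sup>2) - 8 * \<kappa> * \<rho>\<^sup>2" using s d by linarith
  moreover have "\<rho>\<^sup>2 \<le> \<rho>" using rho by (simp add: power2_eq_square mult_left_le)
  moreover have "\<rho> \<le> \<kappa> * \<rho>" "\<kappa> * \<rho>\<^sup>2 \<le> \<kappa> * \<rho>"
    using lam rho \<open>\<rho>\<^sup>2 \<le> \<rho>\<close> by (auto intro: mult_right_mono[of 1 \<kappa> \<rho>, simplified])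
  ultimately show ?thesis by linarith
qed

text \<open>The constants collect four \<open>E\<close> forms and two \<open>G\<close> forms: 24 = 4
  * 6 and 54 = 4 * 9 + 2 * 9.\<close>

lemma pair_form_ge:
  assumes C: "\<And>i j. C i j = C j i" "\<And>i. C i i = 0" and eta: "\<eta> \<ge> 0" and th: "\<theta> \<ge> 0" "\<kappa>\<^sup>2 * \<theta> \<le> 1 + \<eta>"
    and T: "\<And>x. (\<Sum>i<n. x i) = 0 \<Longrightarrow> (\<Sum>i<n. \<Sum>j<n. x i * x j * (p i j)\<^sup>2) \<le> \<theta> * (\<Sum>i<n. (x i)\<^sup>2)"
  shows "(\<Sum>i<n. \<Sum>j<n. \<Sum>k<n. \<Sum>l<n. C i j * C k l * Y i j k l)
    \<ge> (frob n C A)\<^sup>2 - (2 * \<kappa>\<^sup>2 * \<eta> + \<kappa> * (24 * c + 54 * \<rho>)) * frob n C C"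
proof -
  have CC: "frob n C C = (\<Sum>i<n. \<Sum>j<n. (C i j)\<^sup>2)" by (simp add: frob_def power2_eq_square)
  have "(\<Sum>i<n. \<Sum>j<n. \<Sum>l<n. C i j * C i l * E i j l) \<ge> (\<Sum>i<n. - \<kappa> * (6 * c + 9 * \<rho>) * (\<Sum>j<n. (C i j)\<^sup>2))"
    by (intro sum_mono E_form_ge) auto
  hence e: "(\<Sum>i<n. \<Sum>j<n. \<Sum>l<n. C i j * C i l * E i j l) \<ge> - \<kappa> * (6 * c + 9 * \<rho>) * frob n C C"
    unfolding CC by (simp add: sum_distrib_left)
  have "(\<Sum>i<n. \<Sum>j<n. (C i j)\<^sup>2 * G i j) \<ge> (\<Sum>i<n. \<Sum>j<n. (C i j)\<^sup>2 * (- 9 * \<kappa> * \<rho>))"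
  proof (intro sum_mono)
    fix i j assume "i \<in> {..<n}" "j \<in> {..<n}"
    thus "(C i j)\<^sup>2 * (- 9 * \<kappa> * \<rho>) \<le> (C i j)\<^sup>2 * G i j"
      using C(2) by (cases "i = j") (simp, intro mult_left_mono G_ge, auto)
  qed
  hence g: "(\<Sum>i<n. \<Sum>j<n. (C i j)\<^sup>2 * G i j) \<ge> - 9 * \<kappa> * \<rho> * frob n C C"
    unfolding CC by (simp add: sum_distrib_left sum_distrib_right mult_ac)
  have w: "(\<Sum>i<n. \<Sum>j<n. \<Sum>k<n. \<Sum>l<n. C i j * C k l * F i j k l) \<ge> (frob n C A)\<^sup>2 - 2 * \<kappa>\<^sup>2 * \<eta> * frob n C C"
    using C(1) eta th T by (rule wick_form_ge)
  define K where "K = frob n C C"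
  define Z W where "Z = (\<Sum>i<n. \<Sum>j<n. \<Sum>l<n. C i j * C i l * E i j l)" and "W = (\<Sum>i<n. \<Sum>j<n. (C i j)\<^sup>2 * G i j)"
  have "Z \<ge> - (6 * (\<kappa> * c * K)) - 9 * (\<kappa> * \<rho> * K)" "W \<ge> - (9 * (\<kappa> * \<rho> * K))"
    using e g by (simp_all add: K_def Z_def W_def algebra_simps)
  moreover have "(2 * \<kappa>\<^sup>2 * \<eta> + \<kappa> * (24 * c + 54 * \<rho>)) * K
     = 2 * \<kappa>\<^sup>2 * \<eta> * K + 24 * (\<kappa> * c * K) + 54 * (\<kappa> * \<rho> * K)" by (simp add: algebra_simps)
  ultimately show ?thesis
    using overlap_form_eq[of C, OF C] w unfolding K_def[symmetric] Z_def[symmetric] W_def[symmetric] by linarith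
qed

end

section \<open>From the quadratic form to a degree-4 solution\<close>

lemma sum_two_subsets:
  fixes f :: "nat set \<Rightarrow> real"
  shows "(\<Sum>S | S \<subseteq> {..<n} \<and> card S = 2. f S) = (\<Sum>i<n. \<Sum>j<n. if i = j then 0 else f {i, j} / 2)"
proof -
  let ?P = "{S. S \<subseteq> {..<n} \<and> card S = 2}"
  let ?D = "{x \<in> {..<n} \<times> {..<n}. fst x \<noteq> snd x}"
  let ?g = "\<lambda>x :: nat \<times> nat. {fst x, snd x}"
  have fin: "finite ?D" "finite ?P" by auto
  have "(\<Sum>S\<in>?P. \<Sum>x\<in>{x \<in> ?D. ?g x = S}. f (?g x) / 2) = (\<Sum>x\<in>?D. f (?g x) / 2)"
    by (rule sum.group[OF fin]) auto
  moreover have "(\<Sum>x\<in>{x \<in> ?D. ?g x = S}. f (?g x) / 2) = f S" if S: "S \<in> ?P" for S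
  proof -
    obtain a b where ab: "S = {a, b}" "a \<noteq> b" using S by (auto simp: card_2_iff)
    have "{x \<in> ?D. ?g x = S} = {(a, b), (b, a)}"
      using ab S by (auto simp: doubleton_eq_iff)
    thus ?thesis using ab by (simp add: insert_commute)
  qed
  hence "(\<Sum>S\<in>?P. \<Sum>x\<in>{x \<in> ?D. ?g x = S}. f (?g x) / 2) = (\<Sum>S\<in>?P. f S)"
    by (rule sum.cong[OF refl])
  ultimately have "(\<Sum>S\<in>?P. f S) = (\<Sum>x\<in>?D. f (?g x) / 2)" by (simp only:)
  also have "\<dots> = (\<Sum>x\<in>{..<n} \<times> {..<n}. if fst x = snd x then 0 else f (?g x) / 2)"
    by (rule sum.mono_neutral_cong_left) auto
  finally show ?thesis by (simp add: sum.cartesian_product case_prod_beta)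
qed

lemma sum_subsets_upto2:
  fixes f :: "nat set \<Rightarrow> real"
  shows "(\<Sum>S\<in>subsets_upto2 n. f S)
    = f {} + (\<Sum>i<n. f {i}) + (\<Sum>i<n. \<Sum>j<n. if i = j then 0 else f {i, j} / 2)"
proof -
  let ?P = "{S. S \<subseteq> {..<n} \<and> card S = 2}"
  have e: "subsets_upto2 n = insert {} ((\<lambda>i. {i}) ` {..<n} \<union> ?P)"
  proof -
    have 1: "S \<in> insert {} ((\<lambda>i. {i}) ` {..<n} \<union> ?P)" if S: "S \<subseteq> {..<n}" "card S \<le> 2" for S
    proof -
      have "finite S" using S(1) finite_subset by blast
      then consider "S = {}" | "card S = 1" | "card S = 2"
        using S(2) card_gt_0_iff[of S] by linarith
      thus ?thesis
      proof cases
        case 2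
        then obtain i where "S = {i}" by (rule card_1_singletonE)
        thus ?thesis using S(1) by simp
      qed (use S in simp_all)
    qed
    have 2: "insert {} ((\<lambda>i. {i}) ` {..<n} \<union> ?P) \<subseteq> {S. S \<subseteq> {..<n} \<and> card S \<le> 2}"
      by auto
    show ?thesis unfolding subsets_upto2_def using 1 2 by blast
  qed
  have "(\<Sum>S\<in>subsets_upto2 n. f S) = f {} + (\<Sum>S\<in>(\<lambda>i. {i}) ` {..<n} \<union> ?P. f S)"
    unfolding e by (subst sum.insert) auto
  also have "(\<Sum>S\<in>(\<lambda>i. {i}) ` {..<n} \<union> ?P. f S) = (\<Sum>S\<in>(\<lambda>i. {i}) ` {..<n}. f S) + (\<Sum>S\<in>?P. f S)"
    by (rule sum.union_disjoint) auto
  also have "(\<Sum>S\<in>(\<lambda>i. {i}) ` {..<n}. f S) = (\<Sum>i<n. f {i})"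
    by (subst sum.reindex) auto
  finally show ?thesis by (simp add: sum_two_subsets)
qed

text \<open>For i \<noteq> j and k \<noteq> l this is \<open>x\<close> if {i, j} = {k, l} and 0
  otherwise. The nested conditionals let sums over \<open>k\<close> and \<open>l\<close>
  collapse.\<close>

abbreviation delta_pair :: "nat \<Rightarrow> nat \<Rightarrow> nat \<Rightarrow> nat \<Rightarrow> real \<Rightarrow> real" where
  "delta_pair i j k l x \<equiv>
    (if k = i then if l = j then x else 0 else 0) + (if l = i then if k = j then x else 0 else 0)"

section \<open>Moments as functions of a set, and positivity of their matrix\<close>

context scaled_kernel
begin

text \<open>A relation, because the values on sets of size 2 and 4 are given through an enumeration
  of the set.\<close>

definition moment :: "nat set \<Rightarrow> real \<Rightarrow> bool" where
  "moment U v \<longleftrightarrow>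
     (\<exists>i j. i \<noteq> j \<and> U = {i, j} \<and> v = A i j) \<or>
     (\<exists>i j k l. distinct [i, j, k, l] \<and> U = {i, j, k, l} \<and> v = F i j k l) \<or>
     (odd (card U) \<and> v = 0)"

text \<open>The mixture with weights t and 1 - t of the conditioned Gaussian and the uniform cube,
  whose moments vanish on every nonempty set. On the index sets that occur, the choice is unique by
  parity and the symmetry of \<open>A\<close> and \<open>F\<close>.\<close>

definition pseudo_moment :: "real \<Rightarrow> nat set \<Rightarrow> real" where
  "pseudo_moment t U = (if U = {} then 1 else t * (SOME v. moment U v))"

lemma pseudo_moment_empty: "pseudo_moment t {} = 1"
  by (simp add: pseudo_moment_def)

lemma pseudo_moment_odd: assumes "odd (card U)" shows "pseudo_moment t U = 0"
proof -
  have "(SOME v. moment U v) = 0"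
    by (rule some_equality) (use assms in \<open>auto simp: moment_def\<close>)
  thus ?thesis using assms by (auto simp: pseudo_moment_def)
qed

lemma pseudo_moment_pair: assumes "i < n" "j < n" "i \<noteq> j" shows "pseudo_moment t {i, j} = t * A i j"
proof -
  have "(SOME v. moment {i, j} v) = A i j"
  proof (rule some_equality)
    fix v assume "moment {i, j} v"
    thus "v = A i j" unfolding moment_def
    proof (elim disjE exE conjE)
      fix i' j' assume "{i, j} = {i', j'}" "v = A i' j'"
      thus "v = A i j" using assms A_sym by (auto simp: doubleton_eq_iff)
    next
      fix i' j' k l assume "distinct [i', j', k, l]" "{i, j} = {i', j', k, l}"
      hence "card {i, j} = 4" by simp
      thus "v = A i j" using assms by simp
    next
      assume "odd (card {i, j})"
      thus "v = A i j" using assms by simp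
    qed
  qed (use assms in \<open>unfold moment_def, blast\<close>)
  thus ?thesis by (simp add: pseudo_moment_def)
qed

lemma F_sym_tail:
  assumes "i < n" "j < n" "k < n" "l < n" "distinct [j, k, l]" "distinct [j', k', l']"
    and "{j, k, l} = {j', k', l'}"
  shows "F i j' k' l' = F i j k l"
proof -
  have "j' \<in> {j, k, l}" "k' \<in> {j, k, l}" "l' \<in> {j, k, l}" using assms(7) by auto
  hence "(j', k', l') \<in> {(j, k, l), (j, l, k), (k, j, l), (k, l, j), (l, j, k), (l, k, j)}"
    using assms(6) by auto
  thus ?thesis using F_perm(2,3) assms(1-4) by auto
qed

text \<open>The transpositions of \<open>F_perm\<close> generate all permutations. The cases say
  which index comes first; the order of the other three is settled by
  \<open>F_sym_tail\<close>.\<close>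

lemma F_sym:
  assumes "i < n" "j < n" "k < n" "l < n" "distinct [i, j, k, l]" "distinct [i', j', k', l']"
    and e: "{i, j, k, l} = {i', j', k', l'}"
  shows "F i' j' k' l' = F i j k l"
proof -
  have t: "{i, j, k, l} - {i'} = {j', k', l'}" unfolding e using assms(6) by auto
  have "i' \<in> {i, j, k, l}" using e by auto
  then consider "i' = i" | "i' = j" | "i' = k" | "i' = l" by auto
  thus ?thesis
  proof cases
    case 1
    hence "{j, k, l} = {j', k', l'}" using t assms(5) by auto
    thus ?thesis using F_sym_tail[of i j k l j' k' l'] assms 1 by simp
  next
    case 2
    hence "{i, k, l} = {j', k', l'}" using t assms(5) by auto
    hence "F i' j' k' l' = F j i k l" using F_sym_tail[of j i k l j' k' l'] assms 2 by simp
    thus ?thesis using F_perm(1)[of i j k l] assms by simp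
  next
    case 3
    hence "{i, j, l} = {j', k', l'}" using t assms(5) by auto
    hence "F i' j' k' l' = F k i j l" using F_sym_tail[of k i j l j' k' l'] assms 3 by simp
    thus ?thesis using F_perm(1)[of i k j l] F_perm(3)[of i j k l] assms by simp
  next
    case 4
    hence "{i, j, k} = {j', k', l'}" using t assms(5) by auto
    hence "F i' j' k' l' = F l i j k" using F_sym_tail[of l i j k j' k' l'] assms 4 by simp
    thus ?thesis using F_perm(1)[of i l j k] F_perm(3)[of i j l k] F_perm(2)[of k l i j] assms by simp
  qed
qed

lemma pseudo_moment_quad: assumes "i < n" "j < n" "k < n" "l < n" "distinct [i, j, k, l]"
  shows "pseudo_moment t {i, j, k, l} = t * F i j k l"
proof -
  have c: "card {i, j, k, l} = 4" using assms by simp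
  have "(SOME v. moment {i, j, k, l} v) = F i j k l"
  proof (rule some_equality)
    fix v assume "moment {i, j, k, l} v"
    thus "v = F i j k l" unfolding moment_def
    proof (elim disjE exE conjE)
      fix i' j' assume "i' \<noteq> j'" "{i, j, k, l} = {i', j'}"
      hence "card {i, j, k, l} = 2" by simp
      thus "v = F i j k l" using c by simp
    next
      fix i' j' k' l' assume "distinct [i', j', k', l']" "{i, j, k, l} = {i', j', k', l'}" "v = F i' j' k' l'"
      thus "v = F i j k l" using F_sym[OF assms] by simp
    next
      assume "odd (card {i, j, k, l})"
      thus "v = F i j k l" using c by simp
    qed
  qed (use assms(5) in \<open>unfold moment_def, blast\<close>)
  thus ?thesis by (simp add: pseudo_moment_def)
qed

lemma pseudo_moment_sym_diff_pairs:
  assumes "i < n" "j < n" "k < n" "l < n" "i \<noteq> j" "k \<noteq> l"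
  shows "pseudo_moment t (sym_diff {i, j} {k, l}) = t * Y i j k l
    + (1 - t) * delta_pair i j k l 1"
proof -
  consider "k = i" "l = j" | "k = i" "l \<noteq> j" | "l = i" "k = j" | "l = i" "k \<noteq> j" | "k = j" "l \<noteq> i" | "l = j" "k \<noteq> i"
    | "distinct [i, j, k, l]" using assms by auto
  thus ?thesis
  proof cases
    case 1 thus ?thesis using assms by (simp add: pseudo_moment_empty Y_def)
  next
    case 2
    hence "sym_diff {i, j} {k, l} = {j, l}" using assms by auto
    thus ?thesis using 2 assms by (simp add: pseudo_moment_pair Y_def)
  next
    case 3
    hence "sym_diff {i, j} {k, l} = {}" by auto
    thus ?thesis using 3 assms by (simp add: pseudo_moment_empty Y_def)
  next
    case 4
    hence "sym_diff {i, j} {k, l} = {j, k}" using assms by auto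
    thus ?thesis using 4 assms by (simp add: pseudo_moment_pair Y_def)
  next
    case 5
    hence "sym_diff {i, j} {k, l} = {i, l}" using assms by auto
    thus ?thesis using 5 assms by (simp add: pseudo_moment_pair Y_def)
  next
    case 6
    hence "sym_diff {i, j} {k, l} = {i, k}" using assms by auto
    thus ?thesis using 6 assms by (simp add: pseudo_moment_pair Y_def)
  next
    case 7
    hence "sym_diff {i, j} {k, l} = {i, j, k, l}" by auto
    thus ?thesis using 7 assms pseudo_moment_quad[of i j k l t] by (simp add: Y_def)
  qed
qed

lemma pseudo_moment_sym_diff_singles:
  assumes "i < n" "j < n"
  shows "pseudo_moment t (sym_diff {i} {j}) = (if i = j then 1 else t * A i j)"
proof (cases "i = j")
  case False
  hence "sym_diff {i} {j} = {i, j}" by auto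
  thus ?thesis using pseudo_moment_pair[OF assms False] False by simp
qed (simp add: pseudo_moment_empty)

lemma pseudo_moment_sym_diff_odd:
  assumes "j \<noteq> k"
  shows "pseudo_moment t (sym_diff {i} {j, k}) = 0"
proof (rule pseudo_moment_odd)
  show "odd (card (sym_diff {i} {j, k}))"
  proof -
    consider "i = j" | "i = k" | "distinct [i, j, k]" using assms by auto
    thus ?thesis
    proof cases
      case 1
      have "sym_diff {j} {j, k} = {k}" using assms by blast
      thus ?thesis unfolding 1 by (simp only: card.empty card_insert_disjoint finite.emptyI empty_iff simp_thms) simp
    next
      case 2
      have "sym_diff {k} {j, k} = {j}" using assms by blast
      thus ?thesis unfolding 2 by (simp only: card.empty card_insert_disjoint finite.emptyI empty_iff simp_thms) simp
    next
      case 3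
      hence "sym_diff {i} {j, k} = {i, j, k}" by auto
      thus ?thesis using 3 by simp
    qed
  qed
qed

text \<open>The matrix splits by parity into the block of sets of size 0 and 2 and the block of
  singletons. In the even block the identity contributed by the cube pays for the error of
  \<open>pair_form_ge\<close>, whence the weight 1 - L. The value loses one \<open>L\<close> to the
  mixing and at most another to \<rho> \<le> L.\<close>

lemma sos4_solution_exists:
  assumes eta: "\<eta> \<ge> 0" and th: "\<theta> \<ge> 0" "\<kappa>\<^sup>2 * \<theta> \<le> 1 + \<eta>"
    and T: "\<And>x. (\<Sum>i<n. x i) = 0 \<Longrightarrow> (\<Sum>i<n. \<Sum>j<n. x i * x j * (p i j)\<^sup>2) \<le> \<theta> * (\<Sum>i<n. (x i)\<^sup>2)"
    and L: "L = 2 * \<kappa>\<^sup>2 * \<eta> + \<kappa> * (24 * c + 54 * \<rho>)" "L \<le> 1"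
    and tr: "\<kappa> * (\<Sum>i<n. p i i) = n"
  shows "\<exists>M. sos4_solution n M \<and> (1 / n) * (\<Sum>i<n. \<Sum>j<n. p i j * M {i} {j}) \<ge> 1 - 2 * L"
proof -
  define t where "t = 1 - L"
  have "\<rho> \<le> \<kappa> * \<rho>" using lam rho by (auto intro: mult_right_mono[of 1 \<kappa> \<rho>, simplified])
  moreover have "0 \<le> \<kappa> * c" "0 \<le> \<kappa>\<^sup>2 * \<eta>" "0 \<le> \<kappa> * \<rho>" using lam c_nonneg eta rho by auto
  ultimately have L0: "\<rho> \<le> L" unfolding L by (simp add: algebra_simps)
  have Lr: "0 \<le> L * \<rho>" using L0 rho by simp
  have t: "0 \<le> t" "t \<le> 1" using L L0 rho by (auto simp: t_def)
  define M where "M S T = pseudo_moment t (sym_diff S T)" for S T :: "nat set"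
  have "psd_on (subsets_upto2 n) M"
    unfolding psd_on_def
  proof (intro conjI ballI allI)
    fix S T show "M S T = M T S" by (simp add: M_def Un_commute)
  next
    fix x :: "nat set \<Rightarrow> real"
    \<comment> \<open>The coefficient of a two-element set is spread evenly over its two orderings,
      which makes \<open>C\<close> symmetric with zero diagonal.\<close>
    define C where "C i j = (if i = j then 0 else x {i, j} / 2)" for i j
    have C: "C i j = C j i" "C i i = 0" for i j by (auto simp: C_def insert_commute)
    have sC: "(\<Sum>S\<in>subsets_upto2 n. x S * g S) = x {} * g {} + (\<Sum>i<n. x {i} * g {i}) + (\<Sum>i<n. \<Sum>j<n. C i j * g {i, j})"
      for g unfolding sum_subsets_upto2 C_def by (simp add: if_distrib[of "\<lambda>z. z * _"] cong: if_cong)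
    define h where "h S = (\<Sum>T\<in>subsets_upto2 n. x T * M S T)" for S
    have h0: "h {} = x {} + t * frob n C A"
    proof -
      have "(\<Sum>i<n. \<Sum>j<n. C i j * M {} {i, j}) = (\<Sum>i<n. \<Sum>j<n. t * (C i j * A i j))"
        by (intro sum.cong refl) (auto simp: M_def C_def pseudo_moment_pair)
      thus ?thesis unfolding h_def sC by (simp add: M_def pseudo_moment_empty pseudo_moment_odd frob_def sum_distrib_left)
    qed
    have h1: "h {i} = (\<Sum>j<n. x {j} * (if i = j then 1 else t * A i j))" if "i < n" for i
    proof -
      have "C j k * M {i} {j, k} = 0" for j k
        using pseudo_moment_sym_diff_odd[of j k t i] by (cases "j = k") (auto simp: M_def C_def)
      moreover have "M {i} {} = 0" by (simp add: M_def pseudo_moment_odd)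
      moreover have "(\<Sum>j<n. x {j} * M {i} {j}) = (\<Sum>j<n. x {j} * (if i = j then 1 else t * A i j))"
        unfolding M_def using that by (intro sum.cong refl) (simp only: pseudo_moment_sym_diff_singles lessThan_iff)
      ultimately show ?thesis unfolding h_def sC by simp
    qed
    have h2: "h {i, j} = x {} * (t * A i j) + (\<Sum>k<n. \<Sum>l<n. C k l * (t * Y i j k l + (1 - t) * delta_pair i j k l 1))"
      if "i < n" "j < n" "i \<noteq> j" for i j
    proof -
      have M1: "M {i, j} {k} = 0" for k
        using pseudo_moment_sym_diff_odd[OF that(3), of t k] by (simp add: M_def Un_commute)
      have M0: "M {i, j} {} = t * A i j" using that by (simp add: M_def pseudo_moment_pair)
      have eq: "C k l * M {i, j} {k, l} = C k l * (t * Y i j k l + (1 - t) * delta_pair i j k l 1)"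
        if "k < n" "l < n" for k l
      proof (cases "k = l")
        case False
        show ?thesis unfolding M_def pseudo_moment_sym_diff_pairs[OF \<open>i < n\<close> \<open>j < n\<close> that \<open>i \<noteq> j\<close> False] ..
      qed (simp add: C)
      have "(\<Sum>k<n. \<Sum>l<n. C k l * M {i, j} {k, l}) = (\<Sum>k<n. \<Sum>l<n. C k l * (t * Y i j k l + (1 - t) * delta_pair i j k l 1))"
        by (intro sum.cong refl eq) auto
      thus ?thesis unfolding h_def sC by (simp only: M0 M1 mult_zero_right sum.neutral_const add_0_right)
    qed
    have "(\<Sum>S\<in>subsets_upto2 n. \<Sum>T\<in>subsets_upto2 n. x S * M S T * x T) = (\<Sum>S\<in>subsets_upto2 n. x S * h S)"
      by (simp add: h_def sum_distrib_left mult_ac)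
    also have "\<dots> = x {} * h {} + (\<Sum>i<n. x {i} * h {i}) + (\<Sum>i<n. \<Sum>j<n. C i j * h {i, j})" by (rule sC)
    finally have total: "(\<Sum>S\<in>subsets_upto2 n. \<Sum>T\<in>subsets_upto2 n. x S * M S T * x T)
      = x {} * h {} + (\<Sum>i<n. x {i} * h {i}) + (\<Sum>i<n. \<Sum>j<n. C i j * h {i, j})" .
    have "(\<Sum>i<n. \<Sum>j<n. C i j * h {i, j}) = (\<Sum>i<n. \<Sum>j<n. x {} * t * (C i j * A i j)
        + (\<Sum>k<n. \<Sum>l<n. t * (C i j * C k l * Y i j k l)
           + delta_pair i j k l ((1 - t) * (C i j * C k l))))"
    proof (intro sum.cong refl)
      fix i j assume "i \<in> {..<n}" "j \<in> {..<n}"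
      thus "C i j * h {i, j} = x {} * t * (C i j * A i j)
        + (\<Sum>k<n. \<Sum>l<n. t * (C i j * C k l * Y i j k l)
           + delta_pair i j k l ((1 - t) * (C i j * C k l)))"
      proof (cases "i = j")
        case False
        have "C i j * h {i, j} = C i j * (x {} * (t * A i j)) + (\<Sum>k<n. \<Sum>l<n. C i j * (C k l * (t * Y i j k l + (1 - t) * delta_pair i j k l 1)))"
          unfolding h2[OF \<open>i \<in> {..<n}\<close>[unfolded lessThan_iff] \<open>j \<in> {..<n}\<close>[unfolded lessThan_iff] False]
            distrib_left[of "C i j"] sum_distrib_left[of "C i j"] ..
        also have "C i j * (x {} * (t * A i j)) = x {} * t * (C i j * A i j)" by simp
        also have "(\<Sum>k<n. \<Sum>l<n. C i j * (C k l * (t * Y i j k l + (1 - t) * delta_pair i j k l 1)))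
          = (\<Sum>k<n. \<Sum>l<n. t * (C i j * C k l * Y i j k l)
           + delta_pair i j k l ((1 - t) * (C i j * C k l)))"
          by (intro sum.cong refl) (simp add: algebra_simps)
        finally show ?thesis .
      qed (simp add: C)
    qed
    also have "\<dots> = x {} * t * frob n C A + t * (\<Sum>i<n. \<Sum>j<n. \<Sum>k<n. \<Sum>l<n. C i j * C k l * Y i j k l)
        + ((1 - t) * frob n C C + (1 - t) * frob n C C)"
      by (simp add: sum.distrib sum_delta_outer frob_def sum_distrib_left C mult_ac)
    finally have even: "(\<Sum>i<n. \<Sum>j<n. C i j * h {i, j}) = x {} * t * frob n C A
        + t * (\<Sum>i<n. \<Sum>j<n. \<Sum>k<n. \<Sum>l<n. C i j * C k l * Y i j k l) + 2 * (1 - t) * frob n C C" by simp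
    have "t * (\<Sum>i<n. \<Sum>j<n. \<Sum>k<n. \<Sum>l<n. C i j * C k l * Y i j k l) \<ge> t * ((frob n C A)\<^sup>2 - L * frob n C C)"
      unfolding L(1) using t(1) pair_form_ge[of C, OF C eta th T] by (intro mult_left_mono) auto
    moreover have "t * (L * frob n C C) \<le> 1 * (L * frob n C C)"
      using t L0 rho frob_nonneg by (intro mult_right_mono mult_nonneg_nonneg) auto
    moreover have "0 \<le> t * (x {} + frob n C A)\<^sup>2" "0 \<le> L * (x {})\<^sup>2" "0 \<le> L * frob n C C"
      using t L0 rho frob_nonneg by auto
    \<comment> \<open>The left side is at least t (x_0 + K)^2 + L x_0^2 + L |C|^2, where x_0 is the
      coefficient of the empty set and K = \<open>frob n C A\<close>. Of the 2 L |C|^2 from the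
      cube, at most half is spent on the error.\<close>
    ultimately have "x {} * h {} + (\<Sum>i<n. \<Sum>j<n. C i j * h {i, j}) \<ge> 0"
      unfolding even h0 by (simp add: t_def algebra_simps power2_eq_square)
    moreover have "(\<Sum>i<n. x {i} * h {i}) \<ge> 0"
    proof -
      \<comment> \<open>The odd block is \<open>t\<close> times \<open>A\<close> with its diagonal
        reset to 1: a positive semidefinite matrix plus the diagonal 1 - t A_ii. The latter is
        nonnegative since (1 - L)(1 + \<rho>) \<le> 1 for \<rho> \<le> L.\<close>
      have "(\<Sum>i<n. x {i} * h {i}) = (\<Sum>i<n. \<Sum>j<n. t * \<kappa> * (x {i} * x {j} * p i j) + (if i = j then (x {i})\<^sup>2 * (1 - t * A i i) else 0))"
      proof (rule sum.cong[OF refl])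
        fix i assume "i \<in> {..<n}"
        hence "x {i} * h {i} = (\<Sum>j<n. x {i} * (x {j} * (if i = j then 1 else t * A i j)))"
          by (simp add: h1 sum_distrib_left)
        also have "\<dots> = (\<Sum>j<n. t * \<kappa> * (x {i} * x {j} * p i j) + (if i = j then (x {i})\<^sup>2 * (1 - t * A i i) else 0))"
          by (rule sum.cong[OF refl]) (auto simp: A_def power2_eq_square algebra_simps)
        finally show "x {i} * h {i} = (\<Sum>j<n. t * \<kappa> * (x {i} * x {j} * p i j) + (if i = j then (x {i})\<^sup>2 * (1 - t * A i i) else 0))" .
      qed
      also have "\<dots> = t * \<kappa> * (\<Sum>i<n. \<Sum>j<n. x {i} * x {j} * p i j) + (\<Sum>i<n. (x {i})\<^sup>2 * (1 - t * A i i))"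
        by (simp add: sum.distrib sum_distrib_left)
      also have "\<dots> \<ge> 0"
      proof (rule add_nonneg_nonneg)
        show "0 \<le> t * \<kappa> * (\<Sum>i<n. \<Sum>j<n. x {i} * x {j} * p i j)"
          using quadratic_nonneg[of "\<lambda>i. x {i}"] t lam by simp
        show "0 \<le> (\<Sum>i<n. (x {i})\<^sup>2 * (1 - t * A i i))"
        proof (intro sum_nonneg mult_nonneg_nonneg)
          fix i assume "i \<in> {..<n}"
          hence "t * A i i \<le> t * (1 + \<rho>)" using A_diag(1) t by (intro mult_left_mono) auto
          also have "\<dots> \<le> 1" using L0 Lr by (simp add: t_def algebra_simps)
          finally show "0 \<le> 1 - t * A i i" by simp
        qed simp
      qed
      finally show ?thesis .
    qed
    ultimately show "0 \<le> (\<Sum>S\<in>subsets_upto2 n. \<Sum>T\<in>subsets_upto2 n. x S * M S T * x T)"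
      unfolding total by simp
  qed
  hence sol: "sos4_solution n M" unfolding sos4_solution_def by (simp add: M_def pseudo_moment_empty)
  define D where "D = (\<Sum>i<n. p i i)"
  have D: "0 \<le> D" "D \<le> n" "\<kappa> * D = n"
    using p_diag sum_bounded_above[of "{..<n}" "\<lambda>i. p i i" 1] tr by (auto simp: D_def intro!: sum_nonneg)
  \<comment> \<open>By idempotence row \<open>i\<close> contributes t \<kappa> p_ii, and resetting
    the diagonal entry of \<open>A\<close> to 1 costs at most t \<rho> p_ii. Here \<kappa> D = n and
    D \<le> n.\<close>
  have "t * (1 - \<rho>) * n \<le> t * ((\<kappa> - \<rho>) * D)"
    using t D mult_left_mono[OF D(2) rho(1)] unfolding mult.assoc by (intro mult_left_mono) (auto simp: algebra_simps)
  also have "\<dots> = (\<Sum>i<n. t * (\<kappa> * p i i) - t * (\<rho> * p i i))"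
    by (simp add: D_def sum_subtractf sum_distrib_left algebra_simps)
  also have "\<dots> \<le> (\<Sum>i<n. \<Sum>j<n. p i j * M {i} {j})"
  proof (rule sum_mono)
    fix i assume i: "i \<in> {..<n}"
    have "(\<Sum>j<n. p i j * M {i} {j}) = (\<Sum>j<n. t * \<kappa> * (p i j)\<^sup>2 + (if i = j then p i i * (1 - t * A i i) else 0))"
      unfolding M_def using i
      by (intro sum.cong refl, subst pseudo_moment_sym_diff_singles) (auto simp: A_def power2_eq_square algebra_simps)
    also have "\<dots> = t * (\<kappa> * p i i) + p i i * (1 - t * A i i)"
      using i row_norm[of i] by (simp add: sum.distrib sum_distrib_left[symmetric])
    finally have "(\<Sum>j<n. p i j * M {i} {j}) = t * (\<kappa> * p i i) + p i i * (1 - t * A i i)" .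
    moreover have "p i i * (- t * \<rho>) \<le> p i i * (1 - t * A i i)"
    proof (rule mult_left_mono)
      have "t * A i i \<le> t * (1 + \<rho>)" using A_diag(1) t i by (intro mult_left_mono) auto
      thus "- t * \<rho> \<le> 1 - t * A i i" using t by (simp add: algebra_simps)
    qed (use p_diag i in auto)
    ultimately show "t * (\<kappa> * p i i) - t * (\<rho> * p i i) \<le> (\<Sum>j<n. p i j * M {i} {j})" by (simp add: mult_ac)
  qed
  finally have "t * (1 - \<rho>) \<le> (1 / n) * (\<Sum>i<n. \<Sum>j<n. p i j * M {i} {j})"
    using n_pos by (simp add: field_simps)
  moreover have "t * (1 - \<rho>) = 1 - L - \<rho> + L * \<rho>" by (simp add: t_def algebra_simps)
  hence "1 - 2 * L \<le> t * (1 - \<rho>)" using L0 Lr by linarith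
  ultimately show ?thesis using sol by (intro exI[of _ M]) auto
qed

end

section \<open>Entries of a random projection\<close>

text \<open>The kernel R q R^T for the rotation R of the plane of \<open>a\<close> and
  \<open>b\<close>; \<open>u\<close> is the action of R on one index, applied to both.\<close>

definition rotate :: "nat \<Rightarrow> nat \<Rightarrow> real \<Rightarrow> real \<Rightarrow> (nat \<Rightarrow> nat \<Rightarrow> real) \<Rightarrow> nat \<Rightarrow> nat \<Rightarrow> real" where
  "rotate a b c s q i j =
    (let u = (\<lambda>f i. if i = a then c * f a - s * f b else if i = b then s * f a + c * f b else f i)
     in u (\<lambda>i. u (q i) j) i)"

lemma rotate_simps:
  "e \<noteq> a \<Longrightarrow> e \<noteq> b \<Longrightarrow> rotate a b c s q e a = c * q e a - s * q e b"
  "a \<noteq> b \<Longrightarrow> e \<noteq> a \<Longrightarrow> e \<noteq> b \<Longrightarrow> rotate a b c s q e b = s * q e a + c * q e b"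
  "e \<noteq> a \<Longrightarrow> e \<noteq> b \<Longrightarrow> f \<noteq> a \<Longrightarrow> f \<noteq> b \<Longrightarrow> rotate a b c s q e f = q e f"
  "a \<noteq> b \<Longrightarrow> rotate a b c s q a b = c * (s * q a a + c * q a b) - s * (s * q b a + c * q b b)"
  by (auto simp: rotate_def Let_def)

text \<open>All that is used about the random projection. Invariance is stated for functions of the
  whole kernel with measurability asked of the composition, so that no sigma-algebra on kernels is
  needed.\<close>

locale invariant_kernel = prob_space M for M :: "'a measure" +
  fixes n :: nat and d :: real and p :: "'a \<Rightarrow> nat \<Rightarrow> nat \<Rightarrow> real"
  assumes p_meas: "\<And>i j. i < n \<Longrightarrow> j < n \<Longrightarrow> (\<lambda>\<omega>. p \<omega> i j) \<in> borel_measurable M"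
    and kernel: "\<And>\<omega>. \<omega> \<in> space M \<Longrightarrow> proj_kernel n (p \<omega>)"
    and trace: "\<And>\<omega>. \<omega> \<in> space M \<Longrightarrow> (\<Sum>i<n. p \<omega> i i) = d"
    and invariant: "\<And>a b c s g. a < n \<Longrightarrow> b < n \<Longrightarrow> a \<noteq> b \<Longrightarrow> c\<^sup>2 + s\<^sup>2 = 1 \<Longrightarrow>
      (\<lambda>\<omega>. (g :: _ \<Rightarrow> real) (p \<omega>)) \<in> borel_measurable M \<Longrightarrow>
      expectation (\<lambda>\<omega>. g (rotate a b c s (p \<omega>))) = expectation (\<lambda>\<omega>. g (p \<omega>))"
begin

text \<open>Entries of a projection are at most 1 in absolute value, so every polynomial in them is
  in this class and integrability follows by closure rules.\<close>

definition bdd :: "('a \<Rightarrow> real) \<Rightarrow> bool" where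
  "bdd f \<longleftrightarrow> f \<in> borel_measurable M \<and> (\<exists>B. \<forall>\<omega>\<in>space M. \<bar>f \<omega>\<bar> \<le> B)"

lemma bdd_integrable: "bdd f \<Longrightarrow> integrable M f"
  unfolding bdd_def by (elim conjE exE) (rule integrable_const_bound, auto)

lemma bdd_measurable: "bdd f \<Longrightarrow> f \<in> borel_measurable M"
  by (simp add: bdd_def)

lemma bdd_const: "bdd (\<lambda>\<omega>. c)"
  by (auto simp: bdd_def)

lemma bdd_p: "i < n \<Longrightarrow> j < n \<Longrightarrow> bdd (\<lambda>\<omega>. p \<omega> i j)"
  using p_meas proj_kernel.p_abs_le_1[OF kernel] by (auto simp: bdd_def intro!: exI[of _ 1])

lemma bdd_add: "bdd f \<Longrightarrow> bdd g \<Longrightarrow> bdd (\<lambda>\<omega>. f \<omega> + g \<omega>)"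
  unfolding bdd_def
proof (elim conjE exE, intro conjI)
  fix B B' assume "\<forall>\<omega>\<in>space M. \<bar>f \<omega>\<bar> \<le> B" "\<forall>\<omega>\<in>space M. \<bar>g \<omega>\<bar> \<le> B'"
  thus "\<exists>B. \<forall>\<omega>\<in>space M. \<bar>f \<omega> + g \<omega>\<bar> \<le> B"
    by (intro exI[of _ "B + B'"]) (fastforce intro: order_trans[OF abs_triangle_ineq])
qed auto

lemma bdd_mult: "bdd f \<Longrightarrow> bdd g \<Longrightarrow> bdd (\<lambda>\<omega>. f \<omega> * g \<omega>)"
  unfolding bdd_def
proof (elim conjE exE, intro conjI)
  fix B B' assume "\<forall>\<omega>\<in>space M. \<bar>f \<omega>\<bar> \<le> B" "\<forall>\<omega>\<in>space M. \<bar>g \<omega>\<bar> \<le> B'"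
  thus "\<exists>B. \<forall>\<omega>\<in>space M. \<bar>f \<omega> * g \<omega>\<bar> \<le> B"
    by (intro exI[of _ "\<bar>B\<bar> * \<bar>B'\<bar>"]) (fastforce simp: abs_mult intro: mult_mono)
qed auto

lemma bdd_minus: "bdd f \<Longrightarrow> bdd (\<lambda>\<omega>. - f \<omega>)"
  by (auto simp: bdd_def)

lemma bdd_diff: "bdd f \<Longrightarrow> bdd g \<Longrightarrow> bdd (\<lambda>\<omega>. f \<omega> - g \<omega>)"
  using bdd_add[OF _ bdd_minus] by simp

lemma bdd_power: "bdd f \<Longrightarrow> bdd (\<lambda>\<omega>. f \<omega> ^ k)"
  by (induction k) (auto intro: bdd_mult bdd_const)

lemma bdd_divide: "bdd f \<Longrightarrow> bdd (\<lambda>\<omega>. f \<omega> / c)"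
  using bdd_mult[OF _ bdd_const, of f "inverse c"] by (simp add: divide_inverse)

lemma bdd_sum: "(\<And>i. i \<in> A \<Longrightarrow> bdd (f i)) \<Longrightarrow> bdd (\<lambda>\<omega>. \<Sum>i\<in>A. f i \<omega>)"
  by (induction A rule: infinite_finite_induct) (auto intro: bdd_add bdd_const)

lemma bdd_indicator: "S \<in> sets M \<Longrightarrow> bdd (indicator S)"
  by (auto simp: bdd_def indicator_def intro!: exI[of _ 1])

lemmas bdd_intros = bdd_add bdd_mult bdd_diff bdd_power bdd_divide bdd_sum bdd_const bdd_p bdd_minus

lemma expectation_le:
  "bdd f \<Longrightarrow> bdd g \<Longrightarrow> (\<And>\<omega>. \<omega> \<in> space M \<Longrightarrow> f \<omega> \<le> g \<omega>) \<Longrightarrow> expectation f \<le> expectation g"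
  by (intro integral_mono bdd_integrable)

lemma expectation_add: "bdd f \<Longrightarrow> bdd g \<Longrightarrow> expectation (\<lambda>\<omega>. f \<omega> + g \<omega>) = expectation f + expectation g"
  by (intro Bochner_Integration.integral_add bdd_integrable)

lemma expectation_diff: "bdd f \<Longrightarrow> bdd g \<Longrightarrow> expectation (\<lambda>\<omega>. f \<omega> - g \<omega>) = expectation f - expectation g"
  by (intro Bochner_Integration.integral_diff bdd_integrable)

lemma expectation_sum: "(\<And>i. i \<in> A \<Longrightarrow> bdd (f i)) \<Longrightarrow> expectation (\<lambda>\<omega>. \<Sum>i\<in>A. f i \<omega>) = (\<Sum>i\<in>A. expectation (f i))"
  by (intro Bochner_Integration.integral_sum bdd_integrable)

text \<open>Comparing the coefficients of \<open>u\<^sup>2\<close> in the invariance of the \<open>2k\<close>-th moment under rotations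
  of slope \<open>u\<close> yields the recursion for the moments of a uniform point of a sphere.\<close>

lemma moment_rec:
  assumes "a < n" "b < n" "c < n" "a \<noteq> b" "a \<noteq> c" "b \<noteq> c"
  shows "expectation (\<lambda>\<omega>. p \<omega> a b ^ (2 * k + 2))
    = (2 * real k + 1) * expectation (\<lambda>\<omega>. p \<omega> a b ^ (2 * k) * (p \<omega> a c)\<^sup>2)"
proof -
  define m where "m = 2 * k + 2"
  define e where "e = expectation (\<lambda>\<omega>. p \<omega> a b ^ m)"
  define A where "A i = (m choose i) * (-1) ^ i * expectation (\<lambda>\<omega>. p \<omega> a b ^ (m - i) * p \<omega> a c ^ i)" for i
  \<comment> \<open>Coefficients of (1 + u^2)^(k + 1) e as a polynomial in \<open>u\<close>; those
    of \<open>A\<close> come from expanding the rotated moment.\<close>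
  define D where "D i = (if even i then ((k + 1) choose (i div 2)) * e else 0)" for i
  have "(\<Sum>i\<le>m. A i * u ^ i) = (\<Sum>i\<le>m. D i * u ^ i)" for u :: real
  proof -
    \<comment> \<open>Normalises the slope: (1/z, u/z) is a point of the unit circle. The factor
      z^m, with m even, is again a polynomial in \<open>u\<close>.\<close>
    define z where "z = sqrt (1 + u\<^sup>2)"
    have z: "z > 0" "z\<^sup>2 = 1 + u\<^sup>2" by (auto simp: z_def add_pos_nonneg)
    have "(1 / z)\<^sup>2 + (u / z)\<^sup>2 = 1" using z by (simp add: power_divide add_divide_distrib[symmetric] z(2)[symmetric])
    moreover have "(\<lambda>\<omega>. p \<omega> a b ^ m) \<in> borel_measurable M" using assms by (intro bdd_measurable bdd_intros)
    ultimately have "e = expectation (\<lambda>\<omega>. rotate b c (1 / z) (u / z) (p \<omega>) a b ^ m)"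
      unfolding e_def using invariant[of b c "1 / z" "u / z" "\<lambda>q. q a b ^ m"] assms by simp
    also have "(\<lambda>\<omega>. rotate b c (1 / z) (u / z) (p \<omega>) a b ^ m) = (\<lambda>\<omega>. (- (u * p \<omega> a c) + p \<omega> a b) ^ m / z ^ m)"
      using assms by (simp add: rotate_simps power_divide[symmetric] diff_divide_distrib)
    finally have "z ^ m * e = expectation (\<lambda>\<omega>. (- (u * p \<omega> a c) + p \<omega> a b) ^ m)" using z by simp
    also have "\<dots> = expectation (\<lambda>\<omega>. \<Sum>i\<le>m. (m choose i) * (-1) ^ i * u ^ i * (p \<omega> a b ^ (m - i) * p \<omega> a c ^ i))"
      unfolding binomial_ring by (simp add: power_minus[of "_ * _"] power_mult_distrib mult_ac)
    also have "\<dots> = (\<Sum>i\<le>m. expectation (\<lambda>\<omega>. (m choose i) * (-1) ^ i * u ^ i * (p \<omega> a b ^ (m - i) * p \<omega> a c ^ i)))"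
      using assms by (intro expectation_sum bdd_intros)
    also have "\<dots> = (\<Sum>i\<le>m. A i * u ^ i)"
      by (simp add: A_def mult_ac)
    finally have l: "(\<Sum>i\<le>m. A i * u ^ i) = z ^ m * e" by simp
    have "m = 2 * (k + 1)" by (simp add: m_def)
    hence "z ^ m = (u\<^sup>2 + 1) ^ (k + 1)" unfolding power_mult by (simp only: z(2) power_mult add.commute)
    also have "\<dots> = (\<Sum>j\<le>k + 1. ((k + 1) choose j) * u ^ (2 * j))"
      unfolding binomial_ring by (simp add: power_mult)
    finally have "z ^ m * e = (\<Sum>j\<le>k + 1. ((k + 1) choose j) * e * u ^ (2 * j))"
      by (simp only: sum_distrib_right) (simp only: mult_ac)
    also have "\<dots> = (\<Sum>i\<in>(\<lambda>j. 2 * j) ` {..k + 1}. D i * u ^ i)"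
      by (subst sum.reindex) (auto simp: inj_on_def D_def)
    also have "\<dots> = (\<Sum>i\<le>m. D i * u ^ i)"
    proof (rule sum.mono_neutral_left)
      show "\<forall>i\<in>{..m} - (\<lambda>j. 2 * j) ` {..k + 1}. D i * u ^ i = 0"
      proof
        fix i assume i: "i \<in> {..m} - (\<lambda>j. 2 * j) ` {..k + 1}"
        have "odd i"
        proof
          assume "even i"
          then obtain j where "i = 2 * j" by blast
          thus False using i by (auto simp: m_def)
        qed
        thus "D i * u ^ i = 0" by (simp add: D_def)
      qed
    qed (auto simp: m_def)
    finally show ?thesis using l by simp
  qed
  hence "A 2 = D 2" using polyfun_eq_coeffs[of A m D] by (simp add: m_def)
  moreover have "(m choose 2) = (k + 1) * (2 * k + 1)" by (simp add: m_def choose_two)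
  ultimately have "(real k + 1) * ((2 * real k + 1) * expectation (\<lambda>\<omega>. p \<omega> a b ^ (2 * k) * (p \<omega> a c)\<^sup>2)) = (real k + 1) * e"
    by (simp add: A_def D_def m_def algebra_simps)
  thus ?thesis by (simp add: e_def m_def)
qed

lemma row_tail:
  assumes "\<omega> \<in> space M" "a < n" "b < n" "a \<noteq> b"
  shows "(\<Sum>c\<in>{..<n} - {a, b}. (p \<omega> a c)\<^sup>2) = p \<omega> a a - (p \<omega> a a)\<^sup>2 - (p \<omega> a b)\<^sup>2"
proof -
  interpret proj_kernel n "p \<omega>" using kernel assms(1) .
  have "(\<Sum>c<n. (p \<omega> a c)\<^sup>2) = (\<Sum>c\<in>{..<n} - {a, b}. (p \<omega> a c)\<^sup>2) + (\<Sum>c\<in>{a, b}. (p \<omega> a c)\<^sup>2)"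
    using assms by (intro sum.subset_diff) auto
  thus ?thesis using row_norm[OF assms(2)] assms by simp
qed

text \<open>Sum the recursion over the n - 2 admissible columns \<open>c\<close>: the squares of a
  row add up to at most 1, so each further pair of powers costs (2k + 1)/(n - 2). The factor 2 in
  the product is n - 2 \<ge> n/2.\<close>

lemma moment_le:
  assumes "a < n" "b < n" "a \<noteq> b" "n \<ge> 4"
  shows "expectation (\<lambda>\<omega>. p \<omega> a b ^ (2 * k)) \<le> (\<Prod>j<k. 2 * (2 * real j + 1)) / real n ^ k"
proof (induction k)
  case 0 thus ?case by (simp add: prob_space)
next
  case (Suc k)
  let ?e = "expectation (\<lambda>\<omega>. p \<omega> a b ^ (2 * k + 2))"
  have card: "card ({..<n} - {a, b}) = n - 2" using assms by (simp add: card_Diff_subset)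
  have "(real n - 2) * ?e = (\<Sum>c\<in>{..<n} - {a, b}. ?e)" using card assms by (simp add: of_nat_diff)
  also have "\<dots> = (\<Sum>c\<in>{..<n} - {a, b}. (2 * real k + 1) * expectation (\<lambda>\<omega>. p \<omega> a b ^ (2 * k) * (p \<omega> a c)\<^sup>2))"
    using assms by (intro sum.cong refl moment_rec) auto
  also have "\<dots> = (2 * real k + 1) * expectation (\<lambda>\<omega>. \<Sum>c\<in>{..<n} - {a, b}. p \<omega> a b ^ (2 * k) * (p \<omega> a c)\<^sup>2)"
    using assms by (subst expectation_sum) (auto simp: sum_distrib_left intro!: bdd_intros)
  also have "\<dots> \<le> (2 * real k + 1) * expectation (\<lambda>\<omega>. p \<omega> a b ^ (2 * k))"
  proof (intro mult_left_mono expectation_le)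
    fix \<omega> assume w: "\<omega> \<in> space M"
    interpret proj_kernel n "p \<omega>" using kernel w .
    have "(\<Sum>c\<in>{..<n} - {a, b}. (p \<omega> a c)\<^sup>2) \<le> 1"
      unfolding row_tail[OF w assms(1-3)] using p_diag(2)[OF assms(1)] zero_le_power2[of "p \<omega> a a"] zero_le_power2[of "p \<omega> a b"] by linarith
    hence "p \<omega> a b ^ (2 * k) * (\<Sum>c\<in>{..<n} - {a, b}. (p \<omega> a c)\<^sup>2) \<le> p \<omega> a b ^ (2 * k) * 1"
      by (intro mult_left_mono) auto
    thus "(\<Sum>c\<in>{..<n} - {a, b}. p \<omega> a b ^ (2 * k) * (p \<omega> a c)\<^sup>2) \<le> p \<omega> a b ^ (2 * k)"
      by (simp add: sum_distrib_left)
  qed (use assms in \<open>auto intro!: bdd_intros\<close>)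
  finally have 1: "(real n - 2) * ?e \<le> (2 * real k + 1) * expectation (\<lambda>\<omega>. p \<omega> a b ^ (2 * k))" .
  have e0: "?e \<ge> 0" by (intro Bochner_Integration.integral_nonneg zero_le_even_power) simp
  have "real n / 2 * ?e \<le> (real n - 2) * ?e" using assms e0 by (intro mult_right_mono) auto
  also note 1
  also have "(2 * real k + 1) * expectation (\<lambda>\<omega>. p \<omega> a b ^ (2 * k))
     \<le> (2 * real k + 1) * ((\<Prod>j<k. 2 * (2 * real j + 1)) / real n ^ k)"
    using Suc.IH by (intro mult_left_mono) auto
  finally have "?e \<le> (2 / real n) * ((2 * real k + 1) * ((\<Prod>j<k. 2 * (2 * real j + 1)) / real n ^ k))"
    using assms by (simp add: field_simps)
  also have "\<dots> = (\<Prod>j<Suc k. 2 * (2 * real j + 1)) / real n ^ Suc k" by (simp add: mult_ac)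
  finally show ?case by simp
qed

text \<open>Rotation by \<pi>/4 in the plane of \<open>a\<close> and \<open>b\<close> sends the
  off-diagonal entry to half the difference of the diagonal ones.\<close>

lemma diag_diff_moment:
  assumes "a < n" "b < n" "a \<noteq> b"
  shows "expectation (\<lambda>\<omega>. ((p \<omega> a a - p \<omega> b b) / 2) ^ k) = expectation (\<lambda>\<omega>. p \<omega> a b ^ k)"
proof -
  let ?c = "1 / sqrt 2 :: real"
  have "?c\<^sup>2 + ?c\<^sup>2 = 1" by (simp add: power_divide)
  moreover have "(\<lambda>\<omega>. p \<omega> a b ^ k) \<in> borel_measurable M" using assms by (intro bdd_measurable bdd_intros)
  ultimately have "expectation (\<lambda>\<omega>. p \<omega> a b ^ k) = expectation (\<lambda>\<omega>. rotate a b ?c ?c (p \<omega>) a b ^ k)"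
    using invariant[of a b ?c ?c "\<lambda>q. q a b ^ k"] assms by simp
  also have "\<dots> = expectation (\<lambda>\<omega>. ((p \<omega> a a - p \<omega> b b) / 2) ^ k)"
  proof (rule Bochner_Integration.integral_cong[OF refl])
    fix \<omega> assume "\<omega> \<in> space M"
    interpret proj_kernel n "p \<omega>" using kernel \<open>\<omega> \<in> space M\<close> .
    have "?c * ?c = 1 / 2" by simp
    hence "rotate a b ?c ?c (p \<omega>) a b = (p \<omega> a a - p \<omega> b b) / 2"
      unfolding rotate_simps(4)[OF assms(3)] using p_sym[OF assms(1,2)]
      by (simp add: algebra_simps)
    thus "rotate a b ?c ?c (p \<omega>) a b ^ k = ((p \<omega> a a - p \<omega> b b) / 2) ^ k" by (simp only:)
  qed
  finally show ?thesis by simp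
qed

text \<open>Diagonal entries are compared with each other, since half their difference is
  distributed like an off-diagonal entry. Closeness to the mean d/n then follows because the trace
  is fixed.\<close>

definition good :: "real \<Rightarrow> 'a set" where
  "good r = {\<omega> \<in> space M. \<forall>i<n. \<forall>j<n. i \<noteq> j \<longrightarrow> \<bar>p \<omega> i j\<bar> \<le> r \<and> \<bar>p \<omega> i i - p \<omega> j j\<bar> \<le> 2 * r}"

lemma good_sets: "good r \<in> sets M"
proof -
  have e: "good r = {\<omega> \<in> space M. \<forall>i\<in>{..<n}. \<forall>j\<in>{..<n}. i \<noteq> j \<longrightarrow> \<bar>p \<omega> i j\<bar> \<le> r \<and> \<bar>p \<omega> i i - p \<omega> j j\<bar> \<le> 2 * r}"
    (is "_ = ?S") by (auto simp: good_def)
  have [measurable]: "i < n \<Longrightarrow> j < n \<Longrightarrow> (\<lambda>\<omega>. p \<omega> i j) \<in> borel_measurable M" for i j by (rule p_meas)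
  have "?S \<in> sets M"
    by (intro sets.sets_Collect_finite_All sets.sets_Collect_imp sets.sets_Collect_const) auto
  with e show ?thesis by simp
qed

lemma Markov_power:
  assumes f: "bdd f" and r: "r > 0"
  shows "prob {\<omega> \<in> space M. \<not> \<bar>f \<omega>\<bar> \<le> r} \<le> expectation (\<lambda>\<omega>. f \<omega> ^ (2 * k)) / r ^ (2 * k)"
proof -
  have [measurable]: "f \<in> borel_measurable M" by (rule bdd_measurable[OF f])
  have "prob {\<omega> \<in> space M. \<not> \<bar>f \<omega>\<bar> \<le> r} \<le> prob {\<omega> \<in> space M. f \<omega> ^ (2 * k) \<ge> r ^ (2 * k)}"
  proof (rule finite_measure_mono)
    show "{\<omega> \<in> space M. \<not> \<bar>f \<omega>\<bar> \<le> r} \<subseteq> {\<omega> \<in> space M. f \<omega> ^ (2 * k) \<ge> r ^ (2 * k)}"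
    proof safe
      fix \<omega> assume "\<not> \<bar>f \<omega>\<bar> \<le> r"
      hence "r ^ (2 * k) \<le> \<bar>f \<omega>\<bar> ^ (2 * k)" using r by (intro power_mono) auto
      thus "r ^ (2 * k) \<le> f \<omega> ^ (2 * k)" by (simp add: power_even_abs)
    qed
  qed measurable
  also have "\<dots> \<le> expectation (\<lambda>\<omega>. f \<omega> ^ (2 * k)) / r ^ (2 * k)"
    using r f by (intro integral_Markov_inequality_measure[where A = "{}"] bdd_integrable bdd_power) auto
  finally show ?thesis .
qed

text \<open>Union bound over at most n^2 ordered pairs with two events each. The order
  \<open>k\<close> stays free; it has to be large enough to beat the number of pairs.\<close>

lemma prob_bad_le:
  assumes n: "n \<ge> 4" and r: "r > 0"
  shows "prob (space M - good r) \<le> 2 * (real n)\<^sup>2 * ((\<Prod>j<k. 2 * (2 * real j + 1)) / (real n * r\<^sup>2) ^ k)"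
proof -
  define B where "B = (\<Prod>j<k. 2 * (2 * real j + 1)) / (real n * r\<^sup>2) ^ k"
  define X where "X i j = {\<omega> \<in> space M. \<not> \<bar>p \<omega> i j\<bar> \<le> r}" for i j
  define Z where "Z i j = {\<omega> \<in> space M. \<not> \<bar>(p \<omega> i i - p \<omega> j j) / 2\<bar> \<le> r}" for i j
  let ?I = "{x \<in> {..<n} \<times> {..<n}. fst x \<noteq> snd x}"
  have [measurable]: "i < n \<Longrightarrow> j < n \<Longrightarrow> (\<lambda>\<omega>. p \<omega> i j) \<in> borel_measurable M" for i j by (rule p_meas)
  have mX: "X i j \<in> sets M" "Z i j \<in> sets M" if "i < n" "j < n" for i j
    using that unfolding X_def Z_def by measurable
  have Bq: "expectation (\<lambda>\<omega>. p \<omega> i j ^ (2 * k)) / r ^ (2 * k) \<le> B" if "i < n" "j < n" "i \<noteq> j" for i j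
  proof -
    have "expectation (\<lambda>\<omega>. p \<omega> i j ^ (2 * k)) / r ^ (2 * k) \<le> ((\<Prod>j<k. 2 * (2 * real j + 1)) / real n ^ k) / r ^ (2 * k)"
      using moment_le[OF that n] r by (intro divide_right_mono) auto
    thus ?thesis by (simp add: B_def power_mult_distrib power_mult)
  qed
  have pX: "prob (X i j) \<le> B" if "i < n" "j < n" "i \<noteq> j" for i j
    unfolding X_def using Markov_power[OF bdd_p r, of i j k] Bq[OF that] that by linarith
  have pZ: "prob (Z i j) \<le> B" if "i < n" "j < n" "i \<noteq> j" for i j
  proof -
    have "bdd (\<lambda>\<omega>. (p \<omega> i i - p \<omega> j j) / 2)" using that by (intro bdd_intros)
    from Markov_power[OF this r, of k] show ?thesis
      unfolding Z_def diag_diff_moment[OF that] using Bq[OF that] by linarith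
  qed
  have B0: "B \<ge> 0" unfolding B_def by (intro divide_nonneg_nonneg prod_nonneg) auto
  have fin: "finite ?I" by simp
  have "space M - good r \<subseteq> (\<Union>x\<in>?I. X (fst x) (snd x) \<union> Z (fst x) (snd x))"
    by (auto simp: good_def X_def Z_def abs_divide not_le)
  hence "prob (space M - good r) \<le> prob (\<Union>x\<in>?I. X (fst x) (snd x) \<union> Z (fst x) (snd x))"
    using mX by (intro finite_measure_mono sets.finite_UN) auto
  also have "\<dots> \<le> (\<Sum>x\<in>?I. prob (X (fst x) (snd x) \<union> Z (fst x) (snd x)))"
    using mX by (intro finite_measure_subadditive_finite) auto
  also have "\<dots> \<le> (\<Sum>x\<in>?I. 2 * B)"
  proof (rule sum_mono)
    fix x assume "x \<in> ?I"
    hence x: "fst x < n" "snd x < n" "fst x \<noteq> snd x" by auto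
    show "prob (X (fst x) (snd x) \<union> Z (fst x) (snd x)) \<le> 2 * B"
      using measure_Un_le[OF mX(1)[OF x(1,2)] mX(2)[OF x(1,2)]] pX[OF x] pZ[OF x] by linarith
  qed
  also have "\<dots> \<le> (\<Sum>x\<in>{..<n} \<times> {..<n}. 2 * B)"
    using B0 by (intro sum_mono2) auto
  also have "\<dots> = 2 * (real n)\<^sup>2 * B" by (simp add: power2_eq_square)
  finally show ?thesis by (simp add: B_def)
qed

lemma good_diag:
  assumes w: "\<omega> \<in> good r" and i: "i < n" and r: "r \<ge> 0"
  shows "\<bar>p \<omega> i i - d / n\<bar> \<le> 2 * r"
proof -
  have n: "real n > 0" using i by simp
  have ws: "\<omega> \<in> space M" using w by (simp add: good_def)
  have "n * p \<omega> i i - d = (\<Sum>j<n. p \<omega> i i - p \<omega> j j)"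
    using trace[OF ws] by (simp add: sum_subtractf)
  also have "\<bar>\<dots>\<bar> \<le> (\<Sum>j<n. 2 * r)"
  proof (intro order_trans[OF sum_abs] sum_mono)
    fix j assume "j \<in> {..<n}"
    thus "\<bar>p \<omega> i i - p \<omega> j j\<bar> \<le> 2 * r" using w i r by (cases "i = j") (auto simp: good_def)
  qed
  finally have "\<bar>n * (p \<omega> i i - d / n)\<bar> \<le> n * (2 * r)" using n by (simp add: algebra_simps)
  thus ?thesis using n by (simp add: abs_mult)
qed

end

section \<open>Overlaps of two rows\<close>

text \<open>The column set is a parameter because the second moment of an overlap needs these
  quantities with one column removed.\<close>

definition sq_norm :: "(nat \<Rightarrow> nat \<Rightarrow> real) \<Rightarrow> nat \<Rightarrow> nat set \<Rightarrow> real" where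
  "sq_norm q a I = (\<Sum>c\<in>I. (q a c)\<^sup>2)"

definition inner_on :: "(nat \<Rightarrow> nat \<Rightarrow> real) \<Rightarrow> nat \<Rightarrow> nat \<Rightarrow> nat set \<Rightarrow> real" where
  "inner_on q a b I = (\<Sum>c\<in>I. q a c * q b c)"

definition overlap_on :: "(nat \<Rightarrow> nat \<Rightarrow> real) \<Rightarrow> nat \<Rightarrow> nat \<Rightarrow> nat set \<Rightarrow> real" where
  "overlap_on q a b I = (\<Sum>c\<in>I. (q a c)\<^sup>2 * (q b c)\<^sup>2)"

lemma overlap_eq: "overlap n q a b = overlap_on q a b ({..<n} - {a, b})"
  by (simp add: overlap_def overlap_on_def)

lemma sum_diff_prod:
  fixes X Y :: "'b \<Rightarrow> real"
  shows "(\<Sum>c\<in>I. \<Sum>f\<in>I. (X c - X f) * (Y c - Y f)) = 2 * (real (card I) * (\<Sum>c\<in>I. X c * Y c) - (\<Sum>c\<in>I. X c) * (\<Sum>c\<in>I. Y c))"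
proof -
  have "(\<Sum>c\<in>I. \<Sum>f\<in>I. (X c - X f) * (Y c - Y f))
      = (\<Sum>c\<in>I. \<Sum>f\<in>I. X c * Y c) + (\<Sum>c\<in>I. \<Sum>f\<in>I. X f * Y f)
        - (\<Sum>c\<in>I. \<Sum>f\<in>I. X c * Y f) - (\<Sum>c\<in>I. \<Sum>f\<in>I. X f * Y c)"
    by (simp add: algebra_simps sum.distrib sum_subtractf)
  also have "(\<Sum>c\<in>I. \<Sum>f\<in>I. X f * Y c) = (\<Sum>c\<in>I. \<Sum>f\<in>I. X c * Y f)" by (rule sum.swap)
  also have "(\<Sum>c\<in>I. \<Sum>f\<in>I. X c * Y f) = (\<Sum>c\<in>I. X c) * (\<Sum>c\<in>I. Y c)" by (simp add: sum_product)
  finally show ?thesis by (simp add: sum_distrib_left[symmetric])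
qed

lemma sum_off_diag:
  fixes z :: "'b \<Rightarrow> real"
  assumes "finite I"
  shows "(\<Sum>c\<in>I. \<Sum>f\<in>I. if c = f then 0 else z c * z f) = (\<Sum>c\<in>I. z c)\<^sup>2 - (\<Sum>c\<in>I. (z c)\<^sup>2)"
proof -
  have "(\<Sum>c\<in>I. z c)\<^sup>2 = (\<Sum>c\<in>I. \<Sum>f\<in>I. (if c = f then 0 else z c * z f) + (if c = f then z c * z c else 0))"
    unfolding power2_eq_square sum_product by (intro sum.cong refl) auto
  thus ?thesis using assms by (simp add: sum.distrib power2_eq_square)
qed

context invariant_kernel
begin

text \<open>A rotation by \<open>\<pi>/4\<close> turns \<open>x\<^sub>c x\<^sub>f\<close> into \<open>(x\<^sub>c\<^sup>2 - x\<^sub>f\<^sup>2) / 2\<close>. Summed over all pairs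
  of columns, this replaces overlaps by row norms and the inner product of the rows, which are explicit
  functions of a \<open>2 \<times> 2\<close> minor because \<open>p\<close> is idempotent.\<close>

lemma exchange:
  assumes "a < n" "b < n" "c < n" "f < n" "c \<noteq> f" "c \<noteq> a" "c \<noteq> b" "f \<noteq> a" "f \<noteq> b"
    and h: "bdd (\<lambda>\<omega>. h (p \<omega>))" "\<And>q u v. h (rotate c f u v q) = h q"
  shows "expectation (\<lambda>\<omega>. h (p \<omega>) * (((p \<omega> a c)\<^sup>2 - (p \<omega> a f)\<^sup>2) * ((p \<omega> b c)\<^sup>2 - (p \<omega> b f)\<^sup>2)))
    = 4 * expectation (\<lambda>\<omega>. h (p \<omega>) * ((p \<omega> a c * p \<omega> b c) * (p \<omega> a f * p \<omega> b f)))"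
proof -
  let ?c = "1 / sqrt 2 :: real"
  let ?g = "\<lambda>q. h q * ((q a c * q b c) * (q a f * q b f))"
  have "?c\<^sup>2 + ?c\<^sup>2 = 1" by (simp add: power_divide)
  moreover have "(\<lambda>\<omega>. ?g (p \<omega>)) \<in> borel_measurable M" using assms by (intro bdd_measurable bdd_intros) auto
  ultimately have "expectation (\<lambda>\<omega>. ?g (p \<omega>)) = expectation (\<lambda>\<omega>. ?g (rotate c f ?c ?c (p \<omega>)))"
    using invariant[of c f ?c ?c ?g] assms by simp
  also have "(\<lambda>\<omega>. ?g (rotate c f ?c ?c (p \<omega>)))
    = (\<lambda>\<omega>. h (p \<omega>) * (((p \<omega> a c)\<^sup>2 - (p \<omega> a f)\<^sup>2) * ((p \<omega> b c)\<^sup>2 - (p \<omega> b f)\<^sup>2)) / 4)"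
  proof
    fix \<omega>
    have r: "rotate c f ?c ?c (p \<omega>) a c * rotate c f ?c ?c (p \<omega>) a f = ((p \<omega> a c)\<^sup>2 - (p \<omega> a f)\<^sup>2) / 2"
      "rotate c f ?c ?c (p \<omega>) b c * rotate c f ?c ?c (p \<omega>) b f = ((p \<omega> b c)\<^sup>2 - (p \<omega> b f)\<^sup>2) / 2"
      using assms by (simp_all add: rotate_simps power2_eq_square field_simps)
    have "?g (rotate c f ?c ?c (p \<omega>)) = h (p \<omega>) * ((rotate c f ?c ?c (p \<omega>) a c * rotate c f ?c ?c (p \<omega>) a f) *
       (rotate c f ?c ?c (p \<omega>) b c * rotate c f ?c ?c (p \<omega>) b f))"
      by (simp only: h(2) mult_ac)
    thus "?g (rotate c f ?c ?c (p \<omega>)) = h (p \<omega>) * (((p \<omega> a c)\<^sup>2 - (p \<omega> a f)\<^sup>2) * ((p \<omega> b c)\<^sup>2 - (p \<omega> b f)\<^sup>2)) / 4"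
      unfolding r by simp
  qed
  finally show ?thesis by simp
qed

lemma expectation_sum2:
  assumes "\<And>i j. i \<in> A \<Longrightarrow> j \<in> B \<Longrightarrow> bdd (f i j)"
  shows "expectation (\<lambda>\<omega>. \<Sum>i\<in>A. \<Sum>j\<in>B. f i j \<omega>) = (\<Sum>i\<in>A. \<Sum>j\<in>B. expectation (f i j))"
proof -
  have "expectation (\<lambda>\<omega>. \<Sum>i\<in>A. \<Sum>j\<in>B. f i j \<omega>) = (\<Sum>i\<in>A. expectation (\<lambda>\<omega>. \<Sum>j\<in>B. f i j \<omega>))"
    using assms by (intro expectation_sum bdd_sum)
  also have "\<dots> = (\<Sum>i\<in>A. \<Sum>j\<in>B. expectation (f i j))"
    using assms by (intro sum.cong refl expectation_sum)
  finally show ?thesis .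
qed

lemma bdd_on:
  assumes "a < n" "b < n" "I \<subseteq> {..<n}"
  shows "bdd (\<lambda>\<omega>. sq_norm (p \<omega>) a I)" "bdd (\<lambda>\<omega>. inner_on (p \<omega>) a b I)" "bdd (\<lambda>\<omega>. overlap_on (p \<omega>) a b I)"
  using assms unfolding sq_norm_def inner_on_def overlap_on_def by (auto intro!: bdd_intros)

text \<open>Write O for the overlap, N for the product of the squared row norms, P for the inner
  product, all on \<open>I\<close>. Summing \<open>exchange\<close> over pairs of distinct columns
  gives |I| E[h O] - E[h N] = 2 E[h P^2] - 2 E[h O]. The weight must not see rotations inside
  \<open>I\<close>: h = 1 gives the mean of O, a single summand of the overlap gives the second
  moment.\<close>

lemma exchange_sum:
  assumes ab: "a < n" "b < n" and I: "I \<subseteq> {..<n} - {a, b}"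
    and h: "bdd (\<lambda>\<omega>. h (p \<omega>))" "\<And>c f q u v. c \<in> I \<Longrightarrow> f \<in> I \<Longrightarrow> c \<noteq> f \<Longrightarrow> h (rotate c f u v q) = h q"
  shows "real (card I) * expectation (\<lambda>\<omega>. h (p \<omega>) * overlap_on (p \<omega>) a b I)
    = expectation (\<lambda>\<omega>. h (p \<omega>) * (sq_norm (p \<omega>) a I * sq_norm (p \<omega>) b I + 2 * (inner_on (p \<omega>) a b I)\<^sup>2
        - 2 * overlap_on (p \<omega>) a b I))"
proof -
  have fI: "finite I" using I finite_subset by blast
  have In: "I \<subseteq> {..<n}" using I by auto
  have sw: "bdd (\<lambda>\<omega>. sq_norm (p \<omega>) a I)" "bdd (\<lambda>\<omega>. sq_norm (p \<omega>) b I)" "bdd (\<lambda>\<omega>. inner_on (p \<omega>) a b I)" "bdd (\<lambda>\<omega>. overlap_on (p \<omega>) a b I)"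
    using bdd_on ab In by auto
  have pt1: "(\<Sum>c\<in>I. \<Sum>f\<in>I. h q * (((q a c)\<^sup>2 - (q a f)\<^sup>2) * ((q b c)\<^sup>2 - (q b f)\<^sup>2)))
     = 2 * (real (card I) * (h q * overlap_on q a b I)) - 2 * (h q * (sq_norm q a I * sq_norm q b I))" for q
    unfolding sum_distrib_left[symmetric] sum_diff_prod
    by (simp add: overlap_on_def sq_norm_def algebra_simps)
  have pt2: "(\<Sum>c\<in>I. \<Sum>f\<in>I. if c = f then 0 else h q * ((q a c * q b c) * (q a f * q b f)))
     = h q * (inner_on q a b I)\<^sup>2 - h q * overlap_on q a b I" for q
  proof -
    have "(\<Sum>c\<in>I. \<Sum>f\<in>I. if c = f then 0 else h q * ((q a c * q b c) * (q a f * q b f)))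
       = h q * (\<Sum>c\<in>I. \<Sum>f\<in>I. if c = f then 0 else (q a c * q b c) * (q a f * q b f))"
      unfolding sum_distrib_left by (intro sum.cong refl) auto
    thus ?thesis using sum_off_diag[OF fI, of "\<lambda>c. q a c * q b c"]
      by (simp add: overlap_on_def inner_on_def power_mult_distrib right_diff_distrib)
  qed
  have "expectation (\<lambda>\<omega>. 2 * (real (card I) * (h (p \<omega>) * overlap_on (p \<omega>) a b I)) - 2 * (h (p \<omega>) * (sq_norm (p \<omega>) a I * sq_norm (p \<omega>) b I)))
     = expectation (\<lambda>\<omega>. \<Sum>c\<in>I. \<Sum>f\<in>I. h (p \<omega>) * (((p \<omega> a c)\<^sup>2 - (p \<omega> a f)\<^sup>2) * ((p \<omega> b c)\<^sup>2 - (p \<omega> b f)\<^sup>2)))"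
    by (simp only: pt1)
  also have "\<dots> = (\<Sum>c\<in>I. \<Sum>f\<in>I. expectation (\<lambda>\<omega>. h (p \<omega>) * (((p \<omega> a c)\<^sup>2 - (p \<omega> a f)\<^sup>2) * ((p \<omega> b c)\<^sup>2 - (p \<omega> b f)\<^sup>2))))"
    using ab In h(1) by (intro expectation_sum2 bdd_intros) auto
  also have "\<dots> = (\<Sum>c\<in>I. \<Sum>f\<in>I. 4 * expectation (\<lambda>\<omega>. if c = f then 0 else h (p \<omega>) * ((p \<omega> a c * p \<omega> b c) * (p \<omega> a f * p \<omega> b f))))"
  proof (intro sum.cong refl)
    fix c f assume cf: "c \<in> I" "f \<in> I"
    show "expectation (\<lambda>\<omega>. h (p \<omega>) * (((p \<omega> a c)\<^sup>2 - (p \<omega> a f)\<^sup>2) * ((p \<omega> b c)\<^sup>2 - (p \<omega> b f)\<^sup>2)))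
      = 4 * expectation (\<lambda>\<omega>. if c = f then 0 else h (p \<omega>) * ((p \<omega> a c * p \<omega> b c) * (p \<omega> a f * p \<omega> b f)))"
    proof (cases "c = f")
      case False
      thus ?thesis using exchange[of a b c f h] ab I h cf by auto
    qed simp
  qed
  also have "\<dots> = 4 * (\<Sum>c\<in>I. \<Sum>f\<in>I. expectation (\<lambda>\<omega>. if c = f then 0 else h (p \<omega>) * ((p \<omega> a c * p \<omega> b c) * (p \<omega> a f * p \<omega> b f))))"
    by (simp add: sum_distrib_left)
  also have "(\<Sum>c\<in>I. \<Sum>f\<in>I. expectation (\<lambda>\<omega>. if c = f then 0 else h (p \<omega>) * ((p \<omega> a c * p \<omega> b c) * (p \<omega> a f * p \<omega> b f))))
    = expectation (\<lambda>\<omega>. \<Sum>c\<in>I. \<Sum>f\<in>I. if c = f then 0 else h (p \<omega>) * ((p \<omega> a c * p \<omega> b c) * (p \<omega> a f * p \<omega> b f)))"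
  proof -
    have bd: "bdd (\<lambda>\<omega>. if c = f then 0 else h (p \<omega>) * ((p \<omega> a c * p \<omega> b c) * (p \<omega> a f * p \<omega> b f)))" if "c \<in> I" "f \<in> I" for c f
      using that ab In h(1) by (cases "c = f") (auto intro!: bdd_intros)
    thus ?thesis by (rule expectation_sum2[symmetric])
  qed
  also have "\<dots> = expectation (\<lambda>\<omega>. h (p \<omega>) * (inner_on (p \<omega>) a b I)\<^sup>2 - h (p \<omega>) * overlap_on (p \<omega>) a b I)"
    by (simp only: pt2)
  finally have e: "expectation (\<lambda>\<omega>. 2 * (real (card I) * (h (p \<omega>) * overlap_on (p \<omega>) a b I)) - 2 * (h (p \<omega>) * (sq_norm (p \<omega>) a I * sq_norm (p \<omega>) b I)))
     = 4 * expectation (\<lambda>\<omega>. h (p \<omega>) * (inner_on (p \<omega>) a b I)\<^sup>2 - h (p \<omega>) * overlap_on (p \<omega>) a b I)" .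
  define X Y Z where "X = (\<lambda>\<omega>. h (p \<omega>) * overlap_on (p \<omega>) a b I)"
    and "Y = (\<lambda>\<omega>. h (p \<omega>) * (sq_norm (p \<omega>) a I * sq_norm (p \<omega>) b I))"
    and "Z = (\<lambda>\<omega>. h (p \<omega>) * (inner_on (p \<omega>) a b I)\<^sup>2)"
  have b: "bdd X" "bdd Y" "bdd Z" unfolding X_def Y_def Z_def by (intro bdd_intros sw h)+
  have "expectation (\<lambda>\<omega>. 2 * (real (card I) * X \<omega>) - 2 * Y \<omega>) = 2 * (real (card I) * expectation X) - 2 * expectation Y"
    using b by (subst expectation_diff) (auto intro!: bdd_intros)
  moreover have "expectation (\<lambda>\<omega>. Z \<omega> - X \<omega>) = expectation Z - expectation X"
    using b by (intro expectation_diff)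
  moreover have "expectation (\<lambda>\<omega>. Y \<omega> + 2 * Z \<omega> - 2 * X \<omega>) = expectation Y + 2 * expectation Z - 2 * expectation X"
    using b by (subst expectation_diff, auto intro!: bdd_intros, subst expectation_add) (auto intro!: bdd_intros)
  moreover have "(\<lambda>\<omega>. h (p \<omega>) * (sq_norm (p \<omega>) a I * sq_norm (p \<omega>) b I + 2 * (inner_on (p \<omega>) a b I)\<^sup>2
        - 2 * overlap_on (p \<omega>) a b I)) = (\<lambda>\<omega>. Y \<omega> + 2 * Z \<omega> - 2 * X \<omega>)"
    by (simp add: X_def Y_def Z_def fun_eq_iff algebra_simps)
  moreover have "expectation (\<lambda>\<omega>. 2 * (real (card I) * X \<omega>) - 2 * Y \<omega>) = 4 * expectation (\<lambda>\<omega>. Z \<omega> - X \<omega>)"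
    using e by (simp only: X_def Y_def Z_def)
  moreover have "expectation (\<lambda>\<omega>. h (p \<omega>) * overlap_on (p \<omega>) a b I) = expectation X"
    by (simp only: X_def)
  ultimately show ?thesis by simp
qed

text \<open>Off the good event \<open>g\<close> is only nonnegative, so adding the trivial bound
  \<open>B\<close> there gives a pointwise majorant of \<open>f\<close>.\<close>

lemma expectation_le_good:
  assumes f: "bdd f" and le: "\<And>\<omega>. \<omega> \<in> good r \<Longrightarrow> f \<omega> \<le> g \<omega>" and g: "bdd g" "\<And>\<omega>. \<omega> \<in> space M \<Longrightarrow> 0 \<le> g \<omega>"
    and B: "\<And>\<omega>. \<omega> \<in> space M \<Longrightarrow> f \<omega> \<le> B" and B0: "B \<ge> 0"
  shows "expectation f \<le> expectation g + B * prob (space M - good r)"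
proof -
  have S: "space M - good r \<in> sets M" using good_sets by auto
  have "expectation f \<le> expectation (\<lambda>\<omega>. g \<omega> + B * indicator (space M - good r) \<omega>)"
  proof (rule expectation_le[OF f])
    show "bdd (\<lambda>\<omega>. g \<omega> + B * indicator (space M - good r) \<omega>)"
      using S g by (intro bdd_intros bdd_indicator)
    fix \<omega> assume w: "\<omega> \<in> space M"
    show "f \<omega> \<le> g \<omega> + B * indicator (space M - good r) \<omega>"
      using le[of \<omega>] B[OF w] g(2)[OF w] w by (cases "\<omega> \<in> good r") (auto simp: add_increasing)
  qed
  also have "\<dots> = expectation g + B * prob (space M - good r)"
    using S g by (subst expectation_add) (auto intro!: bdd_intros bdd_indicator)
  finally show ?thesis .
qed

lemma expectation_ge_good:
  assumes f: "bdd f" and ge: "\<And>\<omega>. \<omega> \<in> good r \<Longrightarrow> m \<le> f \<omega>"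
    and f0: "\<And>\<omega>. \<omega> \<in> space M \<Longrightarrow> 0 \<le> f \<omega>" and m: "m \<le> 1"
  shows "m - prob (space M - good r) \<le> expectation f"
proof -
  have S: "space M - good r \<in> sets M" using good_sets by auto
  have "m - prob (space M - good r) = expectation (\<lambda>\<omega>. m - indicator (space M - good r) \<omega>)"
    using S by (subst expectation_diff) (auto intro!: bdd_intros bdd_indicator simp: prob_space)
  also have "\<dots> \<le> expectation f"
  proof (rule expectation_le[OF _ f])
    show "bdd (\<lambda>\<omega>. m - indicator (space M - good r) \<omega>)" using S by (intro bdd_intros bdd_indicator)
    fix \<omega> assume w: "\<omega> \<in> space M"
    show "m - indicator (space M - good r) \<omega> \<le> f \<omega>"
      using ge[of \<omega>] f0[OF w] w m by (cases "\<omega> \<in> good r") auto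
  qed
  finally show ?thesis .
qed

end

text \<open>\<open>t\<close> and \<open>Q\<close> are the first two moments of an overlap,
  \<open>s\<close> is \<epsilon> - \<epsilon>^2, and \<open>\<delta>\<close> is the probability of
  the exceptional event. The hypothesis on \<open>Q\<close> amounts to Q \<le> m t + O(r / N^2), and
  m - t \<le> O(r / N). \<open>1 / N \<le> r\<close> absorbs the use of N - 3 for N, and
  \<open>r ^ 3 \<le> 1 / N\<close> the diagonal term. The constant is 434 = 72 + 355 + 7.\<close>

lemma overlap_variance_arith:
  fixes N s r \<delta> t Q m :: real
  assumes N: "N \<ge> 6" and s: "0 \<le> s" "s \<le> 1" and r: "0 \<le> r" "r \<le> 1" and d: "0 \<le> \<delta>" "\<delta> \<le> r / N\<^sup>2"
    and rN: "1 / N \<le> r" "r ^ 3 \<le> 1 / N" and t0: "0 \<le> t"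
    and t1: "N * t \<le> s\<^sup>2 + 8 * r + 3 * \<delta>" and t2: "s\<^sup>2 - 6 * r - \<delta> \<le> N * t"
    and Q: "(N - 3) * Q \<le> (s\<^sup>2 + 14 * r) * t + 3 * N * \<delta> + (N - 3) * (r ^ 4 * t + \<delta>)"
    and m: "m = s\<^sup>2 / N"
  shows "Q - 2 * m * t + m\<^sup>2 \<le> 434 * r / N\<^sup>2"
proof -
  have s2: "0 \<le> s\<^sup>2" "s\<^sup>2 \<le> 1" using s by (auto simp: power_le_one)
  have dr: "\<delta> \<le> r"
  proof -
    have "r / N\<^sup>2 \<le> r / 1" using N r by (intro divide_left_mono) (auto simp: power2_eq_square intro: mult_mono[of 1 N 1 N, simplified])
    thus ?thesis using d by simp
  qed
  have t12: "t \<le> 12 / N"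
  proof -
    have "N * t \<le> 12" using t1 s2 r dr by linarith
    thus ?thesis using N by (simp add: field_simps)
  qed
  have r4: "r ^ 4 \<le> r / N"
  proof -
    have "r * r ^ 3 \<le> r * (1 / N)" using rN r by (intro mult_left_mono) auto
    thus ?thesis by (simp add: power4_eq_xxxx power3_eq_cube)
  qed
  have inv: "1 / (N - 3) \<le> 1 / N + 6 / N\<^sup>2"
  proof -
    have "N * N \<le> (N + 6) * (N - 3)" using N by (simp add: algebra_simps)
    hence "1 / (N - 3) \<le> (N + 6) / (N * N)" using N by (simp add: field_simps)
    also have "\<dots> = 1 / N + 6 / N\<^sup>2" using N by (simp add: field_simps power2_eq_square)
    finally show ?thesis .
  qed
  have inv2: "1 / (N - 3) \<le> 2 / N" using N by (simp add: field_simps)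
  have "Q \<le> ((s\<^sup>2 + 14 * r) * t + 3 * N * \<delta> + (N - 3) * (r ^ 4 * t + \<delta>)) / (N - 3)"
    using Q N by (simp add: field_simps)
  also have "\<dots> = s\<^sup>2 * t * (1 / (N - 3)) + 14 * r * t * (1 / (N - 3)) + 3 * N * \<delta> * (1 / (N - 3)) + (r ^ 4 * t + \<delta>)"
    using N by (simp add: add_divide_distrib distrib_right)
  also have "\<dots> \<le> s\<^sup>2 * t * (1 / N + 6 / N\<^sup>2) + 14 * r * t * (2 / N) + 3 * N * \<delta> * (2 / N) + (r / N * t + \<delta>)"
    using inv inv2 r4 s2 r t0 d N by (intro add_mono mult_left_mono mult_right_mono) auto
  also have "\<dots> = m * t + 6 * s\<^sup>2 * t / N\<^sup>2 + 29 * r * t / N + 7 * \<delta>"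
    using N by (simp add: m field_simps)
  also have "\<dots> \<le> m * t + 6 * 1 * (12 / N) / N\<^sup>2 + 29 * r * (12 / N) / N + 7 * (r / N\<^sup>2)"
    using s2 t12 t0 r d N by (intro add_mono divide_right_mono mult_mono order.refl) auto
  also have "\<dots> = m * t + 72 * (1 / N) / N\<^sup>2 + 355 * r / N\<^sup>2"
    using N by (simp add: field_simps power2_eq_square)
  also have "\<dots> \<le> m * t + 72 * r / N\<^sup>2 + 355 * r / N\<^sup>2"
    using rN by (intro add_mono divide_right_mono mult_left_mono order.refl) auto
  finally have Q': "Q \<le> m * t + 427 * (r / N\<^sup>2)" by simp
  have m0: "0 \<le> m" "m \<le> 1 / N" using s2 N by (auto simp: m divide_right_mono)
  have "N * (m - t) \<le> 7 * r" using t2 dr N by (simp add: m algebra_simps)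
  hence "m - t \<le> 7 * r / N" using N by (simp add: field_simps)
  hence "m * (m - t) \<le> m * (7 * r / N)" using m0 by (intro mult_left_mono)
  also have "\<dots> \<le> (1 / N) * (7 * r / N)" using m0 r N by (intro mult_right_mono) auto
  finally have "m * (m - t) \<le> 7 * (r / N\<^sup>2)" by (simp add: power2_eq_square)
  moreover have "m * (m - t) = m\<^sup>2 - m * t" by (simp add: power2_eq_square algebra_simps)
  moreover have "434 * r / N\<^sup>2 = 434 * (r / N\<^sup>2)" by simp
  ultimately show ?thesis using Q' by linarith
qed

lemma power2_diff_le: "(x - y)\<^sup>2 \<le> 2 * x\<^sup>2 + 2 * y\<^sup>2" for x y :: real
  using zero_le_power2[of "x + y"] by (simp add: power2_eq_square algebra_simps)

section \<open>Mean and variance of an overlap\<close>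

context invariant_kernel
begin

definition \<epsilon> :: real where "\<epsilon> = d / n"

lemma \<epsilon>_bounds: assumes "n > 0" shows "0 \<le> \<epsilon>" "\<epsilon> \<le> 1"
proof -
  obtain \<omega> where w: "\<omega> \<in> space M" using not_empty by blast
  interpret proj_kernel n "p \<omega>" using kernel w .
  have "0 \<le> d" "d \<le> n"
    using p_diag sum_bounded_above[of "{..<n}" "\<lambda>i. p \<omega> i i" 1] unfolding trace[OF w, symmetric]
    by (auto intro!: sum_nonneg)
  thus "0 \<le> \<epsilon>" "\<epsilon> \<le> 1" using assms by (auto simp: \<epsilon>_def)
qed

lemma \<epsilon>_variance_bounds: assumes "n > 0" shows "0 \<le> \<epsilon> - \<epsilon>\<^sup>2" "\<epsilon> - \<epsilon>\<^sup>2 \<le> 1"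
proof -
  have "\<epsilon>\<^sup>2 \<le> \<epsilon>" using \<epsilon>_bounds[OF assms] by (simp add: power2_eq_square mult_left_le)
  moreover have "0 \<le> \<epsilon>\<^sup>2" by simp
  ultimately show "0 \<le> \<epsilon> - \<epsilon>\<^sup>2" "\<epsilon> - \<epsilon>\<^sup>2 \<le> 1" using \<epsilon>_bounds[OF assms] by linarith+
qed

lemma sq_norm_bounds:
  assumes w: "\<omega> \<in> space M" and ab: "a < n" "b < n" "a \<noteq> b" and I: "I \<subseteq> {..<n} - {a, b}"
  shows "0 \<le> sq_norm (p \<omega>) a I" "sq_norm (p \<omega>) a I \<le> 1" "sq_norm (p \<omega>) a I \<le> sq_norm (p \<omega>) a ({..<n} - {a, b})"
proof -
  interpret proj_kernel n "p \<omega>" using kernel w .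
  show "0 \<le> sq_norm (p \<omega>) a I" by (simp add: sq_norm_def sum_nonneg)
  show 1: "sq_norm (p \<omega>) a I \<le> sq_norm (p \<omega>) a ({..<n} - {a, b})"
    unfolding sq_norm_def using I by (intro sum_mono2) auto
  have "sq_norm (p \<omega>) a ({..<n} - {a, b}) \<le> 1"
    unfolding sq_norm_def row_tail[OF w ab]
    using p_diag(2)[OF ab(1)] zero_le_power2[of "p \<omega> a a"] zero_le_power2[of "p \<omega> a b"] by linarith
  thus "sq_norm (p \<omega>) a I \<le> 1" using 1 by simp
qed

text \<open>By \<open>row_tail\<close> the norm is x - x^2 - p_ab^2 with x = p_aa. As x - x^2 is
  1-Lipschitz on [0, 1], the diagonal contributes 2 r and the omitted column at most r.\<close>

lemma sq_norm_good:
  assumes w: "\<omega> \<in> good r" and ab: "a < n" "b < n" "a \<noteq> b" and r: "0 \<le> r" "r \<le> 1"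
  shows "\<bar>sq_norm (p \<omega>) a ({..<n} - {a, b}) - (\<epsilon> - \<epsilon>\<^sup>2)\<bar> \<le> 3 * r"
proof -
  have ws: "\<omega> \<in> space M" using w by (simp add: good_def)
  interpret proj_kernel n "p \<omega>" using kernel ws .
  define x where "x = p \<omega> a a"
  have x: "0 \<le> x" "x \<le> 1" "\<bar>x - \<epsilon>\<bar> \<le> 2 * r" using p_diag ab(1) good_diag[OF w ab(1) r(1)] by (auto simp: x_def \<epsilon>_def)
  have e: "0 \<le> \<epsilon>" "\<epsilon> \<le> 1" using \<epsilon>_bounds ab by auto
  have "\<bar>p \<omega> a b\<bar>\<^sup>2 \<le> r\<^sup>2" using w ab by (intro power_mono) (auto simp: good_def)
  also have "r\<^sup>2 \<le> r" using r by (simp add: power2_eq_square mult_left_le)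
  finally have pr: "0 \<le> (p \<omega> a b)\<^sup>2" "(p \<omega> a b)\<^sup>2 \<le> r" by auto
  have "\<bar>(x - x\<^sup>2) - (\<epsilon> - \<epsilon>\<^sup>2)\<bar> = \<bar>x - \<epsilon>\<bar> * \<bar>1 - x - \<epsilon>\<bar>"
    unfolding abs_mult[symmetric] by (simp add: power2_eq_square algebra_simps)
  also have "\<dots> \<le> (2 * r) * 1" using x e by (intro mult_mono) auto
  finally have "\<bar>(x - x\<^sup>2) - (\<epsilon> - \<epsilon>\<^sup>2)\<bar> \<le> 2 * r" by simp
  thus ?thesis unfolding sq_norm_def row_tail[OF ws ab] x_def[symmetric] using pr by linarith
qed

lemma inner_tail:
  assumes "\<omega> \<in> space M" "a < n" "b < n" "a \<noteq> b"
  shows "inner_on (p \<omega>) a b ({..<n} - {a, b}) = p \<omega> a b * (1 - p \<omega> a a - p \<omega> b b)"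
    and "\<bar>inner_on (p \<omega>) a b ({..<n} - {a, b})\<bar> \<le> \<bar>p \<omega> a b\<bar>"
proof -
  interpret proj_kernel n "p \<omega>" using kernel assms(1) .
  have "(\<Sum>c<n. p \<omega> a c * p \<omega> b c) = p \<omega> a b"
    using p_idem[OF assms(2,3)] p_sym assms(3) by simp
  moreover have "(\<Sum>c<n. p \<omega> a c * p \<omega> b c) = (\<Sum>c\<in>{..<n} - {a, b}. p \<omega> a c * p \<omega> b c) + (\<Sum>c\<in>{a, b}. p \<omega> a c * p \<omega> b c)"
    using assms by (intro sum.subset_diff) auto
  ultimately show e: "inner_on (p \<omega>) a b ({..<n} - {a, b}) = p \<omega> a b * (1 - p \<omega> a a - p \<omega> b b)"
    using assms p_sym[OF assms(2,3)] by (simp add: inner_on_def algebra_simps)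
  have "\<bar>p \<omega> a b\<bar> * \<bar>1 - p \<omega> a a - p \<omega> b b\<bar> \<le> \<bar>p \<omega> a b\<bar> * 1"
    using p_diag[OF assms(2)] p_diag[OF assms(3)] by (intro mult_left_mono) auto
  thus "\<bar>inner_on (p \<omega>) a b ({..<n} - {a, b})\<bar> \<le> \<bar>p \<omega> a b\<bar>" unfolding e abs_mult by simp
qed

lemma norm_product_bounds:
  assumes ab: "a < n" "b < n" "a \<noteq> b" and r: "0 \<le> r" "r \<le> 1"
  defines "J \<equiv> {..<n} - {a, b}"
  shows "\<omega> \<in> good r \<Longrightarrow> (\<epsilon> - \<epsilon>\<^sup>2)\<^sup>2 - 6 * r \<le> sq_norm (p \<omega>) a J * sq_norm (p \<omega>) b J"
    and "\<omega> \<in> good r \<Longrightarrow> sq_norm (p \<omega>) a J * sq_norm (p \<omega>) b J \<le> (\<epsilon> - \<epsilon>\<^sup>2)\<^sup>2 + 6 * r"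
    and "\<omega> \<in> good r \<Longrightarrow> (inner_on (p \<omega>) a b J)\<^sup>2 \<le> r"
proof -
  assume w: "\<omega> \<in> good r"
  have ws: "\<omega> \<in> space M" using w by (simp add: good_def)
  interpret proj_kernel n "p \<omega>" using kernel ws .
  define x y s where "x = sq_norm (p \<omega>) a J" and "y = sq_norm (p \<omega>) b J" and "s = \<epsilon> - \<epsilon>\<^sup>2"
  have J: "J = {..<n} - {b, a}" by (auto simp: J_def)
  have x: "0 \<le> x" "x \<le> 1" "\<bar>x - s\<bar> \<le> 3 * r"
    using sq_norm_bounds[OF ws ab, of J] sq_norm_good[OF w ab r] by (auto simp: x_def J_def s_def)
  have y: "0 \<le> y" "y \<le> 1" "\<bar>y - s\<bar> \<le> 3 * r"
    using sq_norm_bounds[OF ws ab(2,1) ab(3)[symmetric], of J] sq_norm_good[OF w ab(2,1) ab(3)[symmetric] r]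
    unfolding J[symmetric] by (auto simp: y_def s_def J)
  have s: "0 \<le> s" "s \<le> 1"
    using \<epsilon>_variance_bounds ab by (auto simp: s_def)
  have "\<bar>x * y - s\<^sup>2\<bar> = \<bar>(x - s) * y + s * (y - s)\<bar>" by (simp add: algebra_simps power2_eq_square)
  also have "\<dots> \<le> \<bar>x - s\<bar> * \<bar>y\<bar> + \<bar>s\<bar> * \<bar>y - s\<bar>" by (metis abs_mult abs_triangle_ineq)
  also have "\<dots> \<le> (3 * r) * 1 + 1 * (3 * r)" using x y s by (intro add_mono mult_mono) auto
  finally have "\<bar>x * y - s\<^sup>2\<bar> \<le> 6 * r" by simp
  thus "(\<epsilon> - \<epsilon>\<^sup>2)\<^sup>2 - 6 * r \<le> sq_norm (p \<omega>) a J * sq_norm (p \<omega>) b J"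
    "sq_norm (p \<omega>) a J * sq_norm (p \<omega>) b J \<le> (\<epsilon> - \<epsilon>\<^sup>2)\<^sup>2 + 6 * r"
    unfolding x_def y_def s_def by linarith+
  have "\<bar>inner_on (p \<omega>) a b J\<bar> \<le> r" using inner_tail(2)[OF ws ab] w ab unfolding J_def good_def by force
  hence "\<bar>inner_on (p \<omega>) a b J\<bar>\<^sup>2 \<le> r\<^sup>2" by (intro power_mono) auto
  also have "r\<^sup>2 \<le> r" using r by (simp add: power2_eq_square mult_left_le)
  finally show "(inner_on (p \<omega>) a b J)\<^sup>2 \<le> r" by simp
qed

lemma inner_sq_le:
  assumes w: "\<omega> \<in> space M" and ab: "a < n" "b < n" "a \<noteq> b" and I: "I \<subseteq> {..<n} - {a, b}"
  shows "sq_norm (p \<omega>) a I * sq_norm (p \<omega>) b I \<le> 1" "(inner_on (p \<omega>) a b I)\<^sup>2 \<le> 1"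
    "0 \<le> sq_norm (p \<omega>) a I * sq_norm (p \<omega>) b I"
proof -
  have I': "I \<subseteq> {..<n} - {b, a}" using I by auto
  note bd = sq_norm_bounds[OF w ab I] sq_norm_bounds[OF w ab(2,1) ab(3)[symmetric] I']
  show 1: "sq_norm (p \<omega>) a I * sq_norm (p \<omega>) b I \<le> 1" using bd by (intro mult_le_one) auto
  show "0 \<le> sq_norm (p \<omega>) a I * sq_norm (p \<omega>) b I" using bd by simp
  show "(inner_on (p \<omega>) a b I)\<^sup>2 \<le> 1"
    using sum_Cauchy_Schwarz[of "p \<omega> a" "p \<omega> b" I] 1 by (simp add: inner_on_def sq_norm_def)
qed

text \<open>With J all columns but \<open>a\<close> and \<open>b\<close>, row norms and inner
  product on J are explicit and nearly constant, so \<open>exchange_sum\<close> determines the mean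
  of T. For the second moment T^2 is expanded as the sum over \<open>e\<close> of \<open>g e\<close>
  times the overlap without column \<open>e\<close>, plus the squares of \<open>g e\<close>; to the
  former \<open>exchange_sum\<close> applies again with weight \<open>g e\<close>.\<close>

lemma overlap_variance:
  assumes n: "n \<ge> 6" and ab: "a < n" "b < n" "a \<noteq> b" and r: "0 < r" "r \<le> 1"
    and rn: "1 / n \<le> r" "r ^ 3 \<le> 1 / n" and \<delta>: "prob (space M - good r) \<le> r / (real n)\<^sup>2"
  shows "expectation (\<lambda>\<omega>. (overlap n (p \<omega>) a b - (\<epsilon> - \<epsilon>\<^sup>2)\<^sup>2 / n)\<^sup>2) \<le> 434 * r / (real n)\<^sup>2"
proof -
  define J where "J = {..<n} - {a, b}"
  define s where "s = \<epsilon> - \<epsilon>\<^sup>2"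
  define \<delta>' where "\<delta>' = prob (space M - good r)"
  define T where "T \<omega> = overlap_on (p \<omega>) a b J" for \<omega>
  define g where "g e \<omega> = (p \<omega> a e)\<^sup>2 * (p \<omega> b e)\<^sup>2" for e \<omega>
  have J: "finite J" "J \<subseteq> {..<n}" by (auto simp: J_def)
  have cJ: "card J = n - 2" using ab by (simp add: J_def card_Diff_subset)
  have r0: "0 \<le> r" using r by simp
  have s: "0 \<le> s" "s \<le> 1"
    using \<epsilon>_variance_bounds ab by (auto simp: s_def)
  have bs: "bdd (\<lambda>\<omega>. sq_norm (p \<omega>) a I)" "bdd (\<lambda>\<omega>. sq_norm (p \<omega>) b I)" "bdd (\<lambda>\<omega>. inner_on (p \<omega>) a b I)" "bdd (\<lambda>\<omega>. overlap_on (p \<omega>) a b I)"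
    if "I \<subseteq> J" for I using bdd_on ab that J by auto
  have bT: "bdd T" unfolding T_def using bs by auto
  have bg: "bdd (g e)" if "e \<in> J" for e unfolding g_def using that ab J by (intro bdd_intros) auto
  have Tg: "T \<omega> = (\<Sum>e\<in>J. g e \<omega>)" for \<omega> by (simp add: T_def overlap_on_def g_def)
  have g0: "0 \<le> g e \<omega>" for e \<omega> by (simp add: g_def)
  have g1: "g e \<omega> \<le> (p \<omega> a e)\<^sup>2" "g e \<omega> \<le> 1" if "e \<in> J" "\<omega> \<in> space M" for e \<omega>
  proof -
    interpret proj_kernel n "p \<omega>" using kernel that(2) .
    have 1: "(p \<omega> a e)\<^sup>2 \<le> 1" "(p \<omega> b e)\<^sup>2 \<le> 1" using p_abs_le_1 ab that(1) J by (auto simp: abs_square_le_1)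
    show "g e \<omega> \<le> (p \<omega> a e)\<^sup>2" unfolding g_def using 1 mult_left_le[OF 1(2), of "(p \<omega> a e)\<^sup>2"] by simp
    thus "g e \<omega> \<le> 1" using 1 by simp
  qed
  have gr: "g e \<omega> \<le> r ^ 4" if "e \<in> J" "\<omega> \<in> good r" for e \<omega>
  proof -
    have "\<bar>p \<omega> a e\<bar> \<le> r" "\<bar>p \<omega> b e\<bar> \<le> r" using that ab by (auto simp: good_def J_def)
    hence "\<bar>p \<omega> a e\<bar>\<^sup>2 * \<bar>p \<omega> b e\<bar>\<^sup>2 \<le> r\<^sup>2 * r\<^sup>2" by (intro mult_mono power_mono) auto
    thus ?thesis by (simp add: g_def power2_eq_square power4_eq_xxxx)
  qed
  \<comment> \<open>J has n - 2 elements, and the term - 2 O of \<open>exchange_sum\<close> moved to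
    the left restores exactly n.\<close>
  have first: "real n * expectation T = expectation (\<lambda>\<omega>. sq_norm (p \<omega>) a J * sq_norm (p \<omega>) b J + 2 * (inner_on (p \<omega>) a b J)\<^sup>2)"
    (is "_ = expectation ?f")
  proof -
    have bf: "bdd ?f" by (intro bdd_intros bs) auto
    have "real (card J) * expectation (\<lambda>\<omega>. 1 * overlap_on (p \<omega>) a b J) = expectation (\<lambda>\<omega>. 1 * (?f \<omega> - 2 * overlap_on (p \<omega>) a b J))"
      using ab J by (intro exchange_sum) (auto simp: J_def intro!: bdd_intros)
    also have "\<dots> = expectation ?f - 2 * expectation T"
      using expectation_diff[OF bf bdd_mult[OF bdd_const[of 2] bT]] by (simp add: T_def[abs_def])
    finally show ?thesis using cJ n by (simp add: T_def[abs_def] algebra_simps of_nat_diff)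
  qed
  have bf: "bdd (\<lambda>\<omega>. sq_norm (p \<omega>) a J * sq_norm (p \<omega>) b J + 2 * (inner_on (p \<omega>) a b J)\<^sup>2)"
    by (intro bdd_intros bs) auto
  have t1: "real n * expectation T \<le> s\<^sup>2 + 8 * r + 3 * \<delta>'"
  proof -
    have "real n * expectation T \<le> expectation (\<lambda>\<omega>. s\<^sup>2 + 8 * r) + 3 * prob (space M - good r)"
      unfolding first
    proof (rule expectation_le_good[OF bf])
      fix \<omega> assume "\<omega> \<in> good r"
      from norm_product_bounds[OF ab r0 r(2) this]
      show "sq_norm (p \<omega>) a J * sq_norm (p \<omega>) b J + 2 * (inner_on (p \<omega>) a b J)\<^sup>2 \<le> s\<^sup>2 + 8 * r"
        by (simp add: J_def s_def)
    next
      fix \<omega> assume "\<omega> \<in> space M"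
      from inner_sq_le[OF this ab, of J]
      show "sq_norm (p \<omega>) a J * sq_norm (p \<omega>) b J + 2 * (inner_on (p \<omega>) a b J)\<^sup>2 \<le> 3"
        by (simp add: J_def)
    qed (use r in \<open>auto intro: bdd_const\<close>)
    thus ?thesis by (simp add: \<delta>'_def prob_space)
  qed
  have t2: "s\<^sup>2 - 6 * r - \<delta>' \<le> real n * expectation T"
    unfolding first \<delta>'_def
  proof (rule expectation_ge_good[OF bf])
    fix \<omega> assume "\<omega> \<in> good r"
    from norm_product_bounds[OF ab r0 r(2) this]
    show "s\<^sup>2 - 6 * r \<le> sq_norm (p \<omega>) a J * sq_norm (p \<omega>) b J + 2 * (inner_on (p \<omega>) a b J)\<^sup>2"
      by (simp add: J_def s_def add_increasing2)
  next
    fix \<omega> assume "\<omega> \<in> space M"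
    from inner_sq_le[OF this ab, of J]
    show "0 \<le> sq_norm (p \<omega>) a J * sq_norm (p \<omega>) b J + 2 * (inner_on (p \<omega>) a b J)\<^sup>2"
      by (simp add: J_def)
  next
    have "s\<^sup>2 \<le> 1" using s by (simp add: power_le_one)
    thus "s\<^sup>2 - 6 * r \<le> 1" using r by simp
  qed
  \<comment> \<open>Column \<open>e\<close> is removed so that rotations among the remaining columns
    fix \<open>g e\<close>. Only an upper bound is wanted, so the term - 2 O is dropped and the
    factor stays n - 3.\<close>
  have step: "(real n - 3) * expectation (\<lambda>\<omega>. g e \<omega> * overlap_on (p \<omega>) a b (J - {e})) \<le> (s\<^sup>2 + 14 * r) * expectation (g e) + 3 * \<delta>'"
    if e: "e \<in> J" for e
  proof -
    define I where "I = J - {e}"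
    have I: "I \<subseteq> J" "I \<subseteq> {..<n} - {a, b}" by (auto simp: I_def J_def)
    have cI: "real (card I) = real n - 3" using e J cJ n by (simp add: I_def card_Diff_subset of_nat_diff)
    let ?f = "\<lambda>\<omega>. sq_norm (p \<omega>) a I * sq_norm (p \<omega>) b I + 2 * (inner_on (p \<omega>) a b I)\<^sup>2"
    have bf: "bdd ?f" by (intro bdd_intros bs I)
    have bo: "bdd (\<lambda>\<omega>. overlap_on (p \<omega>) a b I)" by (intro bs I)
    have "(real n - 3) * expectation (\<lambda>\<omega>. g e \<omega> * overlap_on (p \<omega>) a b I)
       = expectation (\<lambda>\<omega>. g e \<omega> * (?f \<omega> - 2 * overlap_on (p \<omega>) a b I))"
      unfolding cI[symmetric] g_def
    proof (rule exchange_sum[OF ab(1,2) I(2), where h = "\<lambda>q. (q a e)\<^sup>2 * (q b e)\<^sup>2"])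
      show "bdd (\<lambda>\<omega>. (p \<omega> a e)\<^sup>2 * (p \<omega> b e)\<^sup>2)" using bg[OF e] by (simp add: g_def[abs_def])
    next
      fix c f u v q assume "c \<in> I" "f \<in> I" "c \<noteq> f"
      thus "(rotate c f u v q a e)\<^sup>2 * (rotate c f u v q b e)\<^sup>2 = (q a e)\<^sup>2 * (q b e)\<^sup>2"
        by (subst (1 2) rotate_simps(3)) (auto simp: I_def J_def)
    qed
    also have "\<dots> \<le> expectation (\<lambda>\<omega>. g e \<omega> * ?f \<omega>)"
    proof (rule expectation_le)
      fix \<omega>
      have "0 \<le> overlap_on (p \<omega>) a b I" by (simp add: overlap_on_def sum_nonneg)
      thus "g e \<omega> * (?f \<omega> - 2 * overlap_on (p \<omega>) a b I) \<le> g e \<omega> * ?f \<omega>"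
        using g0 by (intro mult_left_mono) auto
    qed (intro bdd_mult bdd_diff bdd_const bg e bf bo)+
    also have "\<dots> \<le> expectation (\<lambda>\<omega>. (s\<^sup>2 + 14 * r) * g e \<omega>) + 3 * prob (space M - good r)"
    proof (rule expectation_le_good)
      show "bdd (\<lambda>\<omega>. g e \<omega> * ?f \<omega>)" "bdd (\<lambda>\<omega>. (s\<^sup>2 + 14 * r) * g e \<omega>)" by (intro bdd_mult bdd_const bg e bf)+
      show "(3::real) \<ge> 0" by simp
    next
      fix \<omega> assume w: "\<omega> \<in> good r"
      hence ws: "\<omega> \<in> space M" by (simp add: good_def)
      note nb = norm_product_bounds[OF ab r0 r(2) w, folded J_def s_def]
      have "sq_norm (p \<omega>) a I * sq_norm (p \<omega>) b I \<le> sq_norm (p \<omega>) a J * sq_norm (p \<omega>) b J"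
        unfolding sq_norm_def using I J by (intro mult_mono sum_mono2 sum_nonneg) auto
      \<comment> \<open>The inner product is explicit only on all of J. Restoring column
        \<open>e\<close> costs a factor 2 and one extra term, whence 14 = 6 + 2 * (2 + 2).\<close>
      moreover have "inner_on (p \<omega>) a b I = inner_on (p \<omega>) a b J - p \<omega> a e * p \<omega> b e"
        unfolding inner_on_def I_def using J e by (simp add: sum_diff1)
      hence "(inner_on (p \<omega>) a b I)\<^sup>2 \<le> 2 * (inner_on (p \<omega>) a b J)\<^sup>2 + 2 * (p \<omega> a e * p \<omega> b e)\<^sup>2"
        by (simp only: power2_diff_le)
      moreover have "(p \<omega> a e * p \<omega> b e)\<^sup>2 \<le> r"
      proof -
        have "(p \<omega> a e * p \<omega> b e)\<^sup>2 = g e \<omega>" by (simp add: g_def power_mult_distrib)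
        also have "\<dots> \<le> r ^ 4" by (rule gr[OF e w])
        also have "\<dots> \<le> r ^ 1" using r by (intro power_decreasing) auto
        finally show ?thesis by simp
      qed
      ultimately have "?f \<omega> \<le> s\<^sup>2 + 14 * r" using nb by linarith
      thus "g e \<omega> * ?f \<omega> \<le> (s\<^sup>2 + 14 * r) * g e \<omega>"
        using g0[of e \<omega>] mult_right_mono[of "?f \<omega>" "s\<^sup>2 + 14 * r" "g e \<omega>"] by (simp add: mult_ac)
    next
      fix \<omega> assume ws: "\<omega> \<in> space M"
      show "0 \<le> (s\<^sup>2 + 14 * r) * g e \<omega>" using g0 r by simp
      have "?f \<omega> \<le> 3" using inner_sq_le[OF ws ab I(2)] by simp
      moreover have "0 \<le> ?f \<omega>" using inner_sq_le(3)[OF ws ab I(2)] by simp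
      ultimately have "g e \<omega> * ?f \<omega> \<le> 1 * 3" using g1(2)[OF e ws] g0 by (intro mult_mono) auto
      thus "g e \<omega> * ?f \<omega> \<le> 3" by simp
    qed
    finally show ?thesis by (simp add: I_def \<delta>'_def)
  qed
  have bgo: "bdd (\<lambda>\<omega>. g e \<omega> * overlap_on (p \<omega>) a b (J - {e}))" if "e \<in> J" for e
    by (intro bdd_mult bg that bs) auto
  have Tsq: "(T \<omega>)\<^sup>2 = (\<Sum>e\<in>J. g e \<omega> * overlap_on (p \<omega>) a b (J - {e})) + (\<Sum>e\<in>J. (g e \<omega>)\<^sup>2)" for \<omega>
  proof -
    have "(T \<omega>)\<^sup>2 = (\<Sum>e\<in>J. g e \<omega> * T \<omega>)" unfolding power2_eq_square by (simp add: sum_distrib_right[symmetric] Tg[symmetric])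
    also have "\<dots> = (\<Sum>e\<in>J. g e \<omega> * overlap_on (p \<omega>) a b (J - {e}) + (g e \<omega>)\<^sup>2)"
    proof (intro sum.cong refl)
      fix e assume "e \<in> J"
      hence "T \<omega> = g e \<omega> + overlap_on (p \<omega>) a b (J - {e})"
        unfolding T_def overlap_on_def g_def using J by (simp add: sum.remove)
      thus "g e \<omega> * T \<omega> = g e \<omega> * overlap_on (p \<omega>) a b (J - {e}) + (g e \<omega>)\<^sup>2"
        by (simp add: power2_eq_square algebra_simps)
    qed
    finally show ?thesis by (simp add: sum.distrib)
  qed
  have bg2: "bdd (\<lambda>\<omega>. \<Sum>e\<in>J. (g e \<omega>)\<^sup>2)" by (intro bdd_intros bg)
  have ETsq: "expectation (\<lambda>\<omega>. (T \<omega>)\<^sup>2) = (\<Sum>e\<in>J. expectation (\<lambda>\<omega>. g e \<omega> * overlap_on (p \<omega>) a b (J - {e})))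
      + expectation (\<lambda>\<omega>. \<Sum>e\<in>J. (g e \<omega>)\<^sup>2)"
    unfolding Tsq using bgo bg2 by (subst expectation_add) (auto intro: bdd_sum simp: expectation_sum)
  have diag: "expectation (\<lambda>\<omega>. \<Sum>e\<in>J. (g e \<omega>)\<^sup>2) \<le> r ^ 4 * expectation T + \<delta>'"
  proof -
    have "expectation (\<lambda>\<omega>. \<Sum>e\<in>J. (g e \<omega>)\<^sup>2) \<le> expectation (\<lambda>\<omega>. r ^ 4 * T \<omega>) + 1 * prob (space M - good r)"
    proof (rule expectation_le_good[OF bg2])
      show "bdd (\<lambda>\<omega>. r ^ 4 * T \<omega>)" by (intro bdd_mult bdd_const bT)
    next
      fix \<omega> assume w: "\<omega> \<in> good r"
      show "(\<Sum>e\<in>J. (g e \<omega>)\<^sup>2) \<le> r ^ 4 * T \<omega>"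
        unfolding Tg sum_distrib_left power2_eq_square using gr w g0 by (intro sum_mono mult_right_mono) auto
    next
      fix \<omega> assume w: "\<omega> \<in> space M"
      show "0 \<le> r ^ 4 * T \<omega>" using r g0 by (auto simp: Tg intro!: mult_nonneg_nonneg sum_nonneg)
      have "(\<Sum>e\<in>J. (g e \<omega>)\<^sup>2) \<le> (\<Sum>e\<in>J. (p \<omega> a e)\<^sup>2)"
      proof (rule sum_mono)
        fix e assume e: "e \<in> J"
        have "g e \<omega> * g e \<omega> \<le> 1 * g e \<omega>" using g1(2)[OF e w] g0 by (intro mult_right_mono) auto
        thus "(g e \<omega>)\<^sup>2 \<le> (p \<omega> a e)\<^sup>2" using g1(1)[OF e w] by (simp add: power2_eq_square)
      qed
      also have "\<dots> \<le> 1" using sq_norm_bounds(2)[OF w ab, of J] by (simp add: sq_norm_def J_def)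
      finally show "(\<Sum>e\<in>J. (g e \<omega>)\<^sup>2) \<le> 1" .
    qed simp
    thus ?thesis by (simp add: \<delta>'_def)
  qed
  have ET: "expectation T = (\<Sum>e\<in>J. expectation (g e))"
    unfolding Tg[abs_def] using bg by (intro expectation_sum)
  have \<delta>0: "0 \<le> \<delta>'" by (simp add: \<delta>'_def)
  have "(real n - 3) * (\<Sum>e\<in>J. expectation (\<lambda>\<omega>. g e \<omega> * overlap_on (p \<omega>) a b (J - {e})))
      \<le> (\<Sum>e\<in>J. (s\<^sup>2 + 14 * r) * expectation (g e) + 3 * \<delta>')"
    unfolding sum_distrib_left by (intro sum_mono step)
  also have "\<dots> = (s\<^sup>2 + 14 * r) * expectation T + real (card J) * (3 * \<delta>')"
    by (simp add: sum.distrib ET sum_distrib_left)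
  also have "\<dots> \<le> (s\<^sup>2 + 14 * r) * expectation T + real n * (3 * \<delta>')"
    using \<delta>0 cJ by (intro add_left_mono mult_right_mono) auto
  finally have Q1: "(real n - 3) * (\<Sum>e\<in>J. expectation (\<lambda>\<omega>. g e \<omega> * overlap_on (p \<omega>) a b (J - {e})))
      \<le> (s\<^sup>2 + 14 * r) * expectation T + 3 * real n * \<delta>'" by simp
  have "(real n - 3) * expectation (\<lambda>\<omega>. \<Sum>e\<in>J. (g e \<omega>)\<^sup>2) \<le> (real n - 3) * (r ^ 4 * expectation T + \<delta>')"
    using diag n by (intro mult_left_mono) auto
  hence Q: "(real n - 3) * expectation (\<lambda>\<omega>. (T \<omega>)\<^sup>2) \<le> (s\<^sup>2 + 14 * r) * expectation T + 3 * real n * \<delta>' + (real n - 3) * (r ^ 4 * expectation T + \<delta>')"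
    unfolding ETsq using Q1 by (simp add: distrib_left)
  have t0: "0 \<le> expectation T" unfolding ET using g0 by (intro sum_nonneg Bochner_Integration.integral_nonneg) auto
  define m where "m = s\<^sup>2 / n"
  have "expectation (\<lambda>\<omega>. (T \<omega> - m)\<^sup>2) = expectation (\<lambda>\<omega>. (T \<omega>)\<^sup>2 - 2 * m * T \<omega> + m\<^sup>2)"
    by (simp add: power2_eq_square algebra_simps)
  also have "\<dots> = expectation (\<lambda>\<omega>. (T \<omega>)\<^sup>2) - 2 * m * expectation T + m\<^sup>2"
  proof -
    have "bdd (\<lambda>\<omega>. (T \<omega>)\<^sup>2 - 2 * m * T \<omega>)" "bdd (\<lambda>\<omega>. (T \<omega>)\<^sup>2)" "bdd (\<lambda>\<omega>. 2 * m * T \<omega>)"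
      by (intro bdd_diff bdd_mult bdd_power bdd_const bT)+
    thus ?thesis by (simp add: expectation_add expectation_diff bdd_const prob_space)
  qed
  also have "\<dots> \<le> 434 * r / (real n)\<^sup>2"
    using overlap_variance_arith[of "real n" s r \<delta>' "expectation T", OF _ s r0 r(2) \<delta>0 \<delta>[folded \<delta>'_def] rn t0 t1 t2 Q m_def] n by simp
  finally show ?thesis by (simp add: overlap_eq T_def J_def m_def s_def)
qed

text \<open>Markov on the total squared deviation: fewer than n^2 ordered pairs, each with mean at
  most 434 r / n^2.\<close>

lemma overlap_concentrated:
  assumes n: "n \<ge> 6" and r: "0 < r" "r \<le> 1" and \<nu>: "\<nu> > 0"
    and rn: "1 / n \<le> r" "r ^ 3 \<le> 1 / n" and \<delta>: "prob (space M - good r) \<le> r / (real n)\<^sup>2"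
  defines "dev \<equiv> \<lambda>\<omega>. \<Sum>i<n. \<Sum>j\<in>{..<n} - {i}. (overlap n (p \<omega>) i j - (\<epsilon> - \<epsilon>\<^sup>2)\<^sup>2 / n)\<^sup>2"
  shows "dev \<in> borel_measurable M" "prob {\<omega> \<in> space M. dev \<omega> \<ge> \<nu>\<^sup>2} \<le> 434 * r / \<nu>\<^sup>2"
proof -
  have bo: "bdd (\<lambda>\<omega>. (overlap n (p \<omega>) i j - (\<epsilon> - \<epsilon>\<^sup>2)\<^sup>2 / n)\<^sup>2)" if "i < n" "j < n" for i j
    using that unfolding overlap_eq by (intro bdd_intros bdd_on) auto
  have bdev: "bdd dev" unfolding dev_def using bo by (intro bdd_sum) auto
  thus "dev \<in> borel_measurable M" by (rule bdd_measurable)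
  have "expectation dev = (\<Sum>i<n. expectation (\<lambda>\<omega>. \<Sum>j\<in>{..<n} - {i}. (overlap n (p \<omega>) i j - (\<epsilon> - \<epsilon>\<^sup>2)\<^sup>2 / n)\<^sup>2))"
    unfolding dev_def using bo by (intro expectation_sum bdd_sum) auto
  also have "\<dots> = (\<Sum>i<n. \<Sum>j\<in>{..<n} - {i}. expectation (\<lambda>\<omega>. (overlap n (p \<omega>) i j - (\<epsilon> - \<epsilon>\<^sup>2)\<^sup>2 / n)\<^sup>2))"
    using bo by (intro sum.cong refl expectation_sum) auto
  also have "\<dots> \<le> (\<Sum>i<n. \<Sum>j\<in>{..<n} - {i}. 434 * r / (real n)\<^sup>2)"
    by (intro sum_mono overlap_variance[OF n _ _ _ r rn \<delta>]) auto
  also have "\<dots> \<le> (\<Sum>i<n. \<Sum>j<n. 434 * r / (real n)\<^sup>2)"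
    using r by (intro sum_mono sum_mono2) auto
  also have "\<dots> = 434 * r" using n by (simp add: power2_eq_square)
  finally have "expectation dev \<le> 434 * r" .
  moreover have "prob {\<omega> \<in> space M. dev \<omega> \<ge> \<nu>\<^sup>2} \<le> expectation dev / \<nu>\<^sup>2"
    using \<nu> bdev by (intro integral_Markov_inequality_measure[where A = "{}"] bdd_integrable)
      (auto simp: dev_def intro!: sum_nonneg)
  ultimately show "prob {\<omega> \<in> space M. dev \<omega> \<ge> \<nu>\<^sup>2} \<le> 434 * r / \<nu>\<^sup>2"
    by (meson divide_right_mono order_trans zero_le_power2)
qed

end

section \<open>The uniform law on the Grassmannian\<close>

text \<open>The value 0 outside the range makes the effect of a rotation an equality of functions on
  all index pairs, as an arbitrary \<open>g\<close> in \<open>invariant\<close> demands.\<close>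

definition proj_entry :: "nat \<Rightarrow> real vec set \<Rightarrow> nat \<Rightarrow> nat \<Rightarrow> real" where
  "proj_entry n V i j = (if i < n \<and> j < n then orth_proj n V $$ (i, j) else 0)"

text \<open>The matrix of a plane rotation, with rows \<open>a\<close> and \<open>b\<close> written
  as sums of deltas so that sums against it collapse.\<close>

definition givens :: "nat \<Rightarrow> nat \<Rightarrow> real \<Rightarrow> real \<Rightarrow> nat \<Rightarrow> nat \<Rightarrow> real" where
  "givens a b c s i k =
    (if i = a then (if k = a then c else 0) + (if k = b then - s else 0)
     else if i = b then (if k = a then s else 0) + (if k = b then c else 0)
     else if k = i then 1 else 0)"

lemma sum_givens:
  assumes "a < n" "b < n" "a \<noteq> b" "i < n"
  shows "(\<Sum>k<n. givens a b c s i k * f k)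
    = (if i = a then c * f a - s * f b else if i = b then s * f a + c * f b else f i)"
  using assms
  by (auto simp: givens_def distrib_right sum.distrib if_distrib[of "\<lambda>x. x * _"] cong: if_cong)

lemma givens_transpose: "a \<noteq> b \<Longrightarrow> givens a b c s k i = givens a b c (- s) i k"
  by (auto simp: givens_def)

lemma givens_orthogonal:
  assumes "a < n" "b < n" "a \<noteq> b" "c\<^sup>2 + s\<^sup>2 = 1" "i < n" "j < n"
  shows "(\<Sum>k<n. givens a b c s k i * givens a b c s k j) = (if i = j then 1 else 0)"
proof -
  have cs: "c * c + s * s = 1" "s * s + c * c = 1" using assms(4) by (simp_all add: power2_eq_square)
  have "(\<Sum>k<n. givens a b c s k i * givens a b c s k j) = (\<Sum>k<n. givens a b c (- s) i k * givens a b c s k j)"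
    using assms by (intro sum.cong refl) (simp add: givens_transpose[of a b c s _ i])
  also have "\<dots> = (if i = j then 1 else 0)"
    unfolding sum_givens[OF assms(1-3,5)] using assms cs by (auto simp: givens_def mult.commute)
  finally show ?thesis .
qed

lemma rotate_eq_givens:
  assumes "a < n" "b < n" "a \<noteq> b" "i < n" "j < n"
  shows "rotate a b c s q i j = (\<Sum>k<n. givens a b c s i k * (\<Sum>l<n. givens a b c s j l * q k l))"
  unfolding sum_givens[OF assms(1-3,4)] sum_givens[OF assms(1-3,5)] rotate_def Let_def by simp

context
  fixes n d :: nat and \<mu> :: "real vec set measure"
  assumes law: "uniform_subspace_law n d \<mu>"
begin

lemma law_space: "space \<mu> = grassmannian n d"
  and law_sets: "sets \<mu> = sets (grassmannian_borel n d)"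
  and law_prob: "prob_space \<mu>"
  using law by (auto simp: uniform_subspace_law_def)

lemma proj_entry_measurable: "(\<lambda>V. proj_entry n V i j) \<in> borel_measurable \<mu>"
proof (cases "i < n \<and> j < n")
  case True
  let ?f = "\<lambda>V. \<lambda>(i,j)\<in>{..<n} \<times> {..<n}. orth_proj n V $$ (i,j)"
  let ?N = "\<Pi>\<^sub>M ij\<in>{..<n} \<times> {..<n}. (borel :: real measure)"
  have "?f \<in> measurable (grassmannian_borel n d) ?N"
    unfolding grassmannian_borel_def by (rule measurable_vimage_algebra1) (auto simp: space_PiM)
  moreover have "(\<lambda>g. g (i, j)) \<in> measurable ?N borel"
    using True by (intro measurable_component_singleton) auto
  ultimately have "(\<lambda>V. ?f V (i, j)) \<in> borel_measurable (grassmannian_borel n d)"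
    by (rule measurable_compose)
  hence "(\<lambda>V. orth_proj n V $$ (i, j)) \<in> borel_measurable (grassmannian_borel n d)"
    using True by simp
  thus ?thesis using True by (simp add: proj_entry_def measurable_cong_sets[OF law_sets refl])
next
  case False
  hence "(\<lambda>V. proj_entry n V i j) = (\<lambda>V. 0)" by (auto simp: proj_entry_def)
  thus ?thesis by simp
qed

lemma proj_entry_rotation:
  assumes V: "V \<in> grassmannian n d" and ab: "a < n" "b < n" "a \<noteq> b" and cs: "c\<^sup>2 + s\<^sup>2 = 1"
  defines "Q \<equiv> mat n n (\<lambda>(i, j). givens a b c s i j)"
  shows "transpose_mat Q * Q = 1\<^sub>m n"
    and "proj_entry n ((\<lambda>v. Q *\<^sub>v v) ` V) = rotate a b c s (proj_entry n V)"
proof -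
  have Q: "Q \<in> carrier_mat n n" by (simp add: Q_def)
  show o: "transpose_mat Q * Q = 1\<^sub>m n"
  proof (rule eq_matI)
    fix i j assume "i < dim_row (1\<^sub>m n :: real mat)" "j < dim_col (1\<^sub>m n :: real mat)"
    hence ij: "i < n" "j < n" by auto
    have "(transpose_mat Q * Q) $$ (i, j) = (\<Sum>k<n. givens a b c s k i * givens a b c s k j)"
      using ij by (auto simp: Q_def scalar_prod_def atLeast0LessThan intro!: sum.cong)
    thus "(transpose_mat Q * Q) $$ (i, j) = (1\<^sub>m n :: real mat) $$ (i, j)"
      using givens_orthogonal[OF ab cs ij] ij by simp
  qed (auto simp: Q_def)
  have P: "orth_proj n V \<in> carrier_mat n n" using grassmannian_orth_proj(1)[OF V] .
  show "proj_entry n ((\<lambda>v. Q *\<^sub>v v) ` V) = rotate a b c s (proj_entry n V)"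
  proof (intro ext)
    fix i j
    show "proj_entry n ((\<lambda>v. Q *\<^sub>v v) ` V) i j = rotate a b c s (proj_entry n V) i j"
    proof (cases "i < n \<and> j < n")
      case True
      hence ij: "i < n" "j < n" by auto
      have QP: "(Q * orth_proj n V) $$ (i, l) = (\<Sum>k<n. givens a b c s i k * orth_proj n V $$ (k, l))" if "l < n" for l
        using that ij P by (auto simp: Q_def scalar_prod_def atLeast0LessThan intro!: sum.cong)
      have "proj_entry n ((\<lambda>v. Q *\<^sub>v v) ` V) i j = (Q * orth_proj n V * transpose_mat Q) $$ (i, j)"
        using True grassmannian_orthogonal_image(2)[OF V Q o] by (simp add: proj_entry_def)
      also have "\<dots> = (\<Sum>l<n. (Q * orth_proj n V) $$ (i, l) * givens a b c s j l)"
        using ij P Q by (auto simp: scalar_prod_def atLeast0LessThan Q_def intro!: sum.cong)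
      also have "\<dots> = (\<Sum>l<n. \<Sum>k<n. givens a b c s i k * orth_proj n V $$ (k, l) * givens a b c s j l)"
        by (simp add: QP sum_distrib_right)
      also have "\<dots> = (\<Sum>k<n. \<Sum>l<n. givens a b c s i k * orth_proj n V $$ (k, l) * givens a b c s j l)"
        by (rule sum.swap)
      also have "\<dots> = (\<Sum>k<n. givens a b c s i k * (\<Sum>l<n. givens a b c s j l * proj_entry n V k l))"
        by (simp add: sum_distrib_left proj_entry_def mult_ac)
      also have "\<dots> = rotate a b c s (proj_entry n V) i j" using rotate_eq_givens[OF ab ij] by simp
      finally show ?thesis .
    next
      case False
      thus ?thesis using ab by (auto simp: proj_entry_def rotate_def Let_def)
    qed
  qed
qed

text \<open>Change of variables along the image map of the rotation \<open>Q\<close>, which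
  preserves \<mu>. Its measurability is tested on projection entries, where it acts by linear
  combinations.\<close>

lemma proj_entry_invariant_kernel: "invariant_kernel \<mu> n (real d) (proj_entry n)"
proof -
  interpret prob_space \<mu> by (rule law_prob)
  show ?thesis
  proof (intro invariant_kernel.intro invariant_kernel_axioms.intro law_prob)
    show "(\<lambda>V. proj_entry n V i j) \<in> borel_measurable \<mu>" for i j by (rule proj_entry_measurable)
  next
    fix V assume "V \<in> space \<mu>"
    hence V: "V \<in> grassmannian n d" by (simp add: law_space)
    show "proj_kernel n (proj_entry n V)"
      using grassmannian_orth_proj(2,3)[OF V] by unfold_locales (auto simp: proj_entry_def)
    show "(\<Sum>i<n. proj_entry n V i i) = real d"
      using grassmannian_orth_proj(4)[OF V] by (simp add: proj_entry_def)
  next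
    fix a b and c s :: real and g :: "(nat \<Rightarrow> nat \<Rightarrow> real) \<Rightarrow> real"
    assume ab: "a < n" "b < n" "a \<noteq> b" and cs: "c\<^sup>2 + s\<^sup>2 = 1"
      and g: "(\<lambda>V. g (proj_entry n V)) \<in> borel_measurable \<mu>"
    define Q where "Q = mat n n (\<lambda>(i, j). givens a b c s i j)"
    define T where "T V = (\<lambda>v. Q *\<^sub>v v) ` V" for V
    have Q: "Q \<in> carrier_mat n n" by (simp add: Q_def)
    have rotQ: "transpose_mat Q * Q = 1\<^sub>m n" "proj_entry n (T V) = rotate a b c s (proj_entry n V)"
      if "V \<in> space \<mu>" for V
      using proj_entry_rotation[OF _ ab cs] that unfolding Q_def T_def law_space by blast+
    obtain V0 where "V0 \<in> space \<mu>" using not_empty by blast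
    hence o: "transpose_mat Q * Q = 1\<^sub>m n" by (rule rotQ)
    have TG: "T V \<in> grassmannian n d" if "V \<in> space \<mu>" for V
      using grassmannian_orthogonal_image(1)[OF _ Q o] that unfolding T_def law_space by blast
    have T: "T \<in> measurable \<mu> (grassmannian_borel n d)"
      unfolding grassmannian_borel_def
    proof (rule measurable_vimage_algebra2)
      show "T \<in> space \<mu> \<rightarrow> grassmannian n d" using TG by auto
      show "(\<lambda>V. \<lambda>(i,j)\<in>{..<n} \<times> {..<n}. orth_proj n (T V) $$ (i,j)) \<in> measurable \<mu> (\<Pi>\<^sub>M ij\<in>{..<n} \<times> {..<n}. borel)"
      proof (rule measurable_restrict)
        fix x assume "x \<in> {..<n} \<times> {..<n}"
        then obtain i j where x: "x = (i, j)" "i < n" "j < n" by auto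
        have "(\<lambda>V. rotate a b c s (proj_entry n V) i j) \<in> borel_measurable \<mu>"
          unfolding rotate_eq_givens[OF ab x(2,3)] using proj_entry_measurable by measurable
        hence "(\<lambda>V. orth_proj n (T V) $$ (i, j)) \<in> borel_measurable \<mu>"
        proof (rule measurable_cong[THEN iffD1, rotated])
          fix V assume "V \<in> space \<mu>"
          from rotQ(2)[OF this] show "rotate a b c s (proj_entry n V) i j = orth_proj n (T V) $$ (i, j)"
            using x by (metis proj_entry_def)
        qed
        thus "(\<lambda>V. case x of (i, j) \<Rightarrow> orth_proj n (T V) $$ (i, j)) \<in> borel_measurable \<mu>" by (simp add: x)
      qed
    qed
    have d: "distr \<mu> (grassmannian_borel n d) T = \<mu>"
      using law Q o unfolding uniform_subspace_law_def T_def[abs_def] by blast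
    have g': "(\<lambda>V. g (proj_entry n V)) \<in> borel_measurable (grassmannian_borel n d)"
      using g by (simp add: measurable_cong_sets[OF law_sets refl])
    have "expectation (\<lambda>V. g (proj_entry n V)) = (\<integral>V. g (proj_entry n V) \<partial>distr \<mu> (grassmannian_borel n d) T)"
      by (simp only: d)
    also have "\<dots> = expectation (\<lambda>V. g (proj_entry n (T V)))" by (rule integral_distr[OF T g'])
    also have "\<dots> = expectation (\<lambda>V. g (rotate a b c s (proj_entry n V)))"
      by (rule Bochner_Integration.integral_cong) (simp_all add: rotQ)
    finally show "expectation (\<lambda>V. g (rotate a b c s (proj_entry n V))) = expectation (\<lambda>V. g (proj_entry n V))" by simp
  qed
qed

end

section \<open>Compactness of the set of solutions and measurability of the event\<close>

lemma sos4_solution_bounded: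
  assumes M: "sos4_solution n M" and S: "S \<in> subsets_upto2 n" and T: "T \<in> subsets_upto2 n"
  shows "\<bar>M S T\<bar> \<le> 1"
proof -
  have e: "{} \<in> subsets_upto2 n" by (simp add: subsets_upto2_def)
  have diag: "M U U = 1" if "U \<in> subsets_upto2 n" for U
  proof -
    have "sym_diff U U = sym_diff {} ({} :: nat set)" by auto
    hence "M U U = M {} {}" using M that e unfolding sos4_solution_def by blast
    thus ?thesis using M by (simp add: sos4_solution_def)
  qed
  show ?thesis
  proof (cases "S = T")
    case True thus ?thesis using diag[OF S] by simp
  next
    case False
    have fin: "finite (subsets_upto2 n)"
      by (rule finite_subset[of _ "Pow {..<n}"]) (auto simp: subsets_upto2_def)
    have psd: "psd_on (subsets_upto2 n) M" using M unfolding sos4_solution_def by (elim conjE)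
    have sym: "M T S = M S T"
      by (rule psd[unfolded psd_on_def, THEN conjunct1, rule_format, OF T S])
    have pos: "0 \<le> 2 + 2 * u * M S T" if u: "u * u = 1" for u :: real
    proof -
      \<comment> \<open>Diagonal entries are 1, so the test vectors supported on \<open>S\<close>
        and \<open>T\<close> with coefficients 1 and \<plusminus>1 bound \<open>M S T\<close> from
        both sides.\<close>
      define x where "x U = (if U = S then 1 else 0) + (if U = T then u else 0)" for U
      have sx: "(\<Sum>U\<in>subsets_upto2 n. x U * g U) = g S + u * g T" for g
        using S T fin by (simp add: x_def distrib_right sum.distrib if_distrib[of "\<lambda>z. z * _"] cong: if_cong)
      have "0 \<le> (\<Sum>U\<in>subsets_upto2 n. \<Sum>W\<in>subsets_upto2 n. x U * M U W * x W)"
        by (rule psd[unfolded psd_on_def, THEN conjunct2, rule_format])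
      also have "\<dots> = (\<Sum>U\<in>subsets_upto2 n. x U * (\<Sum>W\<in>subsets_upto2 n. x W * M U W))"
        by (simp add: sum_distrib_left mult_ac)
      also have "\<dots> = 2 + 2 * u * M S T"
        unfolding sx using diag[OF S] diag[OF T] sym u by (simp add: algebra_simps)
      finally show ?thesis .
    qed
    from pos[of 1] pos[of "-1"] show ?thesis by simp
  qed
qed

lemma continuous_on_entry: "continuous_on A (\<lambda>M :: 'a \<Rightarrow> 'b \<Rightarrow> real. M S T)"
proof -
  have "continuous_on UNIV (\<lambda>M :: 'a \<Rightarrow> 'b \<Rightarrow> real. M S T)"
    by (rule continuous_on_compose2[OF continuous_on_product_coordinates[of T] continuous_on_product_coordinates[of S]]) auto
  thus ?thesis by (rule continuous_on_subset) auto
qed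

lemma compact_PiE_UNIV:
  assumes "\<And>i. compact (S i)"
  shows "compact (PiE UNIV S)"
  using assms compactin_PiE[of "\<lambda>_. euclidean" UNIV S] by (simp add: euclidean_product_topology)

text \<open>Setting the unconstrained entries to 0 confines the solutions to a product of compact
  sets. One side of the disjunction does not depend on \<open>M\<close>, so closedness follows from
  the shape of the formula.\<close>

definition sos4_box :: "nat \<Rightarrow> (nat set \<Rightarrow> nat set \<Rightarrow> real) set" where
  "sos4_box n = {M. sos4_solution n M \<and> (\<forall>S T. S \<in> subsets_upto2 n \<and> T \<in> subsets_upto2 n \<or> M S T = 0)}"

lemma compact_sos4_box: "compact (sos4_box n)"
proof -
  let ?I = "subsets_upto2 n"
  let ?K = "PiE UNIV (\<lambda>S. PiE UNIV (\<lambda>T. if S \<in> ?I \<and> T \<in> ?I then {-1..1} else {0})) :: (nat set \<Rightarrow> nat set \<Rightarrow> real) set"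
  have K: "compact ?K" by (intro compact_PiE_UNIV) auto
  have "closed (sos4_box n)"
    unfolding sos4_box_def sos4_solution_def psd_on_def Ball_def
    by (intro closed_Collect_conj closed_Collect_all closed_Collect_imp open_Collect_const closed_Collect_disj
        closed_Collect_const closed_Collect_eq closed_Collect_le continuous_on_const continuous_on_sum
        continuous_on_mult continuous_on_entry)
  moreover have "sos4_box n \<subseteq> ?K"
  proof
    fix M assume M: "M \<in> sos4_box n"
    show "M \<in> ?K"
      using M sos4_solution_bounded[of n M] by (fastforce simp: sos4_box_def abs_le_iff PiE_UNIV_domain)
  qed
  ultimately show ?thesis using compact_Int_closed[OF K, of "sos4_box n"] by (simp add: Int_absorb1)
qed

text \<open>The value as a function of a vector of entries in a product space: continuous in
  \<open>w\<close> for fixed \<open>M\<close>, and in \<open>M\<close> for fixed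
  \<open>w\<close>.\<close>

definition kernel_value :: "nat \<Rightarrow> (nat \<times> nat \<Rightarrow> real) \<Rightarrow> (nat set \<Rightarrow> nat set \<Rightarrow> real) \<Rightarrow> real" where
  "kernel_value n w M = (1 / real n) * (\<Sum>i<n. \<Sum>j<n. w (i, j) * M {i} {j})"

lemma sos4_box_truncate:
  assumes M: "sos4_solution n M"
  shows "\<exists>M'\<in>sos4_box n. \<forall>w. kernel_value n w M' = kernel_value n w M"
proof -
  define M' where "M' S T = (if S \<in> subsets_upto2 n \<and> T \<in> subsets_upto2 n then M S T else 0)" for S T
  have eq: "M' S T = M S T" if "S \<in> subsets_upto2 n" "T \<in> subsets_upto2 n" for S T
    using that by (simp add: M'_def)
  have e: "{} \<in> subsets_upto2 n" by (simp add: subsets_upto2_def)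
  have psd: "psd_on (subsets_upto2 n) M" using M unfolding sos4_solution_def by (elim conjE)
  have "sos4_solution n M'"
    unfolding sos4_solution_def
  proof (intro conjI ballI impI)
    fix S T S' T' assume I: "S \<in> subsets_upto2 n" "T \<in> subsets_upto2 n" "S' \<in> subsets_upto2 n" "T' \<in> subsets_upto2 n"
      and d: "sym_diff S T = sym_diff S' T'"
    have "M S T = M S' T'"
      by (rule M[unfolded sos4_solution_def, THEN conjunct1, rule_format, OF I d])
    thus "M' S T = M' S' T'" by (simp only: eq I)
  next
    show "M' {} {} = 1" using M[unfolded sos4_solution_def, THEN conjunct2, THEN conjunct1] by (simp only: eq e)
  next
    show "psd_on (subsets_upto2 n) M'"
      unfolding psd_on_def
    proof (intro conjI ballI allI)
      fix S T assume I: "S \<in> subsets_upto2 n" "T \<in> subsets_upto2 n"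
      show "M' S T = M' T S"
        unfolding eq[OF I] eq[OF I(2,1)] by (rule psd[unfolded psd_on_def, THEN conjunct1, rule_format, OF I])
    next
      fix x :: "nat set \<Rightarrow> real"
      have "(\<Sum>S\<in>subsets_upto2 n. \<Sum>T\<in>subsets_upto2 n. x S * M' S T * x T)
          = (\<Sum>S\<in>subsets_upto2 n. \<Sum>T\<in>subsets_upto2 n. x S * M S T * x T)"
        by (intro sum.cong refl) (simp only: eq)
      also have "\<dots> \<ge> 0" by (rule psd[unfolded psd_on_def, THEN conjunct2, rule_format])
      finally show "0 \<le> (\<Sum>S\<in>subsets_upto2 n. \<Sum>T\<in>subsets_upto2 n. x S * M' S T * x T)" .
    qed
  qed
  hence "M' \<in> sos4_box n" by (auto simp: sos4_box_def M'_def)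
  moreover have "kernel_value n w M' = kernel_value n w M" for w
    unfolding kernel_value_def
    by (intro arg_cong[where f = "(*) _"] sum.cong refl) (auto simp: M'_def subsets_upto2_def)
  ultimately show ?thesis by blast
qed

text \<open>By compactness the supremum of the relaxation is attained, so the non-strict superlevel set
  is a countable intersection of unions of open half-spaces.\<close>

lemma borel_sos4_superlevel:
  "{w. \<exists>M. sos4_solution n M \<and> v \<le> kernel_value n w M} \<in> sets borel"
proof -
  define U where "U k = (\<Union>M\<in>{M. sos4_solution n M}. {w. v - 1 / real (Suc k) < kernel_value n w M})" for k
  have "open (U k)" for k
    unfolding U_def kernel_value_def
    by (intro open_UN ballI open_Collect_less continuous_on_const continuous_on_mult continuous_on_sum
        continuous_on_product_coordinates)
  hence "(\<Inter>k. U k) \<in> sets borel" by (intro sets.countable_INT) auto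
  moreover have "{w. \<exists>M. sos4_solution n M \<and> v \<le> kernel_value n w M} = (\<Inter>k. U k)"
  proof (intro equalityI subsetI)
    fix w assume "w \<in> {w. \<exists>M. sos4_solution n M \<and> v \<le> kernel_value n w M}"
    then obtain M where M: "sos4_solution n M" "v \<le> kernel_value n w M" by blast
    have "v - 1 / real (Suc k) < kernel_value n w M" for k
    proof -
      have "0 < 1 / real (Suc k)" by simp
      thus ?thesis using M(2) by linarith
    qed
    thus "w \<in> (\<Inter>k. U k)" using M(1) by (auto simp: U_def)
  next
    fix w assume w: "w \<in> (\<Inter>k. U k)"
    have ex: "\<exists>M\<in>sos4_box n. v - 1 / real (Suc k) < kernel_value n w M" for k
    proof -
      obtain M where M: "sos4_solution n M" "v - 1 / real (Suc k) < kernel_value n w M"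
        using w by (auto simp: U_def)
      obtain M' where "M' \<in> sos4_box n" "kernel_value n w M' = kernel_value n w M"
        using sos4_box_truncate[OF M(1)] by blast
      thus ?thesis using M(2) by (intro bexI[of _ M']) auto
    qed
    have "continuous_on (sos4_box n) (kernel_value n w)"
      unfolding kernel_value_def
      by (intro continuous_on_const continuous_on_mult continuous_on_sum continuous_on_entry)
    moreover have "sos4_box n \<noteq> {}" using ex[of 0] by auto
    ultimately obtain M where M: "M \<in> sos4_box n" "\<And>M'. M' \<in> sos4_box n \<Longrightarrow> kernel_value n w M' \<le> kernel_value n w M"
      using continuous_attains_sup[OF compact_sos4_box] by blast
    have "v \<le> kernel_value n w M"
    proof (rule ccontr)
      assume "\<not> v \<le> kernel_value n w M"
      then obtain k where k: "1 / real (Suc k) < v - kernel_value n w M"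
        using reals_Archimedean[of "v - kernel_value n w M"] by (auto simp: inverse_eq_divide)
      obtain M' where M': "M' \<in> sos4_box n" "v - 1 / real (Suc k) < kernel_value n w M'" using ex by blast
      thus False using M(2)[OF M'(1)] k by linarith
    qed
    thus "w \<in> {w. \<exists>M. sos4_solution n M \<and> v \<le> kernel_value n w M}" using M(1) by (auto simp: sos4_box_def)
  qed
  ultimately show ?thesis by simp
qed

text \<open>The event is the preimage of a Borel set of entry vectors. Its measurability is what
  permits passing to the complement in the final estimate.\<close>

lemma sos4_event_measurable:
  assumes law: "uniform_subspace_law n d \<mu>"
  shows "{V \<in> space \<mu>. \<exists>M. sos4_solution n M \<and> sos4_value n (orth_proj n V) M \<ge> v} \<in> sets \<mu>"
proof -
  define W where "W V = (\<lambda>ij. proj_entry n V (fst ij) (snd ij))" for V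
  have "W \<in> borel_measurable \<mu>"
    unfolding W_def by (rule measurable_coordinatewise_then_product) (rule proj_entry_measurable[OF law])
  hence "W -` {w. \<exists>M. sos4_solution n M \<and> v \<le> kernel_value n w M} \<inter> space \<mu> \<in> sets \<mu>"
    using borel_sos4_superlevel by (rule measurable_sets)
  moreover have "kernel_value n (W V) M = sos4_value n (orth_proj n V) M" for V M
    by (simp add: kernel_value_def sos4_value_def W_def proj_entry_def)
  ultimately show ?thesis by (simp add: vimage_def Int_def conj_commute)
qed

section \<open>Choice of the parameters\<close>

text \<open>The diagonal of p deviates by 2 r from 1/\<kappa>, hence \<rho> = 2 \<kappa> r and the
  upper bound q = (1 + \<rho>)/\<kappa>. Then \<kappa>^2 q^2 = (1 + \<rho>)^2 \<le> 1 + 3 \<rho>,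
  and the square root of \<open>squared_kernel_form_le\<close> supplies the rest of
  \<open>\<eta>\<close>.\<close>

lemma (in invariant_kernel) good_certificate:
  assumes n: "n \<ge> 1" and w: "\<omega> \<in> good r" and r: "0 \<le> r" and k: "\<kappa> \<ge> 1" "\<kappa> * d = n"
    and \<rho>: "\<rho> = 2 * \<kappa> * r" "\<rho> \<le> 1" and \<nu>: "\<nu> \<ge> 0"
    and dev: "(\<Sum>i<n. \<Sum>j\<in>{..<n} - {i}. (overlap n (p \<omega>) i j - (\<epsilon> - \<epsilon>\<^sup>2)\<^sup>2 / n)\<^sup>2) \<le> \<nu>\<^sup>2"
    and \<eta>: "\<eta> = 3 * \<rho> + \<kappa>\<^sup>2 * sqrt (r\<^sup>2 * ((1 + \<rho>) / \<kappa>) + \<nu>)"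
    and L: "L = 2 * \<kappa>\<^sup>2 * \<eta> + \<kappa> * (24 * (2 * \<kappa>\<^sup>2 / n) + 54 * \<rho>)" "L \<le> 1"
  shows "\<exists>M. sos4_solution n M \<and> (1 / n) * (\<Sum>i<n. \<Sum>j<n. p \<omega> i j * M {i} {j}) \<ge> 1 - 2 * L"
proof -
  have ws: "\<omega> \<in> space M" using w by (simp add: good_def)
  interpret proj_kernel n "p \<omega>" using kernel ws .
  have \<rho>0: "0 \<le> \<rho>" using \<rho> k r by simp
  have kr: "\<kappa> * r \<le> \<rho>" using k r by (simp add: \<rho>)
  have kdn: "\<kappa> * (d / n) = 1" using k n by simp
  have diag': "\<bar>\<kappa> * p \<omega> i i - 1\<bar> \<le> \<rho>" if "i < n" for i
  proof -
    have "\<bar>\<kappa> * p \<omega> i i - 1\<bar> = \<kappa> * \<bar>p \<omega> i i - d / n\<bar>"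
      unfolding kdn[symmetric] right_diff_distrib[symmetric] abs_mult using k by simp
    also have "\<dots> \<le> \<kappa> * (2 * r)" using good_diag[OF w that r] k by (intro mult_left_mono) auto
    finally show ?thesis by (simp add: \<rho>)
  qed
  interpret scaled_kernel n "p \<omega>" \<kappa> "2 * \<kappa>\<^sup>2 / n" \<rho>
  proof
    show "0 < n" "1 \<le> \<kappa>" "0 \<le> \<rho>" "\<rho> \<le> 1" using n k \<rho> \<rho>0 by auto
    fix i assume i: "i < n"
    thus "\<bar>\<kappa> * p \<omega> i i - 1\<bar> \<le> \<rho>" by (rule diag')
    fix j assume j: "j < n" "i \<noteq> j"
    have "\<kappa> * \<bar>p \<omega> i j\<bar> \<le> \<kappa> * r" using w i j k by (intro mult_left_mono) (auto simp: good_def)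
    also note kr
    finally show "\<bar>\<kappa> * p \<omega> i j\<bar> \<le> \<rho>" using k by (simp add: abs_mult)
  qed simp
  define q where "q = (1 + \<rho>) / \<kappa>"
  define \<theta> where "\<theta> = q\<^sup>2 + sqrt (r\<^sup>2 * q + \<nu>)"
  have q0: "0 \<le> q" using \<rho>0 k by (simp add: q_def)
  have \<theta>0: "0 \<le> \<theta>" using q0 \<nu> by (simp add: \<theta>_def)
  have "\<kappa>\<^sup>2 * \<theta> = (\<kappa> * q)\<^sup>2 + \<kappa>\<^sup>2 * sqrt (r\<^sup>2 * q + \<nu>)" by (simp add: \<theta>_def distrib_left power_mult_distrib)
  also have "\<kappa> * q = 1 + \<rho>" using k by (simp add: q_def)
  also have "(1 + \<rho>)\<^sup>2 \<le> 1 + 3 * \<rho>" using mult_left_le[OF \<rho>(2) \<rho>0] by (simp add: power2_eq_square algebra_simps)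
  finally have \<theta>1: "\<kappa>\<^sup>2 * \<theta> \<le> 1 + \<eta>" by (simp add: \<eta> q_def)
  have \<eta>0: "0 \<le> \<eta>" unfolding \<eta> using \<rho>0 k \<nu> by simp
  have T: "(\<Sum>i<n. \<Sum>j<n. x i * x j * (p \<omega> i j)\<^sup>2) \<le> \<theta> * (\<Sum>i<n. (x i)\<^sup>2)" if "(\<Sum>i<n. x i) = 0" for x
    unfolding \<theta>_def
  proof (rule squared_kernel_form_le[OF _ _ _ \<nu> r q0 dev that])
    show "\<bar>p \<omega> i j\<bar> \<le> r" if "i < n" "j < n" "i \<noteq> j" for i j using w that by (auto simp: good_def)
    show "p \<omega> i i \<le> q" if "i < n" for i
      using diag'[OF that] k by (simp add: q_def field_simps)
  qed simp
  show ?thesis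
  proof (rule sos4_solution_exists[OF \<eta>0 \<theta>0 \<theta>1 _ L])
    show "\<kappa> * (\<Sum>i<n. p \<omega> i i) = real n" using trace[OF ws] k by simp
  qed (rule T)
qed

text \<open>In the application u = n^(-0.01), and d \<ge> n^0.99 says exactly \<kappa> u \<le> 1, so
  a factor \<open>\<kappa>\<close> costs one power of \<open>u\<close>. The critical term of
  \<open>L\<close> is \<kappa>^4 sqrt \<nu>, of order \<kappa>^4 u^5 \<le> u. The total is 172 = 16
  + 48 + 108.\<close>

lemma parameter_bounds:
  fixes u \<kappa> :: real
  assumes u: "0 < u" "u \<le> 1 / 172" and k: "1 \<le> \<kappa>" "\<kappa> * u \<le> 1"
    and r: "r = u ^ 40" and \<nu>: "\<nu> = u ^ 10" and N: "1 / N = u ^ 100"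
    and \<rho>: "\<rho> = 2 * \<kappa> * r"
    and \<eta>: "\<eta> = 3 * \<rho> + \<kappa>\<^sup>2 * sqrt (r\<^sup>2 * ((1 + \<rho>) / \<kappa>) + \<nu>)"
    and L: "L = 2 * \<kappa>\<^sup>2 * \<eta> + \<kappa> * (24 * (2 * \<kappa>\<^sup>2 / N) + 54 * \<rho>)"
  shows "\<rho> \<le> 1" "L \<le> 172 * u"
proof -
  have ud: "u ^ i \<le> u ^ j" if "j \<le> i" for i j using u that by (intro power_decreasing) auto
  have ku: "\<kappa> ^ i * u ^ (i + j) \<le> u ^ j" for i j
  proof -
    have "\<kappa> ^ i * u ^ (i + j) = (\<kappa> * u) ^ i * u ^ j" by (simp add: power_add power_mult_distrib)
    also have "\<dots> \<le> 1 * u ^ j" using k u by (intro mult_right_mono power_le_one) auto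
    finally show ?thesis by simp
  qed
  have \<rho>1: "\<rho> \<le> 2 * u ^ 39" using ku[of 1 39] by (simp add: \<rho> r)
  also have "\<dots> \<le> 2 * u ^ 1" using ud[of 1 39] by simp
  finally show \<rho>2: "\<rho> \<le> 1" using u by simp
  have \<rho>0: "0 \<le> \<rho>" using k u by (simp add: \<rho> r)
  have "(1 + \<rho>) / \<kappa> \<le> (1 + \<rho>) / 1" using k \<rho>0 by (intro divide_left_mono) auto
  hence "r\<^sup>2 * ((1 + \<rho>) / \<kappa>) \<le> r\<^sup>2 * 2" using \<rho>2 by (intro mult_left_mono) auto
  moreover have "r\<^sup>2 = u ^ 80" by (simp add: r flip: power_mult)
  moreover have "(2 * u ^ 5)\<^sup>2 = 4 * u ^ 10" by (simp add: power_mult_distrib flip: power_mult)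
  moreover have "0 \<le> u ^ 10" using u by simp
  ultimately have "r\<^sup>2 * ((1 + \<rho>) / \<kappa>) + \<nu> \<le> (2 * u ^ 5)\<^sup>2"
    using ud[of 10 80] unfolding \<nu> by linarith
  hence "sqrt (r\<^sup>2 * ((1 + \<rho>) / \<kappa>) + \<nu>) \<le> 2 * u ^ 5" using u by (intro real_le_lsqrt) auto
  hence "\<kappa>\<^sup>2 * sqrt (r\<^sup>2 * ((1 + \<rho>) / \<kappa>) + \<nu>) \<le> \<kappa>\<^sup>2 * (2 * u ^ 5)" by (intro mult_left_mono) auto
  also have "\<dots> \<le> 2 * u ^ 3" using ku[of 2 3] by simp
  finally have "\<eta> \<le> 8 * u ^ 3" using \<rho>1 ud[of 3 39] by (simp add: \<eta>)
  hence "2 * \<kappa>\<^sup>2 * \<eta> \<le> 2 * \<kappa>\<^sup>2 * (8 * u ^ 3)" by (intro mult_left_mono) auto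
  also have "\<dots> \<le> 16 * u" using ku[of 2 1] by simp
  finally have a: "2 * \<kappa>\<^sup>2 * \<eta> \<le> 16 * u" .
  have "\<kappa> * (24 * (2 * \<kappa>\<^sup>2 / N)) = 48 * (\<kappa> ^ 3 * (1 / N))" by (simp add: power2_eq_square power3_eq_cube)
  also have "\<dots> \<le> 48 * u" unfolding N using ku[of 3 97] ud[of 1 97] by simp
  finally have b: "\<kappa> * (24 * (2 * \<kappa>\<^sup>2 / N)) \<le> 48 * u" .
  have "\<kappa> * (54 * \<rho>) = 108 * (\<kappa> ^ 2 * u ^ 40)" by (simp add: \<rho> r power2_eq_square)
  also have "\<dots> \<le> 108 * u" using ku[of 2 38] ud[of 1 38] by simp
  finally have c: "\<kappa> * (54 * \<rho>) \<le> 108 * u" .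
  show "L \<le> 172 * u" unfolding L distrib_left using a b c by linarith
qed

text \<open>If C u \<ge> 1 the claim is trivial. Otherwise 435 u < 1 and 2 K u \<le> 1, so
  \<open>n\<close> is large enough and the moment constant is absorbed; this is why \<open>C\<close>
  has both parts. Here 344 = 2 * 172 and 435 = 434 + 1, the two exceptional events.\<close>

lemma sos4_event_prob_ge:
  assumes law: "uniform_subspace_law n d \<mu>" and n: "n \<ge> 1" and nd: "real n powr 0.99 \<le> real d" and dn: "d \<le> n"
    and K: "K = (\<Prod>j<23. 2 * (2 * real j + 1))" and C: "C = 435 + 2 * K"
    and u: "u = 1 / real n powr 0.01"
  shows "measure \<mu> {V \<in> space \<mu>. \<exists>M. sos4_solution n M \<and> sos4_value n (orth_proj n V) M \<ge> 1 - 344 * u} \<ge> 1 - C * u"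
    (is "measure \<mu> ?E \<ge> _")
proof (cases "C * u \<ge> 1")
  case True
  thus ?thesis using measure_nonneg[of \<mu> ?E] by linarith
next
  case False
  interpret invariant_kernel \<mu> n "real d" "proj_entry n" by (rule proj_entry_invariant_kernel[OF law])
  have K0: "K \<ge> 0" unfolding K by (intro prod_nonneg) auto
  have u0: "u > 0" using n by (simp add: u)
  have Ku: "2 * K * u \<le> 1" "435 * u < 1" using False mult_nonneg_nonneg[OF K0 less_imp_le[OF u0]] u0 unfolding C distrib_right by linarith+
  have u1: "u \<le> 1 / 172" using Ku(2) by simp
  have un: "1 / real n = u ^ 100"
  proof -
    have "(real n powr 0.01) ^ 100 = real n" using n by (simp add: powr_realpow[symmetric] powr_powr)
    thus ?thesis by (simp add: u power_one_over)
  qed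
  have N: "real n * u ^ 100 = 1" using un n by (simp add: field_simps)
  have ud: "u ^ i \<le> u ^ j" if "j \<le> i" for i j using u0 u1 that by (intro power_decreasing) auto
  have n6: "n \<ge> 6"
  proof -
    have "1 / real n \<le> 1 / 172" unfolding un using ud[of 1 100] u1 by simp
    thus ?thesis using n by (simp add: field_simps)
  qed
  have "0 < real n powr 0.99" using n by simp
  hence d0: "real d > 0" using nd by linarith
  define \<kappa> where "\<kappa> = real n / real d"
  have k: "\<kappa> \<ge> 1" "\<kappa> * real d = real n" using dn d0 by (auto simp: \<kappa>_def)
  have ku: "\<kappa> * u \<le> 1"
  proof -
    have "real n powr 0.99 * real n powr 0.01 = real n" using n by (simp flip: powr_add)
    hence "real n \<le> real d * real n powr 0.01" using nd by (metis mult_right_mono powr_ge_zero)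
    thus ?thesis using d0 n by (simp add: \<kappa>_def u field_simps)
  qed
  \<comment> \<open>As powers of n: r = n^(-0.4) lies above the natural size n^(-1/2) of an entry,
    so the exceptional event is rare, and below n^(-1/3), so r^3 \<le> 1/n. With \<nu> = n^(-0.1)
    the Markov ratio r / \<nu>^2 = u^20 still vanishes.\<close>
  define r where "r = u ^ 40"
  define \<nu> where "\<nu> = u ^ 10"
  have r: "0 < r" "r \<le> 1" using u0 u1 by (auto simp: r_def power_le_one)
  have \<nu>: "\<nu> > 0" using u0 by (simp add: \<nu>_def)
  have bad: "prob (space \<mu> - good r) \<le> u ^ 259"
  proof -
    have nr: "real n * r\<^sup>2 = 1 / u ^ 20"
    proof -
      have "real n * r\<^sup>2 * u ^ 20 = real n * u ^ 100" by (simp add: r_def mult.assoc flip: power_mult power_add)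
      thus ?thesis using N u0 by (simp add: field_simps)
    qed
    have nn: "(real n)\<^sup>2 = 1 / u ^ 200"
    proof -
      have "(real n)\<^sup>2 * u ^ 200 = (real n * u ^ 100)\<^sup>2" by (simp add: power_mult_distrib flip: power_mult)
      thus ?thesis using N u0 by (simp add: field_simps)
    qed
    \<comment> \<open>The bound must reach r / n^2 = u^240. Order k yields 2 K u^(20 k - 200), with
      K the constant for that k, and 23 is the least k with exponent above 240. One spare factor
      \<open>u\<close> absorbs 2 K.\<close>
    have "prob (space \<mu> - good r) \<le> 2 * (real n)\<^sup>2 * (K / (real n * r\<^sup>2) ^ 23)"
      unfolding K using n6 r by (intro prob_bad_le) auto
    also have "\<dots> = 2 * K * (u ^ 460 / u ^ 200)"
      unfolding nr nn using u0 by (simp add: power_one_over flip: power_mult)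
    also have "u ^ 460 / u ^ 200 = u ^ 260" using u0 by (simp add: power_diff[symmetric])
    also have "2 * K * u ^ 260 = (2 * K * u) * u ^ 259" by (simp flip: power_Suc)
    also have "\<dots> \<le> 1 * u ^ 259" using Ku u0 by (intro mult_right_mono) auto
    finally show ?thesis by simp
  qed
  define dev where "dev \<omega> = (\<Sum>i<n. \<Sum>j\<in>{..<n} - {i}. (overlap n (proj_entry n \<omega>) i j - (\<epsilon> - \<epsilon>\<^sup>2)\<^sup>2 / n)\<^sup>2)" for \<omega>
  have rn: "1 / real n \<le> r" "r ^ 3 \<le> 1 / real n" unfolding un r_def using ud[of 40 100] ud[of 100 120] by (simp_all flip: power_mult)
  have \<delta>: "prob (space \<mu> - good r) \<le> r / (real n)\<^sup>2"
  proof -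
    have "r / (real n)\<^sup>2 = u ^ 40 * (1 / real n)\<^sup>2" by (simp add: r_def power_one_over divide_inverse power_inverse)
    also have "\<dots> = u ^ 240" unfolding un by (simp flip: power_mult power_add)
    finally show ?thesis using bad ud[of 240 259] by simp
  qed
  note oc = overlap_concentrated[OF n6 r \<nu> rn \<delta>, folded dev_def]
  have r\<nu>: "434 * r / \<nu>\<^sup>2 = 434 * u ^ 20"
  proof -
    have "r = \<nu>\<^sup>2 * u ^ 20" by (simp add: r_def \<nu>_def flip: power_mult power_add)
    thus ?thesis using \<nu> by simp
  qed
  define \<rho> where "\<rho> = 2 * \<kappa> * r"
  define \<eta> where "\<eta> = 3 * \<rho> + \<kappa>\<^sup>2 * sqrt (r\<^sup>2 * ((1 + \<rho>) / \<kappa>) + \<nu>)"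
  define L where "L = 2 * \<kappa>\<^sup>2 * \<eta> + \<kappa> * (24 * (2 * \<kappa>\<^sup>2 / n) + 54 * \<rho>)"
  note pb = parameter_bounds[OF u0 u1 k(1) ku r_def \<nu>_def un \<rho>_def \<eta>_def L_def]
  have L1: "L \<le> 1" using pb(2) Ku(2) u0 by simp
  let ?B = "{\<omega> \<in> space \<mu>. dev \<omega> \<ge> \<nu>\<^sup>2}"
  have B: "?B \<in> sets \<mu>" using oc(1) unfolding dev_def[abs_def] by measurable
  have S: "space \<mu> - good r \<in> sets \<mu>" using good_sets by auto
  have E: "?E \<in> sets \<mu>" by (rule sos4_event_measurable[OF law])
  have "space \<mu> - ?E \<subseteq> (space \<mu> - good r) \<union> ?B"
  proof
    fix V assume V: "V \<in> space \<mu> - ?E"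
    show "V \<in> (space \<mu> - good r) \<union> ?B"
    proof (rule ccontr)
      assume "V \<notin> (space \<mu> - good r) \<union> ?B"
      hence g: "V \<in> good r" "dev V \<le> \<nu>\<^sup>2" using V by auto
      have "\<exists>M. sos4_solution n M \<and> (1 / n) * (\<Sum>i<n. \<Sum>j<n. proj_entry n V i j * M {i} {j}) \<ge> 1 - 2 * L"
        using good_certificate[OF n g(1) _ k \<rho>_def pb(1) _ _ \<eta>_def L_def L1] g(2) r \<nu> unfolding dev_def by simp
      then obtain M where "sos4_solution n M" "sos4_value n (orth_proj n V) M \<ge> 1 - 2 * L"
        by (auto simp: sos4_value_def proj_entry_def)
      moreover have "1 - 344 * u \<le> 1 - 2 * L" using pb(2) by simp
      ultimately have "V \<in> ?E" using V by force
      thus False using V by simp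
    qed
  qed
  hence "prob (space \<mu> - ?E) \<le> prob ((space \<mu> - good r) \<union> ?B)"
    using S B by (intro finite_measure_mono) auto
  also have "\<dots> \<le> prob (space \<mu> - good r) + prob ?B" by (rule measure_Un_le[OF S B])
  also have "\<dots> \<le> u ^ 259 + 434 * u ^ 20" using bad oc(2) unfolding r\<nu> by linarith
  also have "\<dots> \<le> 435 * u" using ud[of 1 259] ud[of 1 20] by simp
  also have "\<dots> \<le> C * u" using K0 u0 by (simp add: C)
  finally show ?thesis using prob_compl[OF E] by simp
qed

theorem theorem1p6:
  shows "\<exists>\<epsilon> \<delta> :: nat \<Rightarrow> real.
    \<epsilon> \<in> o(\<lambda>_. 1) \<and> \<delta> \<in> o(\<lambda>_. 1) \<and>
    (\<forall>n d \<mu>. n \<ge> 1 \<longrightarrow> real n powr 0.99 \<le> real d \<longrightarrow> d \<le> n \<longrightarrow> uniform_subspace_law n d \<mu> \<longrightarrow>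
      measure \<mu> {V \<in> space \<mu>. \<exists>M. sos4_solution n M \<and>
        sos4_value n (orth_proj n V) M \<ge> 1 - \<epsilon> n} \<ge> 1 - \<delta> n)"
proof -
  have o: "(\<lambda>n. c * (1 / real n powr 0.01)) \<in> o(\<lambda>_. 1)" for c :: real
    by real_asymp
  define C :: real where "C = 435 + 2 * (\<Prod>j<23. 2 * (2 * real j + 1))"
  show ?thesis
    by (rule exI[of _ "\<lambda>n. 344 * (1 / real n powr 0.01)"], rule exI[of _ "\<lambda>n. C * (1 / real n powr 0.01)"])
      (intro conjI o allI impI sos4_event_prob_ge[OF _ _ _ _ refl C_def refl])
qed

end
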